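(* Let $g$ be an element of $\mathbb{F}\langle x_1,\ldots,x_n\rangle$. Then $g(x_1,\ldots,x_n)=0$ is a closed $C^*$-relation; that is, with $\mathcal{X}=\{x_1,\ldots,x_n\}$, the full subcategory of $\mathcal{F}_{\mathcal{X}}$ whose objects are the functions $f:\mathcal{X}\to A$ into $C^*$-algebras $A$ with $g(f(x_1),\ldots,f(x_n))=0$ is a closed $C^*$-relation on $\mathcal{X}$.
   Context: $C^*$-algebras need not be unital and $\{0\}$ is a $C^*$-algebra. For a set $\mathcal{X}$, let $\mathcal{F}_{\mathcal{X}}$ be the category whose objects are pairs $(j,A)$ with $A$ a $C^*$-algebra and $j:\mathcal{X}\to A$ a function, and whose morphisms $(j,A)\to(k,B)$ are all $*$-homomorphisms $\varphi:A\to B$ with $\varphi\circ j=k$. For a nonempty set $\Lambda$ and $C^*$-algebras $A_\lambda$, $\prod_{\lambda\in\Lambda}A_\lambda$ denotes the $C^*$-algebra of norm-bounded families, and $\prod f_\lambda$ is $x\mapsto\langle f_\lambda(x)\rangle_\lambda$. A $C^*$-relation on $\mathcal{X}$ is a full subcategory $\mathcal{R}$ of $\mathcal{F}_{\mathcal{X}}$ such that: (C1) the unique map $\mathcal{X}\to\{0\}$ is an object; (C2) if $\varphi:A\to B$ is an injective $*$-homomorphism of $C^*$-algebras, $f:\mathcal{X}\to A$ is a function and $\varphi\circ f$ is an object, then $f$ is an object; (C3) if $\varphi:A\to B$ is a $*$-homomorphism of $C^*$-algebras and $f:\mathcal{X}\to A$ is an object, then $\varphi\circ f$ is an object; (C4f)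 if $f_j:\mathcal{X}\to A_j$ is an object for $1\le j\le n$, then $\prod f_j:\mathcal{X}\to\prod_{j=1}^n A_j$ is an object. It is closed if (C4b): whenever $\Lambda$ is a nonempty set and $f_\lambda:\mathcal{X}\to A_\lambda$ ($\lambda\in\Lambda$) are objects with $\sup_\lambda\|f_\lambda(x)\|<\infty$ for every $x\in\mathcal{X}$, then $\prod f_\lambda:\mathcal{X}\to\prod_{\lambda}A_\lambda$ is an object. A pro-$C^*$-algebra is a topological $*$-algebra whose (Hausdorff) topology arises from, and is complete with respect to, a set of $C^*$-seminorms; morphisms are the continuous $*$-homomorphisms. $\mathbb{F}\langle x_1,\ldots,x_n\rangle$ is the free pro-$C^*$-algebra on $\mathcal{X}=\{x_1,\ldots,x_n\}$: the inverse limit, over functions $l:\mathcal{X}\to[0,\infty)$ ordered pointwise, of the universal $C^*$-algebras $C^*\langle\mathcal{X}\mid\|x\|\le l(x)\ \forall x\in\mathcal{X}\rangle$ with connecting maps sending generators to generators. Every function from $\mathcal{X}$ to a pro-$C^*$-algebra $A$ extends uniquely to a continuous $*$-homomorphism $\mathbb{F}\langle x_1,\ldots,x_n\rangle\to A$. For $a_1,\ldots,a_n$ in a pro-$C^*$-algebra $A$ (e.g. a $C^*$-algebra), $g(a_1,\ldots,a_n)=\varphi(g)$, where $\varphi:\mathbb{F}\langle x_1,\ldots,x_n\rangle\to A$ is the unique continuous $*$-homomorphism sending $x_j$ to $a_j$. *)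

theory Defs
  imports "HOL-Analysis.Analysis"
begin

section \<open>C*-algebras\<close>

text \<open>
  Complex *-algebras, C*-algebras and topological *-algebras are explicit structures with a
  carrier set, so that \<open>{0}\<close>, subalgebras and products over arbitrary index sets are all
  available. No unit is required.
\<close>

record 'a star_alg =
  carrier :: "'a set"
  zero :: 'a ("\<zero>\<index>")
  add :: "'a \<Rightarrow> 'a \<Rightarrow> 'a" (infixl "\<oplus>\<index>" 65)
  mult :: "'a \<Rightarrow> 'a \<Rightarrow> 'a" (infixl "\<otimes>\<index>" 70)
  scale :: "complex \<Rightarrow> 'a \<Rightarrow> 'a" (infixr "\<odot>\<index>" 75)
  star :: "'a \<Rightarrow> 'a"

record 'a cstar_alg = "'a star_alg" +
  nrm :: "'a \<Rightarrow> real" ("\<parallel>_\<parallel>\<index>")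

record 'a top_star_alg = "'a star_alg" +
  topol :: "'a topology"

definition star_minus :: "('a, 'm) star_alg_scheme \<Rightarrow> 'a \<Rightarrow> 'a \<Rightarrow> 'a" (infixl "\<ominus>\<index>" 65) where
  "x \<ominus>\<^bsub>A\<^esub> y = x \<oplus>\<^bsub>A\<^esub> (-1) \<odot>\<^bsub>A\<^esub> y"

locale star_algebra =
  fixes A :: "('a, 'm) star_alg_scheme" (structure)
  assumes zero_closed: "\<zero> \<in> carrier A"
    and add_closed: "\<lbrakk>x \<in> carrier A; y \<in> carrier A\<rbrakk> \<Longrightarrow> x \<oplus> y \<in> carrier A"
    and mult_closed: "\<lbrakk>x \<in> carrier A; y \<in> carrier A\<rbrakk> \<Longrightarrow> x \<otimes> y \<in> carrier A"
    and scale_closed: "x \<in> carrier A \<Longrightarrow> c \<odot> x \<in> carrier A"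
    and star_closed: "x \<in> carrier A \<Longrightarrow> star A x \<in> carrier A"
    and add_assoc: "\<lbrakk>x \<in> carrier A; y \<in> carrier A; z \<in> carrier A\<rbrakk>
        \<Longrightarrow> (x \<oplus> y) \<oplus> z = x \<oplus> (y \<oplus> z)"
    and add_commute: "\<lbrakk>x \<in> carrier A; y \<in> carrier A\<rbrakk> \<Longrightarrow> x \<oplus> y = y \<oplus> x"
    and add_zero: "x \<in> carrier A \<Longrightarrow> x \<oplus> \<zero> = x"
    and add_inverse: "x \<in> carrier A \<Longrightarrow> \<exists>y\<in>carrier A. x \<oplus> y = \<zero>"
    and scale_add: "\<lbrakk>x \<in> carrier A; y \<in> carrier A\<rbrakk> \<Longrightarrow> c \<odot> (x \<oplus> y) = c \<odot> x \<oplus> c \<odot> y"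
    and add_scale: "x \<in> carrier A \<Longrightarrow> (c + d) \<odot> x = c \<odot> x \<oplus> d \<odot> x"
    and scale_scale: "x \<in> carrier A \<Longrightarrow> c \<odot> d \<odot> x = (c * d) \<odot> x"
    and scale_one: "x \<in> carrier A \<Longrightarrow> 1 \<odot> x = x"
    and mult_assoc: "\<lbrakk>x \<in> carrier A; y \<in> carrier A; z \<in> carrier A\<rbrakk>
        \<Longrightarrow> (x \<otimes> y) \<otimes> z = x \<otimes> (y \<otimes> z)"
    and mult_add_left: "\<lbrakk>x \<in> carrier A; y \<in> carrier A; z \<in> carrier A\<rbrakk>
        \<Longrightarrow> (x \<oplus> y) \<otimes> z = x \<otimes> z \<oplus> y \<otimes> z"
    and mult_add_right: "\<lbrakk>x \<in> carrier A; y \<in> carrier A; z \<in> carrier A\<rbrakk>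
        \<Longrightarrow> x \<otimes> (y \<oplus> z) = x \<otimes> y \<oplus> x \<otimes> z"
    and mult_scale_left: "\<lbrakk>x \<in> carrier A; y \<in> carrier A\<rbrakk> \<Longrightarrow> (c \<odot> x) \<otimes> y = c \<odot> (x \<otimes> y)"
    and mult_scale_right: "\<lbrakk>x \<in> carrier A; y \<in> carrier A\<rbrakk> \<Longrightarrow> x \<otimes> (c \<odot> y) = c \<odot> (x \<otimes> y)"
    and star_star: "x \<in> carrier A \<Longrightarrow> star A (star A x) = x"
    and star_add: "\<lbrakk>x \<in> carrier A; y \<in> carrier A\<rbrakk> \<Longrightarrow> star A (x \<oplus> y) = star A x \<oplus> star A y"
    and star_mult: "\<lbrakk>x \<in> carrier A; y \<in> carrier A\<rbrakk> \<Longrightarrow> star A (x \<otimes> y) = star A y \<otimes> star A x"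
    and star_scale: "x \<in> carrier A \<Longrightarrow> star A (c \<odot> x) = cnj c \<odot> star A x"

definition cstar_seminorm :: "('a, 'm) star_alg_scheme \<Rightarrow> ('a \<Rightarrow> real) \<Rightarrow> bool" where
  "cstar_seminorm A p \<longleftrightarrow>
    (\<forall>x\<in>carrier A. 0 \<le> p x) \<and>
    (\<forall>x\<in>carrier A. \<forall>y\<in>carrier A. p (x \<oplus>\<^bsub>A\<^esub> y) \<le> p x + p y) \<and>
    (\<forall>c. \<forall>x\<in>carrier A. p (c \<odot>\<^bsub>A\<^esub> x) = cmod c * p x) \<and>
    (\<forall>x\<in>carrier A. \<forall>y\<in>carrier A. p (x \<otimes>\<^bsub>A\<^esub> y) \<le> p x * p y) \<and>
    (\<forall>x\<in>carrier A. p (star A x \<otimes>\<^bsub>A\<^esub> x) = (p x)\<^sup>2)"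

text \<open>
  The library's \<^locale>\<open>Metric_space\<close> asks for nonnegativity and symmetry on the whole type,
  hence the value 0 off the carrier.
\<close>

definition cstar_dist :: "('a, 'm) cstar_alg_scheme \<Rightarrow> 'a \<Rightarrow> 'a \<Rightarrow> real" where
  "cstar_dist A x y =
    (if x \<in> carrier A \<and> y \<in> carrier A then \<parallel>x \<ominus>\<^bsub>A\<^esub> y\<parallel>\<^bsub>A\<^esub> else 0)"

definition norm_topology :: "('a, 'm) cstar_alg_scheme \<Rightarrow> 'a topology" where
  "norm_topology A = Metric_space.mtopology (carrier A) (cstar_dist A)"

locale cstar_algebra = star_algebra A
  for A :: "('a, 'm) cstar_alg_scheme" (structure) +
  assumes seminorm: "cstar_seminorm A (nrm A)"
    and norm_eq_zero: "\<lbrakk>x \<in> carrier A; \<parallel>x\<parallel> = 0\<rbrakk> \<Longrightarrow> x = \<zero>"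
    and complete: "Metric_space.mcomplete (carrier A) (cstar_dist A)"

text \<open>
  Maps out of a carrier are taken extensional (value \<^const>\<open>undefined\<close> outside), so that equality
  of maps, and hence uniqueness, has its usual meaning; composites are formed with
  \<^const>\<open>compose\<close>.
\<close>

definition star_homs ::
  "('a, 'm) star_alg_scheme \<Rightarrow> ('b, 'k) star_alg_scheme \<Rightarrow> ('a \<Rightarrow> 'b) set" where
  "star_homs A B = {\<phi> \<in> carrier A \<rightarrow>\<^sub>E carrier B.
    (\<forall>x\<in>carrier A. \<forall>y\<in>carrier A. \<phi> (x \<oplus>\<^bsub>A\<^esub> y) = \<phi> x \<oplus>\<^bsub>B\<^esub> \<phi> y) \<and>
    (\<forall>c. \<forall>x\<in>carrier A. \<phi> (c \<odot>\<^bsub>A\<^esub> x) = c \<odot>\<^bsub>B\<^esub> \<phi> x) \<and>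
    (\<forall>x\<in>carrier A. \<forall>y\<in>carrier A. \<phi> (x \<otimes>\<^bsub>A\<^esub> y) = \<phi> x \<otimes>\<^bsub>B\<^esub> \<phi> y) \<and>
    (\<forall>x\<in>carrier A. \<phi> (star A x) = star B (\<phi> x))}"

definition cstar_prod :: "'i set \<Rightarrow> ('i \<Rightarrow> 'a cstar_alg) \<Rightarrow> ('i \<Rightarrow> 'a) cstar_alg" where
  "cstar_prod \<Lambda> A = \<lparr>
    carrier = {x \<in> (\<Pi>\<^sub>E i\<in>\<Lambda>. carrier (A i)). bdd_above ((\<lambda>i. \<parallel>x i\<parallel>\<^bsub>A i\<^esub>) ` \<Lambda>)},
    zero = (\<lambda>i\<in>\<Lambda>. \<zero>\<^bsub>A i\<^esub>),
    add = (\<lambda>x y. \<lambda>i\<in>\<Lambda>. x i \<oplus>\<^bsub>A i\<^esub> y i),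
    mult = (\<lambda>x y. \<lambda>i\<in>\<Lambda>. x i \<otimes>\<^bsub>A i\<^esub> y i),
    scale = (\<lambda>c x. \<lambda>i\<in>\<Lambda>. c \<odot>\<^bsub>A i\<^esub> x i),
    star = (\<lambda>x. \<lambda>i\<in>\<Lambda>. star (A i) (x i)),
    nrm = (\<lambda>x. SUP i\<in>\<Lambda>. \<parallel>x i\<parallel>\<^bsub>A i\<^esub>)\<rparr>"

definition prod_map :: "'x set \<Rightarrow> 'i set \<Rightarrow> ('i \<Rightarrow> 'x \<Rightarrow> 'a) \<Rightarrow> 'x \<Rightarrow> 'i \<Rightarrow> 'a" where
  "prod_map \<X> \<Lambda> f = (\<lambda>x\<in>\<X>. \<lambda>i\<in>\<Lambda>. f i x)"


section \<open>C*-relations\<close>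

text \<open>
  A full subcategory of \<open>\<F>\<^sub>\<X>\<close> is determined by its class of objects. HOL has no type of all
  C*-algebras, so such a class is given type by type: by a polymorphic constant whose instance at
  \<open>'a\<close> is the set of those objects \<open>(j, A)\<close> whose algebra has its carrier in \<open>'a\<close>. An axiom that
  links algebras over several types takes the corresponding instances as separate arguments. A
  class of objects is a (closed) C*-relation if the axioms hold for its instances at all types,
  i.e. as a theorem with free type variables. In the product axioms the factors have carriers in
  one common type \<open>'a\<close>, which every set of C*-algebras has up to renaming of elements.
\<close>

type_synonym ('x, 'a) fx_object = "('x \<Rightarrow> 'a) \<times> 'a cstar_alg"

definition fx_objects :: "'x set \<Rightarrow> ('x, 'a) fx_object set" where
  "fx_objects \<X> = {(j, A). cstar_algebra A \<and> j \<in> \<X> \<rightarrow>\<^sub>E carrier A}"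

definition axiom_C1 :: "'x set \<Rightarrow> ('x, 'a) fx_object set \<Rightarrow> bool" where
  "axiom_C1 \<X> R \<longleftrightarrow>
    (\<forall>A. cstar_algebra A \<and> carrier A = {\<zero>\<^bsub>A\<^esub>} \<longrightarrow> (\<lambda>x\<in>\<X>. \<zero>\<^bsub>A\<^esub>, A) \<in> R)"

definition axiom_C2 ::
  "'x set \<Rightarrow> ('x, 'a) fx_object set \<Rightarrow> ('x, 'b) fx_object set \<Rightarrow> bool" where
  "axiom_C2 \<X> Ra Rb \<longleftrightarrow>
    (\<forall>A B \<phi> f. cstar_algebra A \<and> cstar_algebra B \<and> \<phi> \<in> star_homs A B \<and> inj_on \<phi> (carrier A) \<and>
      f \<in> \<X> \<rightarrow>\<^sub>E carrier A \<and> (compose \<X> \<phi> f, B) \<in> Rb \<longrightarrow> (f, A) \<in> Ra)"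

definition axiom_C3 ::
  "'x set \<Rightarrow> ('x, 'a) fx_object set \<Rightarrow> ('x, 'b) fx_object set \<Rightarrow> bool" where
  "axiom_C3 \<X> Ra Rb \<longleftrightarrow>
    (\<forall>A B \<phi> f. cstar_algebra A \<and> cstar_algebra B \<and> \<phi> \<in> star_homs A B \<and> (f, A) \<in> Ra \<longrightarrow>
      (compose \<X> \<phi> f, B) \<in> Rb)"

definition axiom_C4f ::
  "'x set \<Rightarrow> ('x, 'a) fx_object set \<Rightarrow> ('x, nat \<Rightarrow> 'a) fx_object set \<Rightarrow> bool" where
  "axiom_C4f \<X> Ra Rn \<longleftrightarrow>
    (\<forall>n f A. n \<ge> 1 \<and> (\<forall>j\<in>{1..n}. (f j, A j) \<in> Ra) \<longrightarrow>
      (prod_map \<X> {1..n} f, cstar_prod {1..n} A) \<in> Rn)"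

definition axiom_C4b ::
  "'x set \<Rightarrow> ('x, 'a) fx_object set \<Rightarrow> ('x, 'i \<Rightarrow> 'a) fx_object set \<Rightarrow> bool" where
  "axiom_C4b \<X> Ra Ri \<longleftrightarrow>
    (\<forall>\<Lambda> f A. \<Lambda> \<noteq> {} \<and> (\<forall>i\<in>\<Lambda>. (f i, A i) \<in> Ra) \<and>
      (\<forall>x\<in>\<X>. bdd_above ((\<lambda>i. \<parallel>f i x\<parallel>\<^bsub>A i\<^esub>) ` \<Lambda>)) \<longrightarrow>
      (prod_map \<X> \<Lambda> f, cstar_prod \<Lambda> A) \<in> Ri)"

definition cstar_relation ::
  "'x set \<Rightarrow> ('x, 'a) fx_object set \<Rightarrow> ('x, 'b) fx_object set \<Rightarrow>
    ('x, nat \<Rightarrow> 'a) fx_object set \<Rightarrow> bool" where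
  "cstar_relation \<X> Ra Rb Rn \<longleftrightarrow>
    Ra \<subseteq> fx_objects \<X> \<and> axiom_C1 \<X> Ra \<and> axiom_C2 \<X> Ra Rb \<and> axiom_C3 \<X> Ra Rb \<and> axiom_C4f \<X> Ra Rn"

definition closed_cstar_relation ::
  "'x set \<Rightarrow> ('x, 'a) fx_object set \<Rightarrow> ('x, 'b) fx_object set \<Rightarrow>
    ('x, nat \<Rightarrow> 'a) fx_object set \<Rightarrow> ('x, 'i \<Rightarrow> 'a) fx_object set \<Rightarrow> bool" where
  "closed_cstar_relation \<X> Ra Rb Rn Ri \<longleftrightarrow> cstar_relation \<X> Ra Rb Rn \<and> axiom_C4b \<X> Ra Ri"


section \<open>The universal C*-algebras \<open>C*\<langle>\<X> | \<parallel>x\<parallel> \<le> l(x)\<rangle>\<close>\<close>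

text \<open>
  The free (non-unital) complex *-algebra on \<open>\<X>\<close>: finitely supported functions on the nonempty
  words in the letters \<open>x, x\<^sup>*\<close> for \<open>x \<in> \<X>\<close>, with convolution as product.
\<close>

datatype 'x letter = Gen 'x | Adj 'x

primrec adj_letter :: "'x letter \<Rightarrow> 'x letter" where
  "adj_letter (Gen x) = Adj x"
| "adj_letter (Adj x) = Gen x"

type_synonym 'x star_poly = "'x letter list \<Rightarrow> complex"

definition star_words :: "'x set \<Rightarrow> 'x letter list set" where
  "star_words \<X> = {w. w \<noteq> [] \<and> set w \<subseteq> Gen ` \<X> \<union> Adj ` \<X>}"

definition free_star_alg :: "'x set \<Rightarrow> 'x star_poly star_alg" where
  "free_star_alg \<X> = \<lparr>
    carrier = {p. finite {w. p w \<noteq> 0} \<and> {w. p w \<noteq> 0} \<subseteq> star_words \<X>},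
    zero = (\<lambda>w. 0),
    add = (\<lambda>p q w. p w + q w),
    mult = (\<lambda>p q w. \<Sum>i\<le>length w. p (take i w) * q (drop i w)),
    scale = (\<lambda>c p w. c * p w),
    star = (\<lambda>p w. cnj (p (rev (map adj_letter w))))\<rparr>"

definition free_gen :: "'x \<Rightarrow> 'x star_poly" where
  "free_gen x = (\<lambda>w. if w = [Gen x] then 1 else 0)"

text \<open>
  \<open>C*\<langle>\<X> | \<parallel>x\<parallel> \<le> l(x)\<rangle>\<close> is the Hausdorff completion of the free *-algebra in its largest
  C*-seminorm \<open>p\<close> with \<open>p(x) \<le> l(x)\<close> for all \<open>x \<in> \<X>\<close>. (The set of values below is bounded above:
  each such \<open>p\<close> satisfies \<open>p(x\<^sup>*) = p(x) \<le> l(x)\<close>, and these bound \<open>p\<close> on every *-polynomial.)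
\<close>

definition univ_seminorm :: "'x set \<Rightarrow> ('x \<Rightarrow> real) \<Rightarrow> 'x star_poly \<Rightarrow> real" where
  "univ_seminorm \<X> l w =
    Sup {p w | p. cstar_seminorm (free_star_alg \<X>) p \<and> (\<forall>x\<in>\<X>. p (free_gen x) \<le> l x)}"

text \<open>
  The Hausdorff completion of a *-algebra in a C*-seminorm: Cauchy sequences modulo null sequences.
\<close>

definition cauchy_seqs :: "('a, 'm) star_alg_scheme \<Rightarrow> ('a \<Rightarrow> real) \<Rightarrow> (nat \<Rightarrow> 'a) set" where
  "cauchy_seqs B p = {s. (\<forall>n. s n \<in> carrier B) \<and>
    (\<forall>\<epsilon>>0. \<exists>N. \<forall>m\<ge>N. \<forall>n\<ge>N. p (s m \<ominus>\<^bsub>B\<^esub> s n) < \<epsilon>)}"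

definition null_rel ::
  "('a, 'm) star_alg_scheme \<Rightarrow> ('a \<Rightarrow> real) \<Rightarrow> ((nat \<Rightarrow> 'a) \<times> (nat \<Rightarrow> 'a)) set" where
  "null_rel B p = {(s, t). s \<in> cauchy_seqs B p \<and> t \<in> cauchy_seqs B p \<and>
    (\<lambda>n. p (s n \<ominus>\<^bsub>B\<^esub> t n)) \<longlonglongrightarrow> 0}"

definition completion ::
  "('a, 'm) star_alg_scheme \<Rightarrow> ('a \<Rightarrow> real) \<Rightarrow> (nat \<Rightarrow> 'a) set cstar_alg" where
  "completion B p = \<lparr>
    carrier = cauchy_seqs B p // null_rel B p,
    zero = null_rel B p `` {\<lambda>n. \<zero>\<^bsub>B\<^esub>},
    add = (\<lambda>u v. \<Union>s\<in>u. \<Union>t\<in>v. null_rel B p `` {\<lambda>n. s n \<oplus>\<^bsub>B\<^esub> t n}),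
    mult = (\<lambda>u v. \<Union>s\<in>u. \<Union>t\<in>v. null_rel B p `` {\<lambda>n. s n \<otimes>\<^bsub>B\<^esub> t n}),
    scale = (\<lambda>c u. \<Union>s\<in>u. null_rel B p `` {\<lambda>n. c \<odot>\<^bsub>B\<^esub> s n}),
    star = (\<lambda>u. \<Union>s\<in>u. null_rel B p `` {\<lambda>n. star B (s n)}),
    nrm = (\<lambda>u. THE r. \<forall>s\<in>u. (\<lambda>n. p (s n)) \<longlonglongrightarrow> r)\<rparr>"

type_synonym 'x univ_elem = "(nat \<Rightarrow> 'x star_poly) set"

definition univ_cstar :: "'x set \<Rightarrow> ('x \<Rightarrow> real) \<Rightarrow> 'x univ_elem cstar_alg" where
  "univ_cstar \<X> l = completion (free_star_alg \<X>) (univ_seminorm \<X> l)"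

definition univ_gen :: "'x set \<Rightarrow> ('x \<Rightarrow> real) \<Rightarrow> 'x \<Rightarrow> 'x univ_elem" where
  "univ_gen \<X> l x = null_rel (free_star_alg \<X>) (univ_seminorm \<X> l) `` {\<lambda>n. free_gen x}"


section \<open>The free pro-C*-algebra\<close>

text \<open>
  The unique *-homomorphism from \<open>C*\<langle>\<X> | \<parallel>x\<parallel> \<le> l'(x)\<rangle>\<close> to \<open>C*\<langle>\<X> | \<parallel>x\<parallel> \<le> l(x)\<rangle>\<close>, for \<open>l \<le> l'\<close>,
  that sends generators to generators.
\<close>

definition univ_conn ::
  "'x set \<Rightarrow> ('x \<Rightarrow> real) \<Rightarrow> ('x \<Rightarrow> real) \<Rightarrow> 'x univ_elem \<Rightarrow> 'x univ_elem" where
  "univ_conn \<X> l' l = (THE \<pi>. \<pi> \<in> star_homs (univ_cstar \<X> l') (univ_cstar \<X> l) \<and>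
    (\<forall>x\<in>\<X>. \<pi> (univ_gen \<X> l' x) = univ_gen \<X> l x))"

definition bounds :: "'x set \<Rightarrow> ('x \<Rightarrow> real) set" where
  "bounds \<X> = \<X> \<rightarrow>\<^sub>E {0..}"

type_synonym 'x pro_elem = "('x \<Rightarrow> real) \<Rightarrow> 'x univ_elem"

definition free_pro_carrier :: "'x set \<Rightarrow> 'x pro_elem set" where
  "free_pro_carrier \<X> = {u \<in> (\<Pi>\<^sub>E l\<in>bounds \<X>. carrier (univ_cstar \<X> l)).
    \<forall>l\<in>bounds \<X>. \<forall>l'\<in>bounds \<X>. (\<forall>x\<in>\<X>. l x \<le> l' x) \<longrightarrow> univ_conn \<X> l' l (u l') = u l}"

definition free_pro_cstar :: "'x set \<Rightarrow> 'x pro_elem top_star_alg" where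
  "free_pro_cstar \<X> = \<lparr>
    carrier = free_pro_carrier \<X>,
    zero = (\<lambda>l\<in>bounds \<X>. \<zero>\<^bsub>univ_cstar \<X> l\<^esub>),
    add = (\<lambda>u v. \<lambda>l\<in>bounds \<X>. u l \<oplus>\<^bsub>univ_cstar \<X> l\<^esub> v l),
    mult = (\<lambda>u v. \<lambda>l\<in>bounds \<X>. u l \<otimes>\<^bsub>univ_cstar \<X> l\<^esub> v l),
    scale = (\<lambda>c u. \<lambda>l\<in>bounds \<X>. c \<odot>\<^bsub>univ_cstar \<X> l\<^esub> u l),
    star = (\<lambda>u. \<lambda>l\<in>bounds \<X>. star (univ_cstar \<X> l) (u l)),
    topol = subtopology
      (product_topology (\<lambda>l. norm_topology (univ_cstar \<X> l)) (bounds \<X>)) (free_pro_carrier \<X>)\<rparr>"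

definition free_pro_gen :: "'x set \<Rightarrow> 'x \<Rightarrow> 'x pro_elem" where
  "free_pro_gen \<X> x = (\<lambda>l\<in>bounds \<X>. univ_gen \<X> l x)"

definition cont_star_homs :: "'a top_star_alg \<Rightarrow> 'b top_star_alg \<Rightarrow> ('a \<Rightarrow> 'b) set" where
  "cont_star_homs P Q = {\<phi> \<in> star_homs P Q. continuous_map (topol P) (topol Q) \<phi>}"

text \<open>A C*-algebra regarded as a pro-C*-algebra.\<close>

definition as_pro_cstar :: "'a cstar_alg \<Rightarrow> 'a top_star_alg" where
  "as_pro_cstar A =
    \<lparr>carrier = carrier A, zero = zero A, add = add A, mult = mult A, scale = scale A, star = star A,
     topol = norm_topology A\<rparr>"

text \<open>
  \<open>pro_eval n x P a g\<close> is \<open>g(a\<^sub>1, \<dots>, a\<^sub>n)\<close>, for \<open>g \<in> \<FF>\<langle>x\<^sub>1, \<dots>, x\<^sub>n\<rangle>\<close> and \<open>a\<^sub>1, \<dots>, a\<^sub>n\<close> in the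
  pro-C*-algebra \<open>P\<close>.
\<close>

definition pro_eval ::
  "nat \<Rightarrow> (nat \<Rightarrow> 'x) \<Rightarrow> 'a top_star_alg \<Rightarrow> (nat \<Rightarrow> 'a) \<Rightarrow> 'x pro_elem \<Rightarrow> 'a" where
  "pro_eval n x P a g = (THE \<phi>. \<phi> \<in> cont_star_homs (free_pro_cstar (x ` {1..n})) P \<and>
    (\<forall>j\<in>{1..n}. \<phi> (free_pro_gen (x ` {1..n}) (x j)) = a j)) g"

definition zero_relation ::
  "nat \<Rightarrow> (nat \<Rightarrow> 'x) \<Rightarrow> 'x pro_elem \<Rightarrow> ('x, 'a) fx_object set" where
  "zero_relation n x g = {(f, A) \<in> fx_objects (x ` {1..n}).
    pro_eval n x (as_pro_cstar A) (\<lambda>j. f (x j)) g = \<zero>\<^bsub>A\<^esub>}"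

end

theory Submission
  imports Defs
begin

text \<open>
  Evaluating \<open>g\<close> commutes with *-homomorphisms: if \<open>\<phi>: A \<rightarrow> B\<close> is a *-homomorphism of C*-algebras, then
  \<open>\<phi> (g(a\<^sub>1, \<dots>, a\<^sub>n)) = g(\<phi> a\<^sub>1, \<dots>, \<phi> a\<^sub>n)\<close>, because \<open>\<phi>\<close> composed with evaluation at \<open>a\<close> is a continuous
  *-homomorphism that takes the generators to the elements \<open>\<phi> a\<^sub>j\<close>, and there is only one such map
  (\<open>pro_eval_natural\<close>). All axioms follow from this. (C1) is trivial; (C3) holds because
  \<open>\<phi> 0 = 0\<close>, and (C2) because an injective \<open>\<phi>\<close> takes only 0 to 0. For (C4f) and (C4b) it is applied to
  the coordinate projections of a product: they take the value of \<open>g\<close> in the product to its values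
  in the factors, and a family all of whose coordinates vanish is 0.

  The rest of the proof establishes the existence and uniqueness of evaluation. The universal
  C*-algebra with bounds \<open>l\<close> is a completion, and a *-homomorphism out of the free *-algebra
  that respects the bounds extends to it (\<open>completion_extension\<close>, \<open>univ_hom_exists\<close>). With
  \<open>l(x) = \<parallel>f(x)\<parallel>\<close>, the projection of the inverse limit to its component at \<open>l\<close> followed by such an
  extension is evaluation at \<open>f\<close> (\<open>pro_hom_exists\<close>). It is unique because the *-polynomials are dense in
  the inverse limit (\<open>pro_poly_dense\<close>): the index set is directed, so an approximation in a single
  component gives approximations in any finite set of components.

  The maps between C*-algebras that occur here - connecting maps, and the \<open>\<phi>\<close> of (C2) and (C3) - are
  not assumed to be continuous. That they are contractive (\<open>star_hom_contractive\<close>) is shown without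
  spectral theory. For a self-adjoint \<open>a\<close> with \<open>\<parallel>a\<parallel> < 1\<close>, an element \<open>d = 1 - (1 - a\<^sup>2)\<^sup>1\<^sup>/\<^sup>2\<close> is found as the
  fixed point of the contraction \<open>d \<mapsto> (a\<^sup>2 + d\<^sup>2) / 2\<close>. Its image makes \<open>\<phi> a + i (1 - \<phi> d)\<close> unitary, so
  \<open>\<phi> a\<close> is the mean of two unitaries and has norm at most 1.
\<close>

section \<open>Calculation in *-algebras and C*-seminorms\<close>

context star_algebra
begin

lemmas closed [simp, intro] = zero_closed add_closed mult_closed scale_closed star_closed

lemma zero_add [simp]: "x \<in> carrier A \<Longrightarrow> \<zero> \<oplus> x = x"
  by (simp add: add_commute add_zero)

lemma add_left_commute:
  "\<lbrakk>x \<in> carrier A; y \<in> carrier A; z \<in> carrier A\<rbrakk> \<Longrightarrow> x \<oplus> (y \<oplus> z) = y \<oplus> (x \<oplus> z)"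
  by (metis add_assoc add_commute)

lemmas add_ac = add_assoc add_commute add_left_commute

lemma add_left_cancel:
  assumes "x \<in> carrier A" "y \<in> carrier A" "z \<in> carrier A"
  shows "x \<oplus> y = x \<oplus> z \<longleftrightarrow> y = z"
proof
  assume eq: "x \<oplus> y = x \<oplus> z"
  obtain x' where x': "x' \<in> carrier A" "x \<oplus> x' = \<zero>"
    using add_inverse assms(1) by blast
  then have "x' \<oplus> x = \<zero>"
    using assms(1) by (simp add: add_commute)
  then have "x' \<oplus> (x \<oplus> w) = w" if "w \<in> carrier A" for w
    using add_assoc[of x' x w] assms(1) x'(1) that by simp
  from this[OF assms(2)] this[OF assms(3)] eq show "y = z" by metis
qed simp

lemma scale_zero_left [simp]: "x \<in> carrier A \<Longrightarrow> 0 \<odot> x = \<zero>"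
  using add_scale[of x 0 0] add_left_cancel[of "0 \<odot> x" "0 \<odot> x" \<zero>] by (simp add: add_zero)

lemma scale_zero_right [simp]: "c \<odot> \<zero> = \<zero>"
  using scale_scale[of \<zero> c 0] by simp

lemma mult_zero_left [simp]: "x \<in> carrier A \<Longrightarrow> \<zero> \<otimes> x = \<zero>"
  using mult_scale_left[of \<zero> x 0] by simp

lemma mult_zero_right [simp]: "x \<in> carrier A \<Longrightarrow> x \<otimes> \<zero> = \<zero>"
  using mult_scale_right[of x \<zero> 0] by simp

lemma star_zero [simp]: "star A \<zero> = \<zero>"
  using star_scale[of \<zero> 0] by simp

lemma minus_closed [simp, intro]: "\<lbrakk>x \<in> carrier A; y \<in> carrier A\<rbrakk> \<Longrightarrow> x \<ominus> y \<in> carrier A"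
  by (simp add: star_minus_def)

lemma minus_self [simp]: "x \<in> carrier A \<Longrightarrow> x \<ominus> x = \<zero>"
  using add_scale[of x 1 "-1"] by (simp add: star_minus_def scale_one)

lemma minus_zero [simp]: "x \<in> carrier A \<Longrightarrow> x \<ominus> \<zero> = x"
  by (simp add: star_minus_def add_zero)

lemma minus_add_minus:
  assumes "x \<in> carrier A" "y \<in> carrier A" "z \<in> carrier A"
  shows "(x \<ominus> y) \<oplus> (y \<ominus> z) = x \<ominus> z"
proof -
  have "(x \<ominus> y) \<oplus> (y \<ominus> z) = x \<oplus> ((y \<ominus> y) \<oplus> (-1) \<odot> z)"
    using assms by (simp add: star_minus_def add_ac)
  also have "\<dots> = x \<oplus> (-1) \<odot> z"
    using assms by simp
  finally show ?thesis by (simp only: star_minus_def)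
qed

lemma minus_add_cancel: "\<lbrakk>x \<in> carrier A; y \<in> carrier A\<rbrakk> \<Longrightarrow> (x \<ominus> y) \<oplus> y = x"
  using minus_add_minus[of x y \<zero>] by simp

lemma eq_if_minus_eq_zero:
  "\<lbrakk>x \<in> carrier A; y \<in> carrier A; x \<ominus> y = \<zero>\<rbrakk> \<Longrightarrow> x = y"
  using minus_add_cancel[of x y] by simp

lemma minus_swap: "\<lbrakk>x \<in> carrier A; y \<in> carrier A\<rbrakk> \<Longrightarrow> (-1) \<odot> (x \<ominus> y) = y \<ominus> x"
  by (simp add: star_minus_def scale_add scale_scale scale_one add_commute)

lemma add_minus_add:
  "\<lbrakk>x \<in> carrier A; y \<in> carrier A; x' \<in> carrier A; y' \<in> carrier A\<rbrakk>
    \<Longrightarrow> (x \<oplus> y) \<ominus> (x' \<oplus> y') = (x \<ominus> x') \<oplus> (y \<ominus> y')"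
  by (simp add: star_minus_def scale_add add_ac)

lemma scale_minus: "\<lbrakk>x \<in> carrier A; y \<in> carrier A\<rbrakk> \<Longrightarrow> c \<odot> (x \<ominus> y) = c \<odot> x \<ominus> c \<odot> y"
  by (simp add: star_minus_def scale_add scale_scale mult.commute)

lemma star_minus: "\<lbrakk>x \<in> carrier A; y \<in> carrier A\<rbrakk> \<Longrightarrow> star A (x \<ominus> y) = star A x \<ominus> star A y"
  by (simp add: star_minus_def star_add star_scale)

lemma mult_minus_left:
  "\<lbrakk>x \<in> carrier A; y \<in> carrier A; z \<in> carrier A\<rbrakk> \<Longrightarrow> (x \<ominus> y) \<otimes> z = x \<otimes> z \<ominus> y \<otimes> z"
  by (simp add: star_minus_def mult_add_left mult_scale_left)

lemma mult_minus_right: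
  "\<lbrakk>x \<in> carrier A; y \<in> carrier A; z \<in> carrier A\<rbrakk> \<Longrightarrow> x \<otimes> (y \<ominus> z) = x \<otimes> y \<ominus> x \<otimes> z"
  by (simp add: star_minus_def mult_add_right mult_scale_right)

lemma mult_minus_mult:
  "\<lbrakk>x \<in> carrier A; y \<in> carrier A; x' \<in> carrier A; y' \<in> carrier A\<rbrakk>
    \<Longrightarrow> x \<otimes> y \<ominus> x' \<otimes> y' = x \<otimes> (y \<ominus> y') \<oplus> (x \<ominus> x') \<otimes> y'"
  by (simp add: mult_minus_left mult_minus_right minus_add_minus)

end

lemma star_homsD:
  assumes "\<phi> \<in> star_homs A B"
  shows "x \<in> carrier A \<Longrightarrow> \<phi> x \<in> carrier B"
    and "\<lbrakk>x \<in> carrier A; y \<in> carrier A\<rbrakk> \<Longrightarrow> \<phi> (x \<oplus>\<^bsub>A\<^esub> y) = \<phi> x \<oplus>\<^bsub>B\<^esub> \<phi> y"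
    and "x \<in> carrier A \<Longrightarrow> \<phi> (c \<odot>\<^bsub>A\<^esub> x) = c \<odot>\<^bsub>B\<^esub> \<phi> x"
    and "\<lbrakk>x \<in> carrier A; y \<in> carrier A\<rbrakk> \<Longrightarrow> \<phi> (x \<otimes>\<^bsub>A\<^esub> y) = \<phi> x \<otimes>\<^bsub>B\<^esub> \<phi> y"
    and "x \<in> carrier A \<Longrightarrow> \<phi> (star A x) = star B (\<phi> x)"
    and "\<phi> \<in> extensional (carrier A)"
  using assms by (auto simp: star_homs_def PiE_iff)

lemma star_homsI:
  assumes "\<And>x. x \<in> carrier A \<Longrightarrow> \<phi> x \<in> carrier B"
    and "\<And>x y. \<lbrakk>x \<in> carrier A; y \<in> carrier A\<rbrakk> \<Longrightarrow> \<phi> (x \<oplus>\<^bsub>A\<^esub> y) = \<phi> x \<oplus>\<^bsub>B\<^esub> \<phi> y"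
    and "\<And>c x. x \<in> carrier A \<Longrightarrow> \<phi> (c \<odot>\<^bsub>A\<^esub> x) = c \<odot>\<^bsub>B\<^esub> \<phi> x"
    and "\<And>x y. \<lbrakk>x \<in> carrier A; y \<in> carrier A\<rbrakk> \<Longrightarrow> \<phi> (x \<otimes>\<^bsub>A\<^esub> y) = \<phi> x \<otimes>\<^bsub>B\<^esub> \<phi> y"
    and "\<And>x. x \<in> carrier A \<Longrightarrow> \<phi> (star A x) = star B (\<phi> x)"
    and "\<phi> \<in> extensional (carrier A)"
  shows "\<phi> \<in> star_homs A B"
  using assms by (auto simp: star_homs_def PiE_iff)

lemma star_homs_eqI:
  assumes "\<phi> \<in> star_homs A B" "\<psi> \<in> star_homs A B" "\<And>x. x \<in> carrier A \<Longrightarrow> \<phi> x = \<psi> x"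
  shows "\<phi> = \<psi>"
  using assms by (meson extensionalityI star_homsD(6))

lemma star_hom_zero:
  assumes "star_algebra A" "star_algebra B" "\<phi> \<in> star_homs A B"
  shows "\<phi> \<zero>\<^bsub>A\<^esub> = \<zero>\<^bsub>B\<^esub>"
proof -
  interpret A: star_algebra A by fact
  interpret B: star_algebra B by fact
  show ?thesis
    using star_homsD(1)[OF assms(3), of "\<zero>\<^bsub>A\<^esub>"] star_homsD(3)[OF assms(3), of "\<zero>\<^bsub>A\<^esub>" 0] by simp
qed

lemma star_hom_minus:
  assumes "star_algebra A" "\<phi> \<in> star_homs A B" "x \<in> carrier A" "y \<in> carrier A"
  shows "\<phi> (x \<ominus>\<^bsub>A\<^esub> y) = \<phi> x \<ominus>\<^bsub>B\<^esub> \<phi> y"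
proof -
  interpret A: star_algebra A by fact
  show ?thesis
    using assms(3,4) star_homsD[OF assms(2)] by (simp add: star_minus_def)
qed

lemma star_homs_compose:
  assumes "star_algebra A" "\<phi> \<in> star_homs A B" "\<psi> \<in> star_homs B C"
  shows "compose (carrier A) \<psi> \<phi> \<in> star_homs A C"
proof -
  interpret A: star_algebra A by fact
  show ?thesis
    using star_homsD[OF assms(2)] star_homsD[OF assms(3)]
    by (intro star_homsI) (simp_all add: compose_def)
qed

text \<open>A *-algebra with a distinguished C*-seminorm, which need not be definite or complete.\<close>

locale seminormed_star_algebra = star_algebra A for A :: "('a, 'm) star_alg_scheme" (structure) +
  fixes p :: "'a \<Rightarrow> real"
  assumes cstar_seminorm: "cstar_seminorm A p"
begin

lemma p_nonneg [simp]: "x \<in> carrier A \<Longrightarrow> 0 \<le> p x"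
  and p_add: "\<lbrakk>x \<in> carrier A; y \<in> carrier A\<rbrakk> \<Longrightarrow> p (x \<oplus> y) \<le> p x + p y"
  and p_scale: "x \<in> carrier A \<Longrightarrow> p (c \<odot> x) = cmod c * p x"
  and p_mult: "\<lbrakk>x \<in> carrier A; y \<in> carrier A\<rbrakk> \<Longrightarrow> p (x \<otimes> y) \<le> p x * p y"
  and p_star_mult: "x \<in> carrier A \<Longrightarrow> p (star A x \<otimes> x) = (p x)\<^sup>2"
  using cstar_seminorm by (auto simp: cstar_seminorm_def)

lemma p_zero [simp]: "p \<zero> = 0"
  using p_scale[of \<zero> 0] by simp

lemma p_star [simp]:
  assumes "x \<in> carrier A"
  shows "p (star A x) = p x"
proof -
  have le: "p y \<le> p (star A y)" if "y \<in> carrier A" for y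
  proof (cases "p y = 0")
    case False
    then have "0 < p y" using that p_nonneg[of y] by linarith
    moreover have "p y * p y \<le> p (star A y) * p y"
      using that p_mult[of "star A y" y] p_star_mult[of y] by (simp add: power2_eq_square)
    ultimately show ?thesis by simp
  qed (use that in simp)
  from le[of x] le[of "star A x"] assms show ?thesis
    by (simp add: star_star)
qed

lemma p_minus_commute: "\<lbrakk>x \<in> carrier A; y \<in> carrier A\<rbrakk> \<Longrightarrow> p (x \<ominus> y) = p (y \<ominus> x)"
  using p_scale[of "x \<ominus> y" "-1"] by (simp add: minus_swap)

lemma p_triangle:
  "\<lbrakk>x \<in> carrier A; y \<in> carrier A; z \<in> carrier A\<rbrakk> \<Longrightarrow> p (x \<ominus> z) \<le> p (x \<ominus> y) + p (y \<ominus> z)"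
  using p_add[of "x \<ominus> y" "y \<ominus> z"] by (simp add: minus_add_minus)

lemma p_abs_diff: 
  assumes "x \<in> carrier A" "y \<in> carrier A"
  shows "\<bar>p x - p y\<bar> \<le> p (x \<ominus> y)"
  using p_triangle[of x y \<zero>] p_triangle[of y x \<zero>] p_minus_commute[of x y] assms by simp

lemma p_mult_minus_mult:
  assumes "x \<in> carrier A" "y \<in> carrier A" "x' \<in> carrier A" "y' \<in> carrier A"
  shows "p (x \<otimes> y \<ominus> x' \<otimes> y') \<le> p x * p (y \<ominus> y') + p (x \<ominus> x') * p y'"
proof -
  have "p (x \<otimes> y \<ominus> x' \<otimes> y') \<le> p (x \<otimes> (y \<ominus> y')) + p ((x \<ominus> x') \<otimes> y')"
    using assms by (simp add: mult_minus_mult p_add)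
  also have "\<dots> \<le> p x * p (y \<ominus> y') + p (x \<ominus> x') * p y'"
    using assms by (intro add_mono p_mult) simp_all
  finally show ?thesis .
qed

end

section \<open>Norm completeness\<close>

text \<open>The seminorm is a norm; the *-algebra need not be complete.\<close>

locale normed_star_algebra = seminormed_star_algebra +
  assumes p_eq_zero: "\<lbrakk>x \<in> carrier A; p x = 0\<rbrakk> \<Longrightarrow> x = \<zero>"
begin

lemma p_minus_eq_zero_iff: "\<lbrakk>x \<in> carrier A; y \<in> carrier A\<rbrakk> \<Longrightarrow> p (x \<ominus> y) = 0 \<longleftrightarrow> x = y"
  by (metis eq_if_minus_eq_zero minus_closed minus_self p_eq_zero p_zero)

lemma limit_unique:
  assumes "\<And>n. s n \<in> carrier A" "a \<in> carrier A" "b \<in> carrier A"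
    and "(\<lambda>n. p (s n \<ominus> a)) \<longlonglongrightarrow> 0" "(\<lambda>n. p (s n \<ominus> b)) \<longlonglongrightarrow> 0"
  shows "a = b"
proof -
  have "(\<lambda>n. p (s n \<ominus> a) + p (s n \<ominus> b)) \<longlonglongrightarrow> 0 + 0"
    by (intro tendsto_add assms)
  moreover have "p (a \<ominus> b) \<le> p (s n \<ominus> a) + p (s n \<ominus> b)" for n
    using p_triangle[of a "s n" b] p_minus_commute[of a "s n"] assms(1-3) by simp
  ultimately have "p (a \<ominus> b) \<le> 0"
    by (intro LIMSEQ_le_const[where X = "\<lambda>n. p (s n \<ominus> a) + p (s n \<ominus> b)"]) auto
  with assms(2,3) have "p (a \<ominus> b) = 0"
    by (simp add: order_antisym)
  with assms(2,3) show ?thesis by (simp add: p_minus_eq_zero_iff)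
qed

end

lemma Metric_space_cstar_dist:
  assumes "normed_star_algebra A (nrm A)"
  shows "Metric_space (carrier A) (cstar_dist A)"
proof -
  interpret normed_star_algebra A "nrm A" by fact
  show ?thesis
    by standard
      (auto simp: cstar_dist_def p_minus_eq_zero_iff p_triangle intro: p_minus_commute)
qed

text \<open>
  Completeness of a set of elements in the metric of the norm. The set is arbitrary, as the
  fixed point theorem below is applied to a closed subset of a C*-algebra.
\<close>

lemma mcomplete_cstar_dist_iff:
  assumes "normed_star_algebra A (nrm A)" and "D \<subseteq> carrier A"
  shows "Metric_space.mcomplete D (cstar_dist A) \<longleftrightarrow>
    (\<forall>s. (\<forall>n. s n \<in> D) \<and> s \<in> cauchy_seqs A (nrm A) \<longrightarrow>
      (\<exists>a\<in>D. (\<lambda>n. \<parallel>s n \<ominus>\<^bsub>A\<^esub> a\<parallel>\<^bsub>A\<^esub>) \<longlonglongrightarrow> 0))"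
proof -
  interpret normed_star_algebra A "nrm A" by fact
  interpret M: Metric_space D "cstar_dist A"
    using Metric_space.subspace[OF Metric_space_cstar_dist[OF assms(1)] assms(2)] .
  have dist: "cstar_dist A x y = \<parallel>x \<ominus>\<^bsub>A\<^esub> y\<parallel>\<^bsub>A\<^esub>" if "x \<in> D" "y \<in> D" for x y
    using that assms(2) by (auto simp: cstar_dist_def)
  have cauchy: "M.MCauchy s \<longleftrightarrow> (\<forall>n. s n \<in> D) \<and> s \<in> cauchy_seqs A (nrm A)" for s
  proof (cases "\<forall>n. s n \<in> D")
    case True
    then show ?thesis
      using assms(2) unfolding M.MCauchy_def cauchy_seqs_def by (auto simp: dist image_subset_iff)
  qed (auto simp: M.MCauchy_def)
  have lim: "limitin M.mtopology s a sequentially \<longleftrightarrow>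
      a \<in> D \<and> (\<lambda>n. \<parallel>s n \<ominus>\<^bsub>A\<^esub> a\<parallel>\<^bsub>A\<^esub>) \<longlonglongrightarrow> 0" if "\<forall>n. s n \<in> D" for s a
  proof (cases "a \<in> D")
    case True
    have "\<parallel>s n \<ominus>\<^bsub>A\<^esub> a\<parallel>\<^bsub>A\<^esub> \<ge> 0" for n
      using that True assms(2) by (simp add: subset_iff)
    then show ?thesis
      using that True by (simp add: M.limit_metric_sequentially dist LIMSEQ_iff)
  qed (simp add: M.limit_metric_sequentially)
  show ?thesis
    unfolding M.mcomplete_def by (metis cauchy lim)
qed

lemma cstar_algebraI:
  assumes "normed_star_algebra A (nrm A)"
    and "\<And>s. s \<in> cauchy_seqs A (nrm A) \<Longrightarrow>
      \<exists>a\<in>carrier A. (\<lambda>n. \<parallel>s n \<ominus>\<^bsub>A\<^esub> a\<parallel>\<^bsub>A\<^esub>) \<longlonglongrightarrow> 0"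
  shows "cstar_algebra A"
proof -
  interpret normed_star_algebra A "nrm A" by fact
  show ?thesis
    by standard
      (use assms cstar_seminorm p_eq_zero in \<open>auto simp: mcomplete_cstar_dist_iff[OF assms(1)]\<close>)
qed

sublocale cstar_algebra \<subseteq> normed_star_algebra A "nrm A"
  by standard (simp_all add: seminorm norm_eq_zero)

lemma (in cstar_algebra) convergent:
  assumes "s \<in> cauchy_seqs A (nrm A)"
  shows "\<exists>a\<in>carrier A. (\<lambda>n. \<parallel>s n \<ominus>\<^bsub>A\<^esub> a\<parallel>\<^bsub>A\<^esub>) \<longlonglongrightarrow> 0"
  using assms complete mcomplete_cstar_dist_iff[OF normed_star_algebra_axioms subset_refl]
  by (auto simp: cauchy_seqs_def)

section \<open>Limits of sequences\<close>

context seminormed_star_algebra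
begin

text \<open>
  The operations preserve asymptotic equality. The filter is arbitrary so that the same lemmas
  serve for limits (one of the two families constant), for the congruence of null sequences, and for
  Cauchy sequences (along the product filter, with \<open>s m\<close> and \<open>s n\<close> as the two families).
\<close>

lemma null_add:
  assumes "\<And>n. s n \<in> carrier A" "\<And>n. s' n \<in> carrier A" "\<And>n. t n \<in> carrier A" "\<And>n. t' n \<in> carrier A"
    and "((\<lambda>n. p (s n \<ominus> s' n)) \<longlongrightarrow> 0) F" "((\<lambda>n. p (t n \<ominus> t' n)) \<longlongrightarrow> 0) F"
  shows "((\<lambda>n. p ((s n \<oplus> t n) \<ominus> (s' n \<oplus> t' n))) \<longlongrightarrow> 0) F"
proof (rule tendsto_sandwich[OF _ _ tendsto_const tendsto_add_zero[OF assms(5,6)]])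
  show "\<forall>\<^sub>F n in F. p ((s n \<oplus> t n) \<ominus> (s' n \<oplus> t' n)) \<le> p (s n \<ominus> s' n) + p (t n \<ominus> t' n)"
    using assms(1-4) by (simp add: add_minus_add p_add)
qed (use assms(1-4) in simp)

lemma null_scale:
  assumes "\<And>n. s n \<in> carrier A" "\<And>n. s' n \<in> carrier A" "((\<lambda>n. p (s n \<ominus> s' n)) \<longlongrightarrow> 0) F"
  shows "((\<lambda>n. p (c \<odot> s n \<ominus> c \<odot> s' n)) \<longlongrightarrow> 0) F"
proof -
  have "p (c \<odot> s n \<ominus> c \<odot> s' n) = cmod c * p (s n \<ominus> s' n)" for n
    using assms(1,2) by (simp add: p_scale flip: scale_minus)
  then show ?thesis
    using tendsto_mult_right_zero[OF assms(3)] by simp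
qed

lemma null_star:
  assumes "\<And>n. s n \<in> carrier A" "\<And>n. s' n \<in> carrier A" "((\<lambda>n. p (s n \<ominus> s' n)) \<longlongrightarrow> 0) F"
  shows "((\<lambda>n. p (star A (s n) \<ominus> star A (s' n))) \<longlongrightarrow> 0) F"
  using assms by (simp flip: star_minus)

lemma null_mult:
  assumes "\<And>n. s n \<in> carrier A" "\<And>n. s' n \<in> carrier A" "\<And>n. t n \<in> carrier A" "\<And>n. t' n \<in> carrier A"
    and "((\<lambda>n. p (s n \<ominus> s' n)) \<longlongrightarrow> 0) F" "((\<lambda>n. p (t n \<ominus> t' n)) \<longlongrightarrow> 0) F"
    and "\<And>n. p (s n) \<le> K" "\<And>n. p (t' n) \<le> L"
  shows "((\<lambda>n. p ((s n \<otimes> t n) \<ominus> (s' n \<otimes> t' n))) \<longlongrightarrow> 0) F"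
proof (rule tendsto_sandwich[OF _ _ tendsto_const])
  show "((\<lambda>n. K * p (t n \<ominus> t' n) + p (s n \<ominus> s' n) * L) \<longlongrightarrow> 0) F"
    by (intro tendsto_add_zero tendsto_mult_right_zero tendsto_mult_left_zero assms(5,6))
  have "p ((s n \<otimes> t n) \<ominus> (s' n \<otimes> t' n)) \<le> K * p (t n \<ominus> t' n) + p (s n \<ominus> s' n) * L" for n
  proof -
    have "p ((s n \<otimes> t n) \<ominus> (s' n \<otimes> t' n)) \<le> p (s n) * p (t n \<ominus> t' n) + p (s n \<ominus> s' n) * p (t' n)"
      using assms(1-4) by (simp add: p_mult_minus_mult)
    also have "\<dots> \<le> K * p (t n \<ominus> t' n) + p (s n \<ominus> s' n) * L"
      using assms(1-4,7,8) by (intro add_mono mult_right_mono mult_left_mono) simp_all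
    finally show ?thesis .
  qed
  then show "\<forall>\<^sub>F n in F. p ((s n \<otimes> t n) \<ominus> (s' n \<otimes> t' n)) \<le>
      K * p (t n \<ominus> t' n) + p (s n \<ominus> s' n) * L"
    by simp
qed (use assms(1-4) in simp)

lemma tendsto_p:
  assumes "\<And>n. s n \<in> carrier A" "a \<in> carrier A" "(\<lambda>n. p (s n \<ominus> a)) \<longlonglongrightarrow> 0"
  shows "(\<lambda>n. p (s n)) \<longlonglongrightarrow> p a"
proof -
  have "(\<lambda>n. p (s n) - p a) \<longlonglongrightarrow> 0"
    by (rule tendsto_rabs_zero_cancel, rule tendsto_sandwich[OF _ _ tendsto_const assms(3)])
      (use assms(1,2) in \<open>simp_all add: p_abs_diff\<close>)
  then show ?thesis
    by (simp add: LIM_zero_iff)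
qed

lemma cauchy_seqs_carrier [simp]: "s \<in> cauchy_seqs A p \<Longrightarrow> s n \<in> carrier A"
  by (simp add: cauchy_seqs_def)

lemma cauchy_seqs_Cauchy:
  assumes "s \<in> cauchy_seqs A p"
  shows "Cauchy (\<lambda>n. p (s n))"
proof (rule CauchyI')
  fix e :: real
  assume "0 < e"
  then obtain N where N: "\<And>m n. N \<le> m \<Longrightarrow> N \<le> n \<Longrightarrow> p (s m \<ominus> s n) < e"
    using assms unfolding cauchy_seqs_def by blast
  have "dist (p (s m)) (p (s n)) \<le> p (s m \<ominus> s n)" for m n
    using assms by (simp add: dist_real_def p_abs_diff)
  with N show "\<exists>N. \<forall>m\<ge>N. \<forall>n>m. dist (p (s m)) (p (s n)) < e"
    by (meson le_trans less_imp_le_nat order.strict_trans1)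
qed

lemma cauchy_seqs_bounded:
  assumes "s \<in> cauchy_seqs A p"
  obtains K where "\<And>n. p (s n) \<le> K"
proof -
  have "Bseq (\<lambda>n. p (s n))"
    using cauchy_seqs_Cauchy[OF assms] by (rule Cauchy_Bseq)
  then obtain K where "\<And>n. norm (p (s n)) \<le> K"
    unfolding Bseq_def by blast
  then have "p (s n) \<le> K" for n
    by (metis abs_le_D1 real_norm_def)
  then show thesis by (rule that)
qed

end

section \<open>*-homomorphisms are contractive\<close>

text \<open>
  An element \<open>d = 1 - (1 - a\<^sup>2)\<^sup>1\<^sup>/\<^sup>2\<close>: the last equation is \<open>(1 - d)\<^sup>2 = 1 - a\<^sup>2\<close> written without
  a unit.
\<close>

lemma (in cstar_algebra) ex_sqrt_defect:
  assumes a: "a \<in> carrier A" "star A a = a" "\<parallel>a\<parallel> < 1"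
  obtains d where "d \<in> carrier A" "star A d = d" "a \<otimes> d = d \<otimes> a" "2 \<odot> d = a \<otimes> a \<oplus> d \<otimes> d"
proof -
  define D where "D = {x \<in> carrier A. star A x = x \<and> a \<otimes> x = x \<otimes> a \<and> \<parallel>x\<parallel> \<le> \<parallel>a\<parallel>}"
  \<comment> \<open>On \<open>D\<close> the map \<open>F\<close> is a contraction with factor \<open>\<parallel>a\<parallel>\<close>, and its fixed points are as required.\<close>
  define F where "F x = (1/2) \<odot> (a \<otimes> a \<oplus> x \<otimes> x)" for x
  have D: "x \<in> carrier A" "star A x = x" "a \<otimes> x = x \<otimes> a" "\<parallel>x\<parallel> \<le> \<parallel>a\<parallel>" if "x \<in> D" for x
    using that by (simp_all add: D_def)
  have sub: "D \<subseteq> carrier A"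
    using D by blast
  interpret M: Metric_space D "cstar_dist A"
    using Metric_space.subspace[OF Metric_space_cstar_dist[OF normed_star_algebra_axioms] sub] .
  have "M.mcomplete"
    unfolding mcomplete_cstar_dist_iff[OF normed_star_algebra_axioms sub]
  proof (intro allI impI)
    fix s
    assume "(\<forall>n. s n \<in> D) \<and> s \<in> cauchy_seqs A (nrm A)"
    then have s: "\<And>n. s n \<in> D" "s \<in> cauchy_seqs A (nrm A)" by auto
    obtain l where l: "l \<in> carrier A" "(\<lambda>n. \<parallel>s n \<ominus> l\<parallel>) \<longlonglongrightarrow> 0"
      using convergent[OF s(2)] by blast
    have "star A l = l"
    proof (rule limit_unique[where s = s])
      show "(\<lambda>n. \<parallel>s n \<ominus> star A l\<parallel>) \<longlonglongrightarrow> 0"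
        using null_star[of s "\<lambda>_. l"] s l D by simp
    qed (use s D l in auto)
    moreover have "a \<otimes> l = l \<otimes> a"
    proof (rule limit_unique[where s = "\<lambda>n. a \<otimes> s n"])
      show "(\<lambda>n. \<parallel>a \<otimes> s n \<ominus> a \<otimes> l\<parallel>) \<longlonglongrightarrow> 0"
        using null_mult[of "\<lambda>_. a" "\<lambda>_. a" s "\<lambda>_. l", OF _ _ _ _ _ _ order_refl order_refl] s l D a by simp
      show "(\<lambda>n. \<parallel>a \<otimes> s n \<ominus> l \<otimes> a\<parallel>) \<longlonglongrightarrow> 0"
        using null_mult[of s "\<lambda>_. l" "\<lambda>_. a" "\<lambda>_. a" sequentially "\<parallel>a\<parallel>", OF _ _ _ _ _ _ _ order_refl] s l D a by simp
    qed (use s D l a in auto)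
    moreover have "\<parallel>l\<parallel> \<le> \<parallel>a\<parallel>"
    proof (rule LIMSEQ_le_const2)
      show "(\<lambda>n. \<parallel>s n\<parallel>) \<longlonglongrightarrow> \<parallel>l\<parallel>"
        by (rule tendsto_p) (use s D l in auto)
    qed (use s D in blast)
    ultimately show "\<exists>l\<in>D. (\<lambda>n. \<parallel>s n \<ominus> l\<parallel>) \<longlonglongrightarrow> 0"
      using l unfolding D_def by blast
  qed
  moreover have "\<zero> \<in> D"
    using a by (simp add: D_def)
  then have "D \<noteq> {}" by blast
  moreover have "F \<in> D \<rightarrow> D"
  proof
    fix x
    assume "x \<in> D"
    note x = D[OF this]
    have "\<parallel>F x\<parallel> \<le> (1/2) * (\<parallel>a\<parallel> * \<parallel>a\<parallel> + \<parallel>a\<parallel> * \<parallel>a\<parallel>)"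
    proof -
      have "\<parallel>F x\<parallel> \<le> (1/2) * (\<parallel>a \<otimes> a\<parallel> + \<parallel>x \<otimes> x\<parallel>)"
        using a x p_add[of "a \<otimes> a" "x \<otimes> x"] by (simp add: F_def p_scale norm_divide)
      also have "\<dots> \<le> (1/2) * (\<parallel>a\<parallel> * \<parallel>a\<parallel> + \<parallel>x\<parallel> * \<parallel>x\<parallel>)"
        using a x by (intro mult_left_mono add_mono p_mult) simp_all
      also have "\<dots> \<le> (1/2) * (\<parallel>a\<parallel> * \<parallel>a\<parallel> + \<parallel>a\<parallel> * \<parallel>a\<parallel>)"
        using a x by (intro mult_left_mono add_mono mult_mono order_refl) simp_all
      finally show ?thesis .
    qed
    also have "\<dots> \<le> \<parallel>a\<parallel>"
      using a mult_left_mono[of "\<parallel>a\<parallel>" 1 "\<parallel>a\<parallel>"] by simp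
    finally have "\<parallel>F x\<parallel> \<le> \<parallel>a\<parallel>" .
    moreover have "star A (F x) = F x"
      using a x by (simp add: F_def star_scale star_add star_mult)
    moreover have "a \<otimes> F x = F x \<otimes> a"
    proof -
      have "a \<otimes> (x \<otimes> x) = (x \<otimes> x) \<otimes> a"
        using a x by (metis mult_assoc)
      then show ?thesis
        using a x by (simp add: F_def mult_scale_left mult_scale_right mult_add_left mult_add_right mult_assoc)
    qed
    ultimately show "F x \<in> D"
      using a x by (simp add: D_def F_def)
  qed
  moreover have "cstar_dist A (F x) (F y) \<le> \<parallel>a\<parallel> * cstar_dist A x y" if "x \<in> D" "y \<in> D" for x y
  proof -
    note x = D[OF that(1)] and y = D[OF that(2)]
    have "F x \<ominus> F y = (1/2) \<odot> (x \<otimes> x \<ominus> y \<otimes> y)"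
      using a x y by (simp add: F_def add_minus_add flip: scale_minus)
    then have "\<parallel>F x \<ominus> F y\<parallel> = (1/2) * \<parallel>x \<otimes> x \<ominus> y \<otimes> y\<parallel>"
      using x y by (simp add: p_scale norm_divide)
    also have "\<dots> \<le> (1/2) * (\<parallel>x\<parallel> * \<parallel>x \<ominus> y\<parallel> + \<parallel>x \<ominus> y\<parallel> * \<parallel>y\<parallel>)"
      using x y by (intro mult_left_mono p_mult_minus_mult) simp_all
    also have "\<dots> \<le> (1/2) * (\<parallel>a\<parallel> * \<parallel>x \<ominus> y\<parallel> + \<parallel>x \<ominus> y\<parallel> * \<parallel>a\<parallel>)"
      using a x y by (intro mult_left_mono add_mono mult_mono order_refl) simp_all
    also have "\<dots> = \<parallel>a\<parallel> * \<parallel>x \<ominus> y\<parallel>"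
      by simp
    finally show ?thesis
      using a x y by (simp add: cstar_dist_def F_def)
  qed
  ultimately obtain d where d: "d \<in> D" "F d = d"
    using M.Banach_fixedpoint_thm[of F "\<parallel>a\<parallel>"] a(3) by blast
  have "2 \<odot> F d = a \<otimes> a \<oplus> d \<otimes> d"
    using a D[OF d(1)] by (simp add: F_def scale_scale scale_one)
  with d D[OF d(1)] that show thesis by simp
qed

text \<open>
  If \<open>e = 1 - (1 - b\<^sup>2)\<^sup>1\<^sup>/\<^sup>2\<close> exists, then \<open>u = b + i (1 - e)\<close> is unitary; so \<open>b\<close>, being the mean
  of two unitaries, multiplies contractively. As there need not be a unit, \<open>u\<close> enters through the
  products \<open>u y\<close> only.
\<close>

lemma (in seminormed_star_algebra) unitary_mult:
  assumes b: "b \<in> carrier A" "star A b = b" and e: "e \<in> carrier A" "star A e = e"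
    and be: "b \<otimes> e = e \<otimes> b" "2 \<odot> e = b \<otimes> b \<oplus> e \<otimes> e" and y: "y \<in> carrier A"
  shows "p (b \<otimes> y \<oplus> \<i> \<odot> (y \<ominus> e \<otimes> y)) = p y"
proof -
  define v where "v = y \<ominus> e \<otimes> y"
  define z where "z = b \<otimes> y \<oplus> \<i> \<odot> v"
  define y' where "y' = star A y"
  define P where "P = y' \<otimes> y"
  define Q where "Q = y' \<otimes> (b \<otimes> (b \<otimes> y))"
  define R where "R = y' \<otimes> (e \<otimes> y)"
  define S where "S = y' \<otimes> (e \<otimes> (e \<otimes> y))"
  define K where "K = y' \<otimes> (b \<otimes> v)"
  have [simp]: "v \<in> carrier A" "y' \<in> carrier A"
    using e y by (simp_all add: v_def y'_def)
  have [simp]: "P \<in> carrier A" "Q \<in> carrier A" "R \<in> carrier A" "S \<in> carrier A" "K \<in> carrier A"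
    using b e y by (simp_all add: P_def Q_def R_def S_def K_def)
  have v': "star A v = y' \<ominus> y' \<otimes> e"
    using e y by (simp add: v_def y'_def star_minus star_mult)
  have bey: "b \<otimes> (e \<otimes> y) = e \<otimes> (b \<otimes> y)"
    using b e y be(1) by (metis mult_assoc)
  have K: "star A v \<otimes> (b \<otimes> y) = K"
    using b e y bey unfolding v' by (simp add: K_def v_def mult_minus_left mult_minus_right mult_assoc)
  have vv: "star A v \<otimes> v = (P \<ominus> R) \<ominus> (R \<ominus> S)"
    using e y unfolding v' by (simp add: v_def P_def R_def S_def mult_minus_left mult_minus_right mult_assoc)
  have "2 \<odot> R = y' \<otimes> ((2 \<odot> e) \<otimes> y)"
    using e y by (simp add: R_def mult_scale_left mult_scale_right)
  also have "\<dots> = Q \<oplus> S"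
    using b e y by (simp add: be(2) Q_def S_def mult_add_left mult_add_right mult_assoc)
  finally have QS: "Q \<oplus> S = 2 \<odot> R" by simp
  have "star A z = y' \<otimes> b \<oplus> (-\<i>) \<odot> star A v"
    using b y by (simp add: z_def y'_def star_add star_scale star_mult)
  then have "star A z \<otimes> z =
      (y' \<otimes> (b \<otimes> (b \<otimes> y)) \<oplus> \<i> \<odot> (y' \<otimes> (b \<otimes> v))) \<oplus>
      ((-\<i>) \<odot> (star A v \<otimes> (b \<otimes> y)) \<oplus> star A v \<otimes> v)"
    using b y by (simp add: z_def mult_add_left mult_add_right mult_scale_left mult_scale_right
        mult_assoc scale_add scale_scale scale_one add_ac)
  also have "\<dots> = (Q \<oplus> \<i> \<odot> K) \<oplus> ((-\<i>) \<odot> K \<oplus> ((P \<ominus> R) \<ominus> (R \<ominus> S)))"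
    by (simp add: K vv flip: Q_def K_def)
  also have "\<dots> = (\<i> \<odot> K \<oplus> (-\<i>) \<odot> K) \<oplus> ((Q \<oplus> S) \<oplus> (((-1) \<odot> R \<oplus> (-1) \<odot> R) \<oplus> P))"
    by (simp add: star_minus_def scale_add scale_scale scale_one add_ac)
  also have "\<dots> = (\<i> \<odot> K \<oplus> (-\<i>) \<odot> K) \<oplus> ((2 \<odot> R \<oplus> (-2) \<odot> R) \<oplus> P)"
    unfolding QS using add_scale[of R "-1" "-1"] by (simp add: add_assoc)
  also have "\<dots> = P"
    using add_scale[of R 2 "-2", symmetric] add_scale[of K \<i> "-\<i>", symmetric] by simp
  finally have "(p z)\<^sup>2 = (p y)\<^sup>2"
    using b y p_star_mult[of z] p_star_mult[of y] by (simp add: P_def y'_def z_def)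
  then have "p z = p y"
    using b y by (simp add: z_def)
  then show ?thesis
    by (simp add: z_def v_def)
qed

lemma (in seminormed_star_algebra) contractive_mult:
  assumes b: "b \<in> carrier A" "star A b = b" and e: "e \<in> carrier A" "star A e = e"
    and be: "b \<otimes> e = e \<otimes> b" "2 \<odot> e = b \<otimes> b \<oplus> e \<otimes> e" and y: "y \<in> carrier A"
  shows "p (b \<otimes> y) \<le> p y"
proof -
  define v where "v = \<i> \<odot> (y \<ominus> e \<otimes> y)"
  define b' where "b' = (-1) \<odot> b"
  have v: "v \<in> carrier A" and b': "b' \<in> carrier A"
    using y e b by (simp_all add: v_def b'_def)
  have z: "p (b \<otimes> y \<oplus> v) = p y"
    unfolding v_def by (rule unitary_mult) fact+
  have z': "p (b' \<otimes> y \<oplus> v) = p y"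
    unfolding v_def
  proof (rule unitary_mult)
    show "b' \<otimes> e = e \<otimes> b'" "2 \<odot> e = b' \<otimes> b' \<oplus> e \<otimes> e" "star A b' = b'"
      using b e be by (simp_all add: b'_def mult_scale_left mult_scale_right scale_scale star_scale scale_one)
  qed (use b' e y in auto)
  have "(b \<otimes> y \<oplus> v) \<ominus> (b' \<otimes> y \<oplus> v) = 2 \<odot> (b \<otimes> y)"
    using b b' y v add_scale[of "b \<otimes> y" 1 1]
    by (simp add: add_minus_add add_zero) (simp add: b'_def star_minus_def mult_scale_left scale_scale scale_one)
  then have "2 * p (b \<otimes> y) = p ((b \<otimes> y \<oplus> v) \<ominus> (b' \<otimes> y \<oplus> v))"
    using b y by (simp add: p_scale)
  also have "\<dots> \<le> p (b \<otimes> y \<oplus> v) + p (b' \<otimes> y \<oplus> v)"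
    using b b' y v p_triangle[of "b \<otimes> y \<oplus> v" \<zero> "b' \<otimes> y \<oplus> v"] p_minus_commute[of \<zero> "b' \<otimes> y \<oplus> v"] by simp
  finally show ?thesis
    using z z' by simp
qed

text \<open>
  No unit and no continuity is assumed. The target need not be complete, nor its seminorm definite.
\<close>

theorem star_hom_contractive:
  assumes "cstar_algebra A" "seminormed_star_algebra B q" "\<phi> \<in> star_homs A B" "x \<in> carrier A"
  shows "q (\<phi> x) \<le> \<parallel>x\<parallel>\<^bsub>A\<^esub>"
proof -
  interpret A: cstar_algebra A by fact
  interpret B: seminormed_star_algebra B q by fact
  note hom = star_homsD[OF assms(3)]
  \<comment> \<open>\<open>b = \<phi> a\<close> multiplies contractively; for \<open>y = b\<close> this says \<open>\<parallel>b\<parallel>\<^sup>2 \<le> \<parallel>b\<parallel>\<close>.\<close>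
  have unit_ball: "q (\<phi> a) \<le> 1" if a: "a \<in> carrier A" "star A a = a" "\<parallel>a\<parallel>\<^bsub>A\<^esub> < 1" for a
  proof -
    obtain d where d: "d \<in> carrier A" "star A d = d" "a \<otimes>\<^bsub>A\<^esub> d = d \<otimes>\<^bsub>A\<^esub> a"
      "2 \<odot>\<^bsub>A\<^esub> d = a \<otimes>\<^bsub>A\<^esub> a \<oplus>\<^bsub>A\<^esub> d \<otimes>\<^bsub>A\<^esub> d"
      using A.ex_sqrt_defect[OF a] .
    have star: "star B (\<phi> a) = \<phi> a" "star B (\<phi> d) = \<phi> d"
      using a d hom(5) by metis+
    have com: "\<phi> a \<otimes>\<^bsub>B\<^esub> \<phi> d = \<phi> d \<otimes>\<^bsub>B\<^esub> \<phi> a"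
      using a d hom(4) by metis
    have "\<phi> (2 \<odot>\<^bsub>A\<^esub> d) = \<phi> (a \<otimes>\<^bsub>A\<^esub> a \<oplus>\<^bsub>A\<^esub> d \<otimes>\<^bsub>A\<^esub> d)"
      using d by simp
    then have "2 \<odot>\<^bsub>B\<^esub> \<phi> d = \<phi> a \<otimes>\<^bsub>B\<^esub> \<phi> a \<oplus>\<^bsub>B\<^esub> \<phi> d \<otimes>\<^bsub>B\<^esub> \<phi> d"
      using a d(1) by (simp add: hom)
    then have "q (\<phi> a \<otimes>\<^bsub>B\<^esub> \<phi> a) \<le> q (\<phi> a)"
      by (intro B.contractive_mult[where e = "\<phi> d"] star com hom(1) a d)
    then have "(q (\<phi> a))\<^sup>2 \<le> q (\<phi> a)"
      using B.p_star_mult[of "\<phi> a"] hom(1) a star by simp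
    then show ?thesis
      using mult_le_cancel_left1[of "q (\<phi> a)" "q (\<phi> a)"] by (cases "q (\<phi> a) \<le> 0") (simp_all add: power2_eq_square)
  qed
  have hermitian: "q (\<phi> a) \<le> \<parallel>a\<parallel>\<^bsub>A\<^esub>" if a: "a \<in> carrier A" "star A a = a" for a
  proof (rule dense_ge)
    fix r
    assume r: "\<parallel>a\<parallel>\<^bsub>A\<^esub> < r"
    then have "r > 0"
      using a(1) A.p_nonneg le_less_trans by blast
    then have "q (\<phi> (inverse (complex_of_real r) \<odot>\<^bsub>A\<^esub> a)) \<le> 1"
      using a r \<open>r > 0\<close> by (intro unit_ball) (simp_all add: A.star_scale A.p_scale norm_inverse norm_divide field_simps)
    then have "inverse r * q (\<phi> a) \<le> 1"
      using a \<open>r > 0\<close> by (simp add: hom B.p_scale norm_inverse)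
    then show "q (\<phi> a) \<le> r"
      using \<open>r > 0\<close> by (simp add: field_simps)
  qed
  have "(q (\<phi> x))\<^sup>2 = q (\<phi> (star A x \<otimes>\<^bsub>A\<^esub> x))"
    using assms(4) by (simp add: hom B.p_star_mult)
  also have "\<dots> \<le> \<parallel>star A x \<otimes>\<^bsub>A\<^esub> x\<parallel>\<^bsub>A\<^esub>"
    using assms(4) by (intro hermitian) (simp_all add: A.star_mult A.star_star)
  also have "\<dots> = \<parallel>x\<parallel>\<^bsub>A\<^esub>\<^sup>2"
    using assms(4) by (rule A.p_star_mult)
  finally show ?thesis
    by (rule power2_le_imp_le) (use assms(4) in simp)
qed

section \<open>The completion of a *-algebra in a C*-seminorm\<close>

lemma null_if_le:
  fixes f g :: "'i \<Rightarrow> real"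
  assumes "(g \<longlongrightarrow> 0) F" "\<And>i. 0 \<le> f i" "\<And>i. f i \<le> g i"
  shows "(f \<longlongrightarrow> 0) F"
  by (rule tendsto_sandwich[OF _ _ tendsto_const assms(1)]) (use assms in simp_all)

context seminormed_star_algebra
begin

lemma cauchy_seqs_iff:
  "s \<in> cauchy_seqs A p \<longleftrightarrow> (\<forall>n. s n \<in> carrier A) \<and>
    ((\<lambda>i. p (s (fst i) \<ominus> s (snd i))) \<longlongrightarrow> 0) (sequentially \<times>\<^sub>F sequentially)"
proof (cases "\<forall>n. s n \<in> carrier A")
  case True
  have "(\<forall>\<^sub>F i in sequentially \<times>\<^sub>F sequentially. dist (p (s (fst i) \<ominus> s (snd i))) 0 < e) \<longleftrightarrow>
      (\<exists>N. \<forall>m\<ge>N. \<forall>n\<ge>N. p (s m \<ominus> s n) < e)" for e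
    unfolding eventually_prod_sequentially using True by simp blast
  with True show ?thesis
    unfolding tendsto_iff cauchy_seqs_def by simp
qed (use cauchy_seqs_carrier in blast)

lemma cauchy_seqs_null:
  "s \<in> cauchy_seqs A p \<Longrightarrow>
    ((\<lambda>i. p (s (fst i) \<ominus> s (snd i))) \<longlongrightarrow> 0) (sequentially \<times>\<^sub>F sequentially)"
  by (simp add: cauchy_seqs_iff)

lemma cauchy_const [simp]: "a \<in> carrier A \<Longrightarrow> (\<lambda>n. a) \<in> cauchy_seqs A p"
  unfolding cauchy_seqs_def by simp

lemma cauchy_seqsI:
  assumes "\<And>n. s n \<in> carrier A"
    and "((\<lambda>i. p (s (fst i) \<ominus> s (snd i))) \<longlongrightarrow> 0) (sequentially \<times>\<^sub>F sequentially)"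
  shows "s \<in> cauchy_seqs A p"
  using assms cauchy_seqs_iff by blast

lemma cauchy_seqsD:
  assumes "s \<in> cauchy_seqs A p" "0 < e"
  obtains N where "\<And>m n. m \<ge> N \<Longrightarrow> n \<ge> N \<Longrightarrow> p (s m \<ominus> s n) < e"
  using assms unfolding cauchy_seqs_def by blast

lemma cauchy_add [simp]:
  assumes "s \<in> cauchy_seqs A p" "t \<in> cauchy_seqs A p"
  shows "(\<lambda>n. s n \<oplus> t n) \<in> cauchy_seqs A p"
proof (rule cauchy_seqsI)
  show "((\<lambda>i. p (s (fst i) \<oplus> t (fst i) \<ominus> (s (snd i) \<oplus> t (snd i)))) \<longlongrightarrow> 0)
      (sequentially \<times>\<^sub>F sequentially)"
    by (rule null_add) (use assms in \<open>simp_all add: cauchy_seqs_null\<close>)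
qed (use assms in simp)

lemma cauchy_scale [simp]:
  assumes "s \<in> cauchy_seqs A p"
  shows "(\<lambda>n. c \<odot> s n) \<in> cauchy_seqs A p"
proof (rule cauchy_seqsI)
  show "((\<lambda>i. p (c \<odot> s (fst i) \<ominus> c \<odot> s (snd i))) \<longlongrightarrow> 0) (sequentially \<times>\<^sub>F sequentially)"
    by (rule null_scale) (use assms in \<open>simp_all add: cauchy_seqs_null\<close>)
qed (use assms in simp)

lemma cauchy_star [simp]:
  assumes "s \<in> cauchy_seqs A p"
  shows "(\<lambda>n. star A (s n)) \<in> cauchy_seqs A p"
proof (rule cauchy_seqsI)
  show "((\<lambda>i. p (star A (s (fst i)) \<ominus> star A (s (snd i)))) \<longlongrightarrow> 0)
      (sequentially \<times>\<^sub>F sequentially)"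
    by (rule null_star) (use assms in \<open>simp_all add: cauchy_seqs_null\<close>)
qed (use assms in simp)

lemma cauchy_mult [simp]:
  assumes "s \<in> cauchy_seqs A p" "t \<in> cauchy_seqs A p"
  shows "(\<lambda>n. s n \<otimes> t n) \<in> cauchy_seqs A p"
proof (rule cauchy_seqsI)
  obtain K where K: "\<And>n. p (s n) \<le> K" using cauchy_seqs_bounded[OF assms(1)] by blast
  obtain L where L: "\<And>n. p (t n) \<le> L" using cauchy_seqs_bounded[OF assms(2)] by blast
  show "((\<lambda>i. p (s (fst i) \<otimes> t (fst i) \<ominus> (s (snd i) \<otimes> t (snd i)))) \<longlongrightarrow> 0)
      (sequentially \<times>\<^sub>F sequentially)"
    by (rule null_mult[where K = K and L = L])
      (use assms K L in \<open>simp_all add: cauchy_seqs_null\<close>)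
qed (use assms in simp)

lemma equiv_null_rel: "equiv (cauchy_seqs A p) (null_rel A p)"
proof (rule equivI)
  show "null_rel A p \<subseteq> cauchy_seqs A p \<times> cauchy_seqs A p"
    by (auto simp: null_rel_def)
  show "refl_on (cauchy_seqs A p) (null_rel A p)"
    by (auto simp: refl_on_def null_rel_def)
  show "sym (null_rel A p)"
    by (auto simp: sym_def null_rel_def p_minus_commute)
  show "trans (null_rel A p)"
  proof (rule transI)
    fix s t u
    assume "(s, t) \<in> null_rel A p" "(t, u) \<in> null_rel A p"
    then have stu: "s \<in> cauchy_seqs A p" "t \<in> cauchy_seqs A p" "u \<in> cauchy_seqs A p"
      and lim: "(\<lambda>n. p (s n \<ominus> t n)) \<longlonglongrightarrow> 0" "(\<lambda>n. p (t n \<ominus> u n)) \<longlonglongrightarrow> 0"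
      by (auto simp: null_rel_def)
    have "(\<lambda>n. p (s n \<ominus> u n)) \<longlonglongrightarrow> 0"
      by (rule tendsto_sandwich[OF _ _ tendsto_const tendsto_add_zero[OF lim]])
        (use stu in \<open>simp_all add: p_triangle\<close>)
    with stu show "(s, u) \<in> null_rel A p"
      by (simp add: null_rel_def)
  qed
qed

lemma null_rel_iff:
  "(s, t) \<in> null_rel A p \<longleftrightarrow> s \<in> cauchy_seqs A p \<and> t \<in> cauchy_seqs A p \<and>
    (\<lambda>n. p (s n \<ominus> t n)) \<longlonglongrightarrow> 0"
  by (simp add: null_rel_def)

text \<open>The element of the completion that a Cauchy sequence represents.\<close>

abbreviation cls :: "(nat \<Rightarrow> 'a) \<Rightarrow> (nat \<Rightarrow> 'a) set" where
  "cls s \<equiv> null_rel A p `` {s}"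

lemma cls_eq_iff:
  "\<lbrakk>s \<in> cauchy_seqs A p; t \<in> cauchy_seqs A p\<rbrakk>
    \<Longrightarrow> cls s = cls t \<longleftrightarrow> (\<lambda>n. p (s n \<ominus> t n)) \<longlonglongrightarrow> 0"
  by (subst eq_equiv_class_iff[OF equiv_null_rel]) (simp_all add: null_rel_iff)

lemma carrier_completion: "carrier (completion A p) = cauchy_seqs A p // null_rel A p"
  by (simp add: completion_def)

lemma cls_closed [simp]: "s \<in> cauchy_seqs A p \<Longrightarrow> cls s \<in> carrier (completion A p)"
  by (simp add: carrier_completion quotientI)

lemma completionE:
  assumes "u \<in> carrier (completion A p)"
  obtains s where "s \<in> cauchy_seqs A p" "u = cls s"
  using assms by (auto simp: carrier_completion elim: quotientE)

lemma zero_completion: "\<zero>\<^bsub>completion A p\<^esub> = cls (\<lambda>n. \<zero>)"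
  by (simp add: completion_def)

lemma add_completion:
  assumes "s \<in> cauchy_seqs A p" "t \<in> cauchy_seqs A p"
  shows "cls s \<oplus>\<^bsub>completion A p\<^esub> cls t = cls (\<lambda>n. s n \<oplus> t n)"
proof -
  have "congruent2 (null_rel A p) (null_rel A p) (\<lambda>s t. cls (\<lambda>n. s n \<oplus> t n))"
    by (rule congruent2I') (simp add: null_rel_iff cls_eq_iff null_add)
  from UN_equiv_class2[OF equiv_null_rel equiv_null_rel this assms] show ?thesis
    by (simp add: completion_def)
qed

lemma mult_completion:
  assumes "s \<in> cauchy_seqs A p" "t \<in> cauchy_seqs A p"
  shows "cls s \<otimes>\<^bsub>completion A p\<^esub> cls t = cls (\<lambda>n. s n \<otimes> t n)"
proof -
  have "cls (\<lambda>n. s n \<otimes> t n) = cls (\<lambda>n. s' n \<otimes> t' n)"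
    if "(s, s') \<in> null_rel A p" "(t, t') \<in> null_rel A p" for s s' t t'
  proof -
    have st: "s \<in> cauchy_seqs A p" "s' \<in> cauchy_seqs A p" "t \<in> cauchy_seqs A p" "t' \<in> cauchy_seqs A p"
      using that by (auto simp: null_rel_iff)
    obtain K where "\<And>n. p (s n) \<le> K" using cauchy_seqs_bounded[OF st(1)] by blast
    moreover obtain L where "\<And>n. p (t' n) \<le> L" using cauchy_seqs_bounded[OF st(4)] by blast
    ultimately show ?thesis
      using st that by (simp add: null_rel_iff cls_eq_iff null_mult[where K = K and L = L])
  qed
  then have "congruent2 (null_rel A p) (null_rel A p) (\<lambda>s t. cls (\<lambda>n. s n \<otimes> t n))"
    by (rule congruent2I')
  from UN_equiv_class2[OF equiv_null_rel equiv_null_rel this assms] show ?thesis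
    by (simp add: completion_def)
qed

lemma scale_completion:
  assumes "s \<in> cauchy_seqs A p"
  shows "c \<odot>\<^bsub>completion A p\<^esub> cls s = cls (\<lambda>n. c \<odot> s n)"
proof -
  have "(\<lambda>s. cls (\<lambda>n. c \<odot> s n)) respects null_rel A p"
    by (rule congruentI) (simp add: null_rel_iff cls_eq_iff null_scale)
  from UN_equiv_class[OF equiv_null_rel this assms] show ?thesis
    by (simp add: completion_def)
qed

lemma star_completion:
  assumes "s \<in> cauchy_seqs A p"
  shows "star (completion A p) (cls s) = cls (\<lambda>n. star A (s n))"
proof -
  have "(\<lambda>s. cls (\<lambda>n. star A (s n))) respects null_rel A p"
    by (rule congruentI) (simp add: null_rel_iff cls_eq_iff null_star)
  from UN_equiv_class[OF equiv_null_rel this assms] show ?thesis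
    by (simp add: completion_def)
qed

lemmas completion_ops =
  zero_completion add_completion mult_completion scale_completion star_completion

lemma minus_completion:
  "\<lbrakk>s \<in> cauchy_seqs A p; t \<in> cauchy_seqs A p\<rbrakk>
    \<Longrightarrow> cls s \<ominus>\<^bsub>completion A p\<^esub> cls t = cls (\<lambda>n. s n \<ominus> t n)"
  by (simp add: star_minus_def completion_ops)

lemma cauchy_minus [simp]:
  "\<lbrakk>s \<in> cauchy_seqs A p; t \<in> cauchy_seqs A p\<rbrakk> \<Longrightarrow> (\<lambda>n. s n \<ominus> t n) \<in> cauchy_seqs A p"
  by (simp add: star_minus_def)

lemma nrm_completion:
  assumes s: "s \<in> cauchy_seqs A p"
  shows "(\<lambda>n. p (s n)) \<longlonglongrightarrow> \<parallel>cls s\<parallel>\<^bsub>completion A p\<^esub>"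
proof -
  obtain r where r: "(\<lambda>n. p (s n)) \<longlonglongrightarrow> r"
    using cauchy_seqs_Cauchy[OF s] by (auto simp: Cauchy_convergent_iff convergent_def)
  have lim: "(\<lambda>n. p (t n)) \<longlonglongrightarrow> r" if "t \<in> cls s" for t
  proof -
    have t: "t \<in> cauchy_seqs A p" "(\<lambda>n. p (s n \<ominus> t n)) \<longlonglongrightarrow> 0"
      using that by (auto simp: null_rel_iff)
    have "(\<lambda>n. p (s n) - p (t n)) \<longlonglongrightarrow> 0"
      by (rule tendsto_rabs_zero_cancel, rule tendsto_sandwich[OF _ _ tendsto_const t(2)])
        (use s t in \<open>simp_all add: p_abs_diff\<close>)
    from tendsto_diff[OF r this] show ?thesis by simp
  qed
  have self: "s \<in> cls s"
    using equiv_null_rel s by (rule equiv_class_self)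
  have "\<parallel>cls s\<parallel>\<^bsub>completion A p\<^esub> = (THE r. \<forall>s\<in>cls s. (\<lambda>n. p (s n)) \<longlonglongrightarrow> r)"
    by (simp add: completion_def)
  also have "\<dots> = r"
    by (rule the_equality) (use lim self LIMSEQ_unique r in blast)+
  finally show ?thesis
    using r by simp
qed

lemma nrm_completion_eqI:
  "\<lbrakk>s \<in> cauchy_seqs A p; (\<lambda>n. p (s n)) \<longlonglongrightarrow> r\<rbrakk> \<Longrightarrow> \<parallel>cls s\<parallel>\<^bsub>completion A p\<^esub> = r"
  using LIMSEQ_unique nrm_completion by blast

lemma nrm_const [simp]: "a \<in> carrier A \<Longrightarrow> \<parallel>cls (\<lambda>n. a)\<parallel>\<^bsub>completion A p\<^esub> = p a"
  by (rule nrm_completion_eqI) simp_all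

lemma star_algebra_completion: "star_algebra (completion A p)"
proof
  fix u
  assume "u \<in> carrier (completion A p)"
  then obtain s where s: "s \<in> cauchy_seqs A p" "u = cls s" by (rule completionE)
  have "u \<oplus>\<^bsub>completion A p\<^esub> cls (\<lambda>n. (-1) \<odot> s n) = cls (\<lambda>n. s n \<ominus> s n)"
    using s by (simp add: completion_ops star_minus_def)
  also have "\<dots> = \<zero>\<^bsub>completion A p\<^esub>"
    using s by (simp add: zero_completion)
  finally show "\<exists>v\<in>carrier (completion A p). u \<oplus>\<^bsub>completion A p\<^esub> v = \<zero>\<^bsub>completion A p\<^esub>"
    using s by (metis cauchy_scale cls_closed)
qed (auto elim!: completionE simp: completion_ops add_ac add_zero scale_add add_scale
    scale_scale scale_one mult_assoc mult_add_left mult_add_right mult_scale_left mult_scale_right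
    star_star star_add star_mult star_scale)

lemma cstar_seminorm_completion: "cstar_seminorm (completion A p) (nrm (completion A p))"
  unfolding cstar_seminorm_def
proof (intro conjI ballI allI)
  let ?C = "completion A p"
  fix u
  assume "u \<in> carrier ?C"
  then obtain s where s: "s \<in> cauchy_seqs A p" "u = cls s" by (rule completionE)
  show "0 \<le> \<parallel>u\<parallel>\<^bsub>?C\<^esub>"
    unfolding s(2) by (rule LIMSEQ_le_const[OF nrm_completion[OF s(1)]]) (use s in auto)
  show "\<parallel>c \<odot>\<^bsub>?C\<^esub> u\<parallel>\<^bsub>?C\<^esub> = cmod c * \<parallel>u\<parallel>\<^bsub>?C\<^esub>" for c
    using s tendsto_mult_left[OF nrm_completion[OF s(1)], of "cmod c"]
    by (simp add: completion_ops nrm_completion_eqI p_scale)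
  show "\<parallel>star ?C u \<otimes>\<^bsub>?C\<^esub> u\<parallel>\<^bsub>?C\<^esub> = \<parallel>u\<parallel>\<^bsub>?C\<^esub>\<^sup>2"
    using s tendsto_power[OF nrm_completion[OF s(1)], of 2]
    by (simp add: completion_ops nrm_completion_eqI p_star_mult)
  fix v
  assume "v \<in> carrier ?C"
  then obtain t where t: "t \<in> cauchy_seqs A p" "v = cls t" by (rule completionE)
  show "\<parallel>u \<oplus>\<^bsub>?C\<^esub> v\<parallel>\<^bsub>?C\<^esub> \<le> \<parallel>u\<parallel>\<^bsub>?C\<^esub> + \<parallel>v\<parallel>\<^bsub>?C\<^esub>"
  proof (rule LIMSEQ_le)
    show "(\<lambda>n. p (s n \<oplus> t n)) \<longlonglongrightarrow> \<parallel>u \<oplus>\<^bsub>?C\<^esub> v\<parallel>\<^bsub>?C\<^esub>"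
      using s t nrm_completion[of "\<lambda>n. s n \<oplus> t n"] by (simp add: completion_ops)
    show "(\<lambda>n. p (s n) + p (t n)) \<longlonglongrightarrow> \<parallel>u\<parallel>\<^bsub>?C\<^esub> + \<parallel>v\<parallel>\<^bsub>?C\<^esub>"
      using s t by (auto intro!: tendsto_add nrm_completion)
  qed (use s t p_add in auto)
  show "\<parallel>u \<otimes>\<^bsub>?C\<^esub> v\<parallel>\<^bsub>?C\<^esub> \<le> \<parallel>u\<parallel>\<^bsub>?C\<^esub> * \<parallel>v\<parallel>\<^bsub>?C\<^esub>"
  proof (rule LIMSEQ_le)
    show "(\<lambda>n. p (s n \<otimes> t n)) \<longlonglongrightarrow> \<parallel>u \<otimes>\<^bsub>?C\<^esub> v\<parallel>\<^bsub>?C\<^esub>"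
      using s t nrm_completion[of "\<lambda>n. s n \<otimes> t n"] by (simp add: completion_ops)
    show "(\<lambda>n. p (s n) * p (t n)) \<longlonglongrightarrow> \<parallel>u\<parallel>\<^bsub>?C\<^esub> * \<parallel>v\<parallel>\<^bsub>?C\<^esub>"
      using s t by (auto intro!: tendsto_mult nrm_completion)
  qed (use s t p_mult in auto)
qed

lemma normed_star_algebra_completion:
  "normed_star_algebra (completion A p) (nrm (completion A p))"
proof -
  interpret C: star_algebra "completion A p" by (rule star_algebra_completion)
  show ?thesis
  proof
    fix u
    assume "u \<in> carrier (completion A p)" and zero: "\<parallel>u\<parallel>\<^bsub>completion A p\<^esub> = 0"
    then obtain s where "s \<in> cauchy_seqs A p" "u = cls s" by (auto elim: completionE)
    with zero nrm_completion[of s] show "u = \<zero>\<^bsub>completion A p\<^esub>"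
      by (simp add: zero_completion cls_eq_iff)
  qed (rule cstar_seminorm_completion)
qed

text \<open>Constant sequences represent the image of the *-algebra in its completion.\<close>

lemma const_dense:
  assumes "u \<in> carrier (completion A p)" "0 < e"
  obtains a where "a \<in> carrier A" "\<parallel>u \<ominus>\<^bsub>completion A p\<^esub> cls (\<lambda>n. a)\<parallel>\<^bsub>completion A p\<^esub> < e"
proof -
  obtain s where s: "s \<in> cauchy_seqs A p" "u = cls s"
    using assms(1) by (rule completionE)
  obtain N where N: "\<And>m n. m \<ge> N \<Longrightarrow> n \<ge> N \<Longrightarrow> p (s m \<ominus> s n) < e / 2"
    using cauchy_seqsD[OF s(1), of "e / 2"] assms(2) by (metis half_gt_zero)
  have "\<parallel>u \<ominus>\<^bsub>completion A p\<^esub> cls (\<lambda>n. s N)\<parallel>\<^bsub>completion A p\<^esub> \<le> e / 2"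
  proof (rule LIMSEQ_le_const2)
    show "(\<lambda>n. p (s n \<ominus> s N)) \<longlonglongrightarrow> \<parallel>u \<ominus>\<^bsub>completion A p\<^esub> cls (\<lambda>n. s N)\<parallel>\<^bsub>completion A p\<^esub>"
      using s nrm_completion[of "\<lambda>n. s n \<ominus> s N"] by (simp add: minus_completion)
    show "\<exists>M. \<forall>n\<ge>M. p (s n \<ominus> s N) \<le> e / 2"
      using N less_imp_le by blast
  qed
  with s(1) assms(2) that[of "s N"] show thesis by simp
qed

lemma const_tendsto:
  assumes s: "s \<in> cauchy_seqs A p"
  shows "(\<lambda>m. \<parallel>cls (\<lambda>n. s m) \<ominus>\<^bsub>completion A p\<^esub> cls s\<parallel>\<^bsub>completion A p\<^esub>) \<longlonglongrightarrow> 0"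
proof (rule LIMSEQ_I)
  interpret C: normed_star_algebra "completion A p" "nrm (completion A p)"
    by (rule normed_star_algebra_completion)
  fix e :: real
  assume "0 < e"
  then obtain N where N: "\<And>m n. m \<ge> N \<Longrightarrow> n \<ge> N \<Longrightarrow> p (s m \<ominus> s n) < e / 2"
    using cauchy_seqsD[OF s, of "e / 2"] by (metis half_gt_zero)
  have "\<parallel>cls (\<lambda>n. s m) \<ominus>\<^bsub>completion A p\<^esub> cls s\<parallel>\<^bsub>completion A p\<^esub> \<le> e / 2" if "m \<ge> N" for m
  proof (rule LIMSEQ_le_const2)
    show "(\<lambda>n. p (s m \<ominus> s n)) \<longlonglongrightarrow> \<parallel>cls (\<lambda>n. s m) \<ominus>\<^bsub>completion A p\<^esub> cls s\<parallel>\<^bsub>completion A p\<^esub>"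
      using s nrm_completion[of "\<lambda>n. s m \<ominus> s n"] by (simp add: minus_completion)
    show "\<exists>M. \<forall>n\<ge>M. p (s m \<ominus> s n) \<le> e / 2"
      using N that less_imp_le by blast
  qed
  with \<open>0 < e\<close> s
  show "\<exists>N. \<forall>m\<ge>N. norm (\<parallel>cls (\<lambda>n. s m) \<ominus>\<^bsub>completion A p\<^esub> cls s\<parallel>\<^bsub>completion A p\<^esub> - 0) < e"
    by (intro exI[of _ N]) (auto simp: le_less_trans[of _ "e / 2" e])
qed

theorem cstar_algebra_completion: "cstar_algebra (completion A p)"
proof (rule cstar_algebraI)
  let ?C = "completion A p"
  show "normed_star_algebra ?C (nrm ?C)"
    by (rule normed_star_algebra_completion)
  then interpret C: normed_star_algebra ?C "nrm ?C" .
  fix U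
  assume U: "U \<in> cauchy_seqs ?C (nrm ?C)"
  then have Uc: "U n \<in> carrier ?C" for n by simp
  \<comment> \<open>Approximate each term of \<open>U\<close> by a constant \<open>b n\<close>; then \<open>b\<close> is Cauchy, and \<open>U\<close> converges to its class.\<close>
  have "\<exists>a. a \<in> carrier A \<and> \<parallel>U n \<ominus>\<^bsub>?C\<^esub> cls (\<lambda>_. a)\<parallel>\<^bsub>?C\<^esub> < inverse (real (Suc n))" for n
    using const_dense[OF Uc, of "inverse (real (Suc n))" n] by auto
  then obtain b where b: "\<And>n. b n \<in> carrier A"
    and Ub: "\<And>n. \<parallel>U n \<ominus>\<^bsub>?C\<^esub> cls (\<lambda>_. b n)\<parallel>\<^bsub>?C\<^esub> < inverse (real (Suc n))"
    by metis
  have bc: "cls (\<lambda>_. b n) \<in> carrier ?C" for n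
    using b by simp
  have lim: "(\<lambda>n. \<parallel>U n \<ominus>\<^bsub>?C\<^esub> cls (\<lambda>_. b n)\<parallel>\<^bsub>?C\<^esub>) \<longlonglongrightarrow> 0"
    by (rule tendsto_sandwich[OF _ _ tendsto_const LIMSEQ_inverse_real_of_nat])
      (use Ub less_imp_le Uc bc in \<open>auto intro!: always_eventually\<close>)
  have "b \<in> cauchy_seqs A p"
  proof (rule cauchy_seqsI)
    let ?F = "sequentially \<times>\<^sub>F sequentially"
    let ?d = "\<lambda>n. \<parallel>U n \<ominus>\<^bsub>?C\<^esub> cls (\<lambda>_. b n)\<parallel>\<^bsub>?C\<^esub>"
    have le: "p (b m \<ominus> b n) \<le> ?d m + (\<parallel>U m \<ominus>\<^bsub>?C\<^esub> U n\<parallel>\<^bsub>?C\<^esub> + ?d n)" for m n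
    proof -
      have "p (b m \<ominus> b n) = \<parallel>cls (\<lambda>_. b m) \<ominus>\<^bsub>?C\<^esub> cls (\<lambda>_. b n)\<parallel>\<^bsub>?C\<^esub>"
        using b by (simp add: minus_completion)
      also have "\<dots> \<le> \<parallel>cls (\<lambda>_. b m) \<ominus>\<^bsub>?C\<^esub> U m\<parallel>\<^bsub>?C\<^esub> + \<parallel>U m \<ominus>\<^bsub>?C\<^esub> cls (\<lambda>_. b n)\<parallel>\<^bsub>?C\<^esub>"
        using bc Uc by (simp add: C.p_triangle)
      also have "\<parallel>cls (\<lambda>_. b m) \<ominus>\<^bsub>?C\<^esub> U m\<parallel>\<^bsub>?C\<^esub> = ?d m"
        using bc Uc by (simp add: C.p_minus_commute)
      also have "\<parallel>U m \<ominus>\<^bsub>?C\<^esub> cls (\<lambda>_. b n)\<parallel>\<^bsub>?C\<^esub> \<le> \<parallel>U m \<ominus>\<^bsub>?C\<^esub> U n\<parallel>\<^bsub>?C\<^esub> + ?d n"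
        using bc Uc by (simp add: C.p_triangle)
      finally show ?thesis by simp
    qed
    show "((\<lambda>i. p (b (fst i) \<ominus> b (snd i))) \<longlongrightarrow> 0) ?F"
    proof (rule null_if_le)
      show "((\<lambda>i. ?d (fst i) + (\<parallel>U (fst i) \<ominus>\<^bsub>?C\<^esub> U (snd i)\<parallel>\<^bsub>?C\<^esub> + ?d (snd i))) \<longlongrightarrow> 0) ?F"
        by (intro tendsto_add_zero C.cauchy_seqs_null U filterlim_compose[OF lim] filterlim_fst filterlim_snd)
    qed (use le b in simp_all)
  qed (rule b)
  then have b': "cls b \<in> carrier ?C" "(\<lambda>n. \<parallel>cls (\<lambda>_. b n) \<ominus>\<^bsub>?C\<^esub> cls b\<parallel>\<^bsub>?C\<^esub>) \<longlonglongrightarrow> 0"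
    by (simp_all add: const_tendsto)
  have "(\<lambda>n. \<parallel>U n \<ominus>\<^bsub>?C\<^esub> cls b\<parallel>\<^bsub>?C\<^esub>) \<longlonglongrightarrow> 0"
    by (rule null_if_le[OF tendsto_add_zero[OF lim b'(2)]])
      (use Uc bc b'(1) in \<open>simp_all add: C.p_triangle\<close>)
  with b'(1) show "\<exists>a\<in>carrier ?C. (\<lambda>n. \<parallel>U n \<ominus>\<^bsub>?C\<^esub> a\<parallel>\<^bsub>?C\<^esub>) \<longlonglongrightarrow> 0"
    by blast
qed

lemma const_star_hom: "(\<lambda>a\<in>carrier A. cls (\<lambda>n. a)) \<in> star_homs A (completion A p)"
  by (rule star_homsI) (simp_all add: completion_ops)

lemma completion_extension:
  assumes "cstar_algebra B" "\<phi> \<in> star_homs A B"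
    and contr: "\<And>a. a \<in> carrier A \<Longrightarrow> \<parallel>\<phi> a\<parallel>\<^bsub>B\<^esub> \<le> p a"
  obtains \<psi> where "\<psi> \<in> star_homs (completion A p) B" "\<And>a. a \<in> carrier A \<Longrightarrow> \<psi> (cls (\<lambda>n. a)) = \<phi> a"
proof -
  interpret B: cstar_algebra B by fact
  note hom = star_homsD[OF assms(2)]
  have le: "\<parallel>\<phi> a \<ominus>\<^bsub>B\<^esub> \<phi> b\<parallel>\<^bsub>B\<^esub> \<le> p (a \<ominus> b)" if "a \<in> carrier A" "b \<in> carrier A" for a b
    using contr[of "a \<ominus> b"] that star_hom_minus[OF star_algebra_axioms assms(2)] by simp
  define lim where "lim s b \<longleftrightarrow> b \<in> carrier B \<and> (\<lambda>n. \<parallel>\<phi> (s n) \<ominus>\<^bsub>B\<^esub> b\<parallel>\<^bsub>B\<^esub>) \<longlonglongrightarrow> 0" for s b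
  define \<psi> where "\<psi> u = (if u \<in> carrier (completion A p)
    then SOME b. \<exists>s\<in>cauchy_seqs A p. u = cls s \<and> lim s b else undefined)" for u
  have cauchy: "(\<lambda>n. \<phi> (s n)) \<in> cauchy_seqs B (nrm B)" if s: "s \<in> cauchy_seqs A p" for s
  proof (rule B.cauchy_seqsI)
    show "((\<lambda>i. \<parallel>\<phi> (s (fst i)) \<ominus>\<^bsub>B\<^esub> \<phi> (s (snd i))\<parallel>\<^bsub>B\<^esub>) \<longlongrightarrow> 0) (sequentially \<times>\<^sub>F sequentially)"
      by (rule tendsto_sandwich[OF _ _ tendsto_const cauchy_seqs_null[OF s]])
        (use s hom(1) le in auto)
  qed (use s hom in auto)
  have \<psi>_eq: "\<psi> (cls s) = b" if s: "s \<in> cauchy_seqs A p" and b: "lim s b" for s b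
  proof -
    have "\<exists>b. \<exists>t\<in>cauchy_seqs A p. cls s = cls t \<and> lim t b"
      using s b by blast
    from someI_ex[OF this] obtain t where t: "t \<in> cauchy_seqs A p" "cls s = cls t" "lim t (\<psi> (cls s))"
      using s by (auto simp: \<psi>_def)
    have st: "(\<lambda>n. p (s n \<ominus> t n)) \<longlonglongrightarrow> 0"
      using s t by (simp add: cls_eq_iff)
    have "(\<lambda>n. \<parallel>\<phi> (s n) \<ominus>\<^bsub>B\<^esub> \<phi> (t n)\<parallel>\<^bsub>B\<^esub>) \<longlonglongrightarrow> 0"
      by (rule tendsto_sandwich[OF _ _ tendsto_const st]) (use s t hom(1) le in auto)
    then have "(\<lambda>n. \<parallel>\<phi> (s n) \<ominus>\<^bsub>B\<^esub> \<phi> (t n)\<parallel>\<^bsub>B\<^esub> + \<parallel>\<phi> (t n) \<ominus>\<^bsub>B\<^esub> \<psi> (cls s)\<parallel>\<^bsub>B\<^esub>) \<longlonglongrightarrow> 0"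
      using t by (intro tendsto_add_zero) (simp_all add: lim_def)
    then have "(\<lambda>n. \<parallel>\<phi> (s n) \<ominus>\<^bsub>B\<^esub> \<psi> (cls s)\<parallel>\<^bsub>B\<^esub>) \<longlonglongrightarrow> 0"
      by (rule tendsto_sandwich[OF _ _ tendsto_const, rotated 2])
        (use s t hom(1) in \<open>simp_all add: B.p_triangle lim_def\<close>)
    then show ?thesis
      using s t b hom(1) by (intro B.limit_unique[of "\<lambda>n. \<phi> (s n)"]) (simp_all add: lim_def)
  qed
  have lim: "\<psi> (cls s) \<in> carrier B" "(\<lambda>n. \<parallel>\<phi> (s n) \<ominus>\<^bsub>B\<^esub> \<psi> (cls s)\<parallel>\<^bsub>B\<^esub>) \<longlonglongrightarrow> 0"
    if s: "s \<in> cauchy_seqs A p" for s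
    using B.convergent[OF cauchy[OF s]] \<psi>_eq[OF s] by (auto simp: lim_def)
  have \<phi>c: "\<phi> (s n) \<in> carrier B" if "s \<in> cauchy_seqs A p" for s n
    using that hom(1) by simp
  have "\<psi> \<in> star_homs (completion A p) B"
  proof (rule star_homsI)
    fix u
    assume "u \<in> carrier (completion A p)"
    then obtain s where s: "s \<in> cauchy_seqs A p" "u = cls s" by (rule completionE)
    show "\<psi> u \<in> carrier B"
      using s lim by simp
    show "\<psi> (c \<odot>\<^bsub>completion A p\<^esub> u) = c \<odot>\<^bsub>B\<^esub> \<psi> u" for c
      using s lim hom B.null_scale[of "\<lambda>n. \<phi> (s n)" "\<lambda>_. \<psi> u" sequentially c]
      by (auto simp: completion_ops lim_def intro!: \<psi>_eq)
    show "\<psi> (star (completion A p) u) = star B (\<psi> u)"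
      using s lim hom B.null_star[of "\<lambda>n. \<phi> (s n)" "\<lambda>_. \<psi> u" sequentially]
      by (auto simp: completion_ops lim_def intro!: \<psi>_eq)
    fix v
    assume "v \<in> carrier (completion A p)"
    then obtain t where t: "t \<in> cauchy_seqs A p" "v = cls t" by (rule completionE)
    show "\<psi> (u \<oplus>\<^bsub>completion A p\<^esub> v) = \<psi> u \<oplus>\<^bsub>B\<^esub> \<psi> v"
      using s t lim hom B.null_add[of "\<lambda>n. \<phi> (s n)" "\<lambda>_. \<psi> u" "\<lambda>n. \<phi> (t n)" "\<lambda>_. \<psi> v" sequentially]
      by (auto simp: completion_ops lim_def intro!: \<psi>_eq)
    obtain K where "\<And>n. \<parallel>\<phi> (s n)\<parallel>\<^bsub>B\<^esub> \<le> K"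
      using B.cauchy_seqs_bounded[OF cauchy[OF s(1)]] by blast
    then show "\<psi> (u \<otimes>\<^bsub>completion A p\<^esub> v) = \<psi> u \<otimes>\<^bsub>B\<^esub> \<psi> v"
      using s t lim hom B.null_mult[of "\<lambda>n. \<phi> (s n)" "\<lambda>_. \<psi> u" "\<lambda>n. \<phi> (t n)" "\<lambda>_. \<psi> v" sequentially K "\<parallel>\<psi> v\<parallel>\<^bsub>B\<^esub>"]
      by (auto simp: completion_ops lim_def intro!: \<psi>_eq)
  next
    show "\<psi> \<in> extensional (carrier (completion A p))"
      by (simp add: extensional_def \<psi>_def)
  qed
  moreover have "\<psi> (cls (\<lambda>n. a)) = \<phi> a" if "a \<in> carrier A" for a
    using that hom(1) by (intro \<psi>_eq) (simp_all add: lim_def)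
  ultimately show thesis by (rule that)
qed

text \<open>
  Continuity of the two *-homomorphisms is automatic, by contractivity, so that agreement on the dense
  image of the *-algebra suffices.
\<close>

lemma completion_hom_unique:
  assumes "cstar_algebra B" "\<phi> \<in> star_homs (completion A p) B" "\<psi> \<in> star_homs (completion A p) B"
    and eq: "\<And>a. a \<in> carrier A \<Longrightarrow> \<phi> (cls (\<lambda>n. a)) = \<psi> (cls (\<lambda>n. a))"
  shows "\<phi> = \<psi>"
proof (rule star_homs_eqI[OF assms(2,3)])
  let ?C = "completion A p"
  interpret B: cstar_algebra B by fact
  interpret C: cstar_algebra ?C by (rule cstar_algebra_completion)
  fix u
  assume u: "u \<in> carrier ?C"
  have \<phi>u: "\<phi> u \<in> carrier B" "\<psi> u \<in> carrier B"
    using u star_homsD(1) assms(2,3) by metis+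
  have "\<parallel>\<phi> u \<ominus>\<^bsub>B\<^esub> \<psi> u\<parallel>\<^bsub>B\<^esub> \<le> e" if "0 < e" for e
  proof -
    obtain a where a: "a \<in> carrier A" "\<parallel>u \<ominus>\<^bsub>?C\<^esub> cls (\<lambda>n. a)\<parallel>\<^bsub>?C\<^esub> < e / 2"
      using const_dense[OF u, of "e / 2"] \<open>0 < e\<close> by auto
    have le: "\<parallel>\<eta> u \<ominus>\<^bsub>B\<^esub> \<eta> (cls (\<lambda>n. a))\<parallel>\<^bsub>B\<^esub> \<le> e / 2" if "\<eta> \<in> star_homs ?C B" for \<eta>
    proof -
      have "\<parallel>\<eta> (u \<ominus>\<^bsub>?C\<^esub> cls (\<lambda>n. a))\<parallel>\<^bsub>B\<^esub> \<le> \<parallel>u \<ominus>\<^bsub>?C\<^esub> cls (\<lambda>n. a)\<parallel>\<^bsub>?C\<^esub>"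
        by (rule star_hom_contractive[OF C.cstar_algebra_axioms B.seminormed_star_algebra_axioms that])
          (use u a in simp)
      then show ?thesis
        using a u star_hom_minus[OF C.star_algebra_axioms that] by simp
    qed
    let ?a = "\<phi> (cls (\<lambda>n. a))"
    have ac: "?a \<in> carrier B"
      using a star_homsD(1)[OF assms(2)] by simp
    have "\<parallel>\<phi> u \<ominus>\<^bsub>B\<^esub> \<psi> u\<parallel>\<^bsub>B\<^esub> \<le> \<parallel>\<phi> u \<ominus>\<^bsub>B\<^esub> ?a\<parallel>\<^bsub>B\<^esub> + \<parallel>?a \<ominus>\<^bsub>B\<^esub> \<psi> u\<parallel>\<^bsub>B\<^esub>"
      using \<phi>u ac by (simp add: B.p_triangle)
    also have "\<parallel>?a \<ominus>\<^bsub>B\<^esub> \<psi> u\<parallel>\<^bsub>B\<^esub> = \<parallel>\<psi> u \<ominus>\<^bsub>B\<^esub> ?a\<parallel>\<^bsub>B\<^esub>"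
      using \<phi>u ac by (simp add: B.p_minus_commute)
    finally show ?thesis
      using le[OF assms(2)] le[OF assms(3)] eq[OF a(1)] by simp
  qed
  then have "\<parallel>\<phi> u \<ominus>\<^bsub>B\<^esub> \<psi> u\<parallel>\<^bsub>B\<^esub> \<le> 0"
    by (metis dense_ge)
  then have "\<parallel>\<phi> u \<ominus>\<^bsub>B\<^esub> \<psi> u\<parallel>\<^bsub>B\<^esub> = 0"
    using \<phi>u by (simp add: order_antisym)
  then show "\<phi> u = \<psi> u"
    using \<phi>u by (simp add: B.p_minus_eq_zero_iff)
qed

end

section \<open>The free *-algebra\<close>

lemma adj_letter_adj_letter [simp]: "adj_letter (adj_letter a) = a"
  by (cases a) simp_all

text \<open>The adjoint of a word.\<close>

definition adj_word :: "'x letter list \<Rightarrow> 'x letter list" where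
  "adj_word w = rev (map adj_letter w)"

lemma adj_word_adj_word [simp]: "adj_word (adj_word w) = w"
  by (simp add: adj_word_def rev_map comp_def)

lemma length_adj_word [simp]: "length (adj_word w) = length w"
  by (simp add: adj_word_def)

lemma take_adj_word: "take i (adj_word w) = adj_word (drop (length w - i) w)"
  by (simp add: adj_word_def take_rev drop_map)

lemma drop_adj_word: "drop i (adj_word w) = adj_word (take (length w - i) w)"
  by (simp add: adj_word_def drop_rev take_map)

lemma adj_word_star_words [simp]:
  assumes "w \<in> star_words X"
  shows "adj_word w \<in> star_words X"
proof -
  have "adj_letter a \<in> Gen ` X \<union> Adj ` X" if "a \<in> Gen ` X \<union> Adj ` X" for a
    using that by auto
  then show ?thesis
    using assms by (auto simp: star_words_def adj_word_def subset_iff)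
qed

lemma append_star_words [simp]:
  "u \<in> star_words X \<Longrightarrow> v \<in> star_words X \<Longrightarrow> u @ v \<in> star_words X"
  by (simp add: star_words_def)

lemma Cons_star_words_iff:
  "a # w \<in> star_words X \<longleftrightarrow> a \<in> Gen ` X \<union> Adj ` X \<and> (w = [] \<or> w \<in> star_words X)"
  by (auto simp: star_words_def)

text \<open>The *-polynomial that consists of a single word.\<close>

definition monomial :: "'x letter list \<Rightarrow> 'x star_poly" where
  "monomial w = (\<lambda>v. if v = w then 1 else 0)"

lemma free_gen_eq_monomial: "free_gen x = monomial [Gen x]"
  by (simp add: free_gen_def monomial_def)

lemma free_carrier_iff:
  "p \<in> carrier (free_star_alg X) \<longleftrightarrow> finite {w. p w \<noteq> 0} \<and> {w. p w \<noteq> 0} \<subseteq> star_words X"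
  by (simp add: free_star_alg_def)

lemma free_ops:
  "\<zero>\<^bsub>free_star_alg X\<^esub> = (\<lambda>w. 0)"
  "p \<oplus>\<^bsub>free_star_alg X\<^esub> q = (\<lambda>w. p w + q w)"
  "p \<otimes>\<^bsub>free_star_alg X\<^esub> q = (\<lambda>w. \<Sum>i\<le>length w. p (take i w) * q (drop i w))"
  "c \<odot>\<^bsub>free_star_alg X\<^esub> p = (\<lambda>w. c * p w)"
  "star (free_star_alg X) p = (\<lambda>w. cnj (p (adj_word w)))"
  by (simp_all add: free_star_alg_def adj_word_def)

lemma free_mult_assoc:
  fixes p q r :: "'x star_poly"
  shows "(p \<otimes>\<^bsub>free_star_alg X\<^esub> q) \<otimes>\<^bsub>free_star_alg X\<^esub> r =
    p \<otimes>\<^bsub>free_star_alg X\<^esub> (q \<otimes>\<^bsub>free_star_alg X\<^esub> r)"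
proof
  fix w :: "'x letter list"
  let ?n = "length w"
  define f where "f j m = p (take j w) * q (take m (drop j w)) * r (drop (j + m) w)" for j m
  have "((p \<otimes>\<^bsub>free_star_alg X\<^esub> q) \<otimes>\<^bsub>free_star_alg X\<^esub> r) w = (\<Sum>i\<le>?n. \<Sum>j\<le>i. f j (i - j))"
    by (simp add: free_ops sum_distrib_right f_def min_absorb1 min_absorb2 drop_take cong: sum.cong_simp)
  also have "\<dots> = (\<Sum>(j, m)\<in>{(j, m). j + m \<le> ?n}. f j m)"
    by (rule sum.triangle_reindex_eq[symmetric])
  also have "{(j, m). j + m \<le> ?n} = (SIGMA j:{..?n}. {..?n - j})"
    by auto
  also have "(\<Sum>(j, m)\<in>\<dots>. f j m) = (\<Sum>j\<le>?n. \<Sum>m\<le>?n - j. f j m)"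
    by (rule sum.Sigma[symmetric]) simp_all
  also have "\<dots> = (p \<otimes>\<^bsub>free_star_alg X\<^esub> (q \<otimes>\<^bsub>free_star_alg X\<^esub> r)) w"
    by (simp add: free_ops sum_distrib_left f_def mult.assoc add.commute)
  finally show "((p \<otimes>\<^bsub>free_star_alg X\<^esub> q) \<otimes>\<^bsub>free_star_alg X\<^esub> r) w =
      (p \<otimes>\<^bsub>free_star_alg X\<^esub> (q \<otimes>\<^bsub>free_star_alg X\<^esub> r)) w" .
qed

lemma free_star_mult:
  fixes p q :: "'x star_poly"
  shows "star (free_star_alg X) (p \<otimes>\<^bsub>free_star_alg X\<^esub> q) =
    star (free_star_alg X) q \<otimes>\<^bsub>free_star_alg X\<^esub> star (free_star_alg X) p"
proof
  fix w :: "'x letter list"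
  have "(\<Sum>i\<le>length w. cnj (p (adj_word (drop (length w - i) w))) * cnj (q (adj_word (take (length w - i) w)))) =
      (\<Sum>i\<le>length w. cnj (q (adj_word (take i w))) * cnj (p (adj_word (drop i w))))"
    by (rule sum.reindex_bij_witness[of _ "\<lambda>i. length w - i" "\<lambda>i. length w - i"]) auto
  then show "star (free_star_alg X) (p \<otimes>\<^bsub>free_star_alg X\<^esub> q) w =
      (star (free_star_alg X) q \<otimes>\<^bsub>free_star_alg X\<^esub> star (free_star_alg X) p) w"
    by (simp add: free_ops take_adj_word drop_adj_word)
qed

lemma free_mult_closed:
  assumes "p \<in> carrier (free_star_alg X)" "q \<in> carrier (free_star_alg X)"
  shows "p \<otimes>\<^bsub>free_star_alg X\<^esub> q \<in> carrier (free_star_alg X)"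
proof -
  let ?S = "(\<lambda>(u, v). u @ v) ` ({u. p u \<noteq> 0} \<times> {v. q v \<noteq> 0})"
  have "w \<in> ?S" if "(p \<otimes>\<^bsub>free_star_alg X\<^esub> q) w \<noteq> 0" for w
  proof -
    obtain i where "p (take i w) * q (drop i w) \<noteq> 0"
      using \<open>(p \<otimes>\<^bsub>free_star_alg X\<^esub> q) w \<noteq> 0\<close> unfolding free_ops by (meson sum.neutral)
    then show ?thesis
      by (intro image_eqI[of _ _ "(take i w, drop i w)"]) simp_all
  qed
  then have sub: "{w. (p \<otimes>\<^bsub>free_star_alg X\<^esub> q) w \<noteq> 0} \<subseteq> ?S"
    by blast
  have "finite ?S" "?S \<subseteq> star_words X"
    using assms by (auto simp: free_carrier_iff subset_iff)
  with sub show ?thesis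
    unfolding free_carrier_iff by (meson finite_subset subset_trans)
qed

lemma free_star_closed:
  assumes "p \<in> carrier (free_star_alg X)"
  shows "star (free_star_alg X) p \<in> carrier (free_star_alg X)"
proof -
  have "{w. star (free_star_alg X) p w \<noteq> 0} = adj_word ` {w. p w \<noteq> 0}"
    by (auto simp: free_ops intro!: image_eqI[of _ adj_word "adj_word _"])
  then show ?thesis
    using assms unfolding free_carrier_iff by (auto simp: subset_iff)
qed

lemma star_algebra_free: "star_algebra (free_star_alg (X :: 'x set))"
proof
  fix p q r :: "'x star_poly" and c d :: complex
  let ?F = "free_star_alg X"
  show "\<zero>\<^bsub>?F\<^esub> \<in> carrier ?F"
    by (simp add: free_carrier_iff free_ops)
  show "(p \<otimes>\<^bsub>?F\<^esub> q) \<otimes>\<^bsub>?F\<^esub> r = p \<otimes>\<^bsub>?F\<^esub> (q \<otimes>\<^bsub>?F\<^esub> r)"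
    by (rule free_mult_assoc)
  show "star ?F (p \<otimes>\<^bsub>?F\<^esub> q) = star ?F q \<otimes>\<^bsub>?F\<^esub> star ?F p"
    by (rule free_star_mult)
  assume p: "p \<in> carrier ?F"
  show scale: "c \<odot>\<^bsub>?F\<^esub> p \<in> carrier ?F" for c
    using p by (auto simp: free_carrier_iff free_ops elim!: rev_finite_subset)
  show "\<exists>q\<in>carrier ?F. p \<oplus>\<^bsub>?F\<^esub> q = \<zero>\<^bsub>?F\<^esub>"
    by (rule bexI[OF _ scale[of "-1"]]) (simp add: free_ops)
  show "star ?F p \<in> carrier ?F"
    using p by (rule free_star_closed)
  assume q: "q \<in> carrier ?F"
  show "p \<otimes>\<^bsub>?F\<^esub> q \<in> carrier ?F"
    using p q by (rule free_mult_closed)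
  have "{w. p w + q w \<noteq> 0} \<subseteq> {w. p w \<noteq> 0} \<union> {w. q w \<noteq> 0}"
    by auto
  then show "p \<oplus>\<^bsub>?F\<^esub> q \<in> carrier ?F"
    using p q unfolding free_carrier_iff free_ops by (meson finite_UnI finite_subset le_sup_iff subset_trans)
qed (simp_all add: free_ops algebra_simps sum.distrib sum_distrib_left)

lemma monomial_carrier [simp]: "w \<in> star_words X \<Longrightarrow> monomial w \<in> carrier (free_star_alg X)"
  by (auto simp: free_carrier_iff monomial_def)

lemma gen_star_words [simp]: "x \<in> X \<Longrightarrow> [Gen x] \<in> star_words X" "x \<in> X \<Longrightarrow> [Adj x] \<in> star_words X"
  by (simp_all add: star_words_def)

lemma free_gen_carrier [simp]: "x \<in> X \<Longrightarrow> free_gen x \<in> carrier (free_star_alg X)"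
  by (simp add: free_gen_eq_monomial)

lemma monomial_append:
  fixes u v :: "'x letter list"
  shows "monomial u \<otimes>\<^bsub>free_star_alg X\<^esub> monomial v = monomial (u @ v)"
proof
  fix w :: "'x letter list"
  have "(\<Sum>i\<le>length w. monomial u (take i w) * monomial v (drop i w) :: complex) =
      (\<Sum>i\<le>length w. if i = length u then (if w = u @ v then 1 else 0) else 0)"
  proof (rule sum.cong)
    fix i
    assume "i \<in> {..length w}"
    then have eq: "take i w = u \<and> drop i w = v \<longleftrightarrow> i = length u \<and> w = u @ v"
      by (metis append_eq_conv_conj append_take_drop_id atMost_iff length_take min.absorb2)
    have "monomial u (take i w) * monomial v (drop i w) =
        (if take i w = u \<and> drop i w = v then 1 else (0::complex))"
      by (simp add: monomial_def)
    also have "\<dots> = (if i = length u then if w = u @ v then 1 else 0 else 0)"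
      unfolding eq by simp
    finally show "monomial u (take i w) * monomial v (drop i w) =
        (if i = length u then if w = u @ v then 1 else 0 else (0::complex))" .
  qed simp
  also have "\<dots> = monomial (u @ v) w"
    by (auto simp: monomial_def)
  finally show "(monomial u \<otimes>\<^bsub>free_star_alg X\<^esub> monomial v) w = monomial (u @ v) w"
    by (simp add: free_ops)
qed

lemma star_monomial: "star (free_star_alg X) (monomial w) = monomial (adj_word w)"
  by (auto simp: free_ops monomial_def fun_eq_iff)

lemma free_star_alg_induct [consumes 1, case_names zero add]:
  assumes "p \<in> carrier (free_star_alg X)"
    and "P \<zero>\<^bsub>free_star_alg X\<^esub>"
    and "\<And>c w q. \<lbrakk>w \<in> star_words X; q \<in> carrier (free_star_alg X); P q\<rbrakk> \<Longrightarrow>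
      P (c \<odot>\<^bsub>free_star_alg X\<^esub> monomial w \<oplus>\<^bsub>free_star_alg X\<^esub> q)"
  shows "P p"
proof -
  have "finite {w. p w \<noteq> 0}"
    using assms(1) by (simp add: free_carrier_iff)
  then show ?thesis
    using assms(1)
  proof (induction "{w. p w \<noteq> 0}" arbitrary: p rule: finite_psubset_induct)
    case psubset
    show ?case
    proof (cases "p = (\<lambda>w. 0)")
      case True
      then show ?thesis using assms(2) by (simp add: free_ops)
    next
      case False
      then obtain w where w: "p w \<noteq> 0" by auto
      define q where "q = p(w := 0)"
      have "{v. q v \<noteq> 0} \<subset> {v. p v \<noteq> 0}"
        using w by (auto simp: q_def)
      moreover from this have q: "q \<in> carrier (free_star_alg X)"
        using psubset.prems unfolding free_carrier_iff by (meson finite_subset psubset_imp_subset subset_trans)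
      ultimately have "P q"
        by (rule psubset.hyps)
      moreover have "w \<in> star_words X"
        using w psubset.prems by (auto simp: free_carrier_iff)
      moreover have "p = p w \<odot>\<^bsub>free_star_alg X\<^esub> monomial w \<oplus>\<^bsub>free_star_alg X\<^esub> q"
        by (auto simp: free_ops q_def monomial_def)
      ultimately show ?thesis
        using assms(3) q by metis
    qed
  qed
qed

text \<open>The generators generate the free *-algebra.\<close>

lemma free_star_alg_generated [consumes 1, case_names zero gen add scale mult star]:
  assumes "p \<in> carrier (free_star_alg X)"
    and zero: "P \<zero>\<^bsub>free_star_alg X\<^esub>"
    and gen: "\<And>x. x \<in> X \<Longrightarrow> P (free_gen x)"
    and add: "\<And>p q. \<lbrakk>p \<in> carrier (free_star_alg X); q \<in> carrier (free_star_alg X); P p; P q\<rbrakk> \<Longrightarrow>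
      P (p \<oplus>\<^bsub>free_star_alg X\<^esub> q)"
    and scale: "\<And>c p. \<lbrakk>p \<in> carrier (free_star_alg X); P p\<rbrakk> \<Longrightarrow> P (c \<odot>\<^bsub>free_star_alg X\<^esub> p)"
    and mult: "\<And>p q. \<lbrakk>p \<in> carrier (free_star_alg X); q \<in> carrier (free_star_alg X); P p; P q\<rbrakk> \<Longrightarrow>
      P (p \<otimes>\<^bsub>free_star_alg X\<^esub> q)"
    and star: "\<And>p. \<lbrakk>p \<in> carrier (free_star_alg X); P p\<rbrakk> \<Longrightarrow> P (star (free_star_alg X) p)"
  shows "P p"
proof -
  interpret F: star_algebra "free_star_alg X" by (rule star_algebra_free)
  have letter: "P (monomial [a])" if "a \<in> Gen ` X \<union> Adj ` X" for a
  proof (cases a)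
    case (Gen x)
    then show ?thesis using that gen by (auto simp: free_gen_eq_monomial)
  next
    case (Adj x)
    then have "x \<in> X" using that by auto
    moreover have "monomial [a] = star (free_star_alg X) (free_gen x)"
      using Adj by (simp add: free_gen_eq_monomial star_monomial adj_word_def)
    ultimately show ?thesis using gen star by simp
  qed
  have monomial: "P (monomial w)" if "w \<in> star_words X" for w
    using that
  proof (induction w)
    case (Cons a w)
    show ?case
    proof (cases "w = []")
      case True
      then show ?thesis using Cons.prems letter by (simp add: Cons_star_words_iff)
    next
      case False
      then have w: "w \<in> star_words X" "a \<in> Gen ` X \<union> Adj ` X"
        using Cons.prems by (simp_all add: Cons_star_words_iff)
      then have "[a] \<in> star_words X"
        by (simp add: Cons_star_words_iff)
      then have "P (monomial [a] \<otimes>\<^bsub>free_star_alg X\<^esub> monomial w)"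
        using w Cons.IH letter by (intro mult) simp_all
      then show ?thesis by (simp add: monomial_append)
    qed
  qed (simp add: star_words_def)
  show ?thesis
    using assms(1)
  proof (induction rule: free_star_alg_induct)
    case (add c w q)
    then show ?case using monomial scale by (intro assms(4)) simp_all
  qed (rule zero)
qed

lemma free_hom_unique:
  assumes "\<phi> \<in> star_homs (free_star_alg X) B" "\<psi> \<in> star_homs (free_star_alg X) B"
    and B: "star_algebra B" and eq: "\<And>x. x \<in> X \<Longrightarrow> \<phi> (free_gen x) = \<psi> (free_gen x)"
  shows "\<phi> = \<psi>"
proof (rule star_homs_eqI[OF assms(1,2)])
  fix p
  assume "p \<in> carrier (free_star_alg X)"
  then show "\<phi> p = \<psi> p"
  proof (induction rule: free_star_alg_generated)
    case zero
    show ?case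
      using star_hom_zero[OF star_algebra_free B] assms(1,2) by metis
  qed (simp_all add: eq star_homsD[OF assms(1)] star_homsD[OF assms(2)])
qed

section \<open>Evaluation of *-polynomials\<close>

context star_algebra
begin

text \<open>
  Finite sums in the carrier. As addition is commutative on the carrier only, the folded function leaves
  other elements alone.
\<close>

definition asum :: "('i \<Rightarrow> 'a) \<Rightarrow> 'i set \<Rightarrow> 'a" where
  "asum f S = Finite_Set.fold (\<lambda>i a. if a \<in> carrier A then f i \<oplus> a else a) \<zero> S"

lemma asum_empty [simp]: "asum f {} = \<zero>"
  by (simp add: asum_def)

lemma
  assumes "finite S" "\<And>j. j \<in> S \<Longrightarrow> f j \<in> carrier A"
  shows asum_closed [simp]: "asum f S \<in> carrier A"
    and asum_remove: "i \<in> S \<Longrightarrow> asum f S = f i \<oplus> asum f (S - {i})"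
proof -
  let ?g = "\<lambda>i a. if a \<in> carrier A then f i \<oplus> a else a"
  interpret comp_fun_commute_on S ?g
    by standard (use assms(2) add_left_commute in \<open>auto simp: fun_eq_iff\<close>)
  have closed: "asum f T \<in> carrier A" if "finite T" "T \<subseteq> S" for T
    using that
  proof (induction T)
    case (insert j T)
    then show ?case
      using assms(2) by (simp add: asum_def fold_insert)
  qed simp
  then show "asum f S \<in> carrier A"
    using assms(1) by blast
  show "asum f S = f i \<oplus> asum f (S - {i})" if "i \<in> S"
    using closed[of "S - {i}"] fold_rec[OF subset_refl assms(1) that, of \<zero>] assms(1)
    by (auto simp: asum_def)
qed

lemma asum_insert [simp]:
  assumes "finite S" "i \<notin> S" "f i \<in> carrier A" "\<And>j. j \<in> S \<Longrightarrow> f j \<in> carrier A"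
  shows "asum f (insert i S) = f i \<oplus> asum f S"
  using asum_remove[of "insert i S" f i] assms by auto

lemma asum_add:
  assumes "finite S" "\<And>j. j \<in> S \<Longrightarrow> f j \<in> carrier A" "\<And>j. j \<in> S \<Longrightarrow> g j \<in> carrier A"
  shows "asum (\<lambda>j. f j \<oplus> g j) S = asum f S \<oplus> asum g S"
  using assms
proof (induction S)
  case (insert i S)
  then show ?case by (simp add: add_ac)
qed (simp add: add_zero)

lemma asum_scale:
  assumes "finite S" "\<And>j. j \<in> S \<Longrightarrow> f j \<in> carrier A"
  shows "asum (\<lambda>j. c \<odot> f j) S = c \<odot> asum f S"
  using assms by (induction S) (simp_all add: scale_add)

lemma asum_cong:
  assumes "finite S" "\<And>j. j \<in> S \<Longrightarrow> f j \<in> carrier A" "\<And>j. j \<in> S \<Longrightarrow> f j = g j"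
  shows "asum f S = asum g S"
  using assms
proof (induction S)
  case (insert i S)
  then have "asum f S = asum g S" by simp
  moreover have "f i = g i" "\<And>j. j \<in> S \<Longrightarrow> g j \<in> carrier A" "g i \<in> carrier A"
    using insert.prems by (metis insert_iff)+
  ultimately show ?case
    using insert by simp
qed simp

lemma asum_mono_neutral:
  assumes "finite S" "T \<subseteq> S" "\<And>j. j \<in> S \<Longrightarrow> f j \<in> carrier A" "\<And>j. j \<in> S - T \<Longrightarrow> f j = \<zero>"
  shows "asum f T = asum f S"
proof -
  have "asum f (T \<union> U) = asum f T" if "finite U" "U \<subseteq> S - T" for U
    using that
  proof (induction U)
    case (insert i U)
    have fin: "finite (T \<union> U)"
      using insert finite_subset[OF assms(2,1)] by simp
    have sub: "T \<union> U \<subseteq> S" "i \<in> S - T" "i \<notin> T \<union> U"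
      using insert assms(2) by auto
    have "asum f (insert i (T \<union> U)) = f i \<oplus> asum f (T \<union> U)"
      using fin sub assms(3) by (intro asum_insert) auto
    also have "asum f (T \<union> U) \<in> carrier A"
      using fin sub(1) assms(3) by (intro asum_closed) auto
    then have "f i \<oplus> asum f (T \<union> U) = asum f (T \<union> U)"
      using assms(4)[OF sub(2)] by simp
    finally show ?case using insert by simp
  qed simp
  from this[of "S - T"] assms(1,2) show ?thesis
    by (simp add: Un_absorb1)
qed

text \<open>
  The value of a word, and of a *-polynomial, when each generator \<open>x\<close> is replaced by \<open>f x\<close>. For want
  of a unit the empty word, which is not among the words of the free *-algebra, gets the value 0.
\<close>

primrec letter_val :: "('x \<Rightarrow> 'a) \<Rightarrow> 'x letter \<Rightarrow> 'a" where
  "letter_val f (Gen x) = f x"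
| "letter_val f (Adj x) = star A (f x)"

primrec word_val :: "('x \<Rightarrow> 'a) \<Rightarrow> 'x letter list \<Rightarrow> 'a" where
  "word_val f [] = \<zero>"
| "word_val f (a # w) = (if w = [] then letter_val f a else letter_val f a \<otimes> word_val f w)"

definition poly_val :: "('x \<Rightarrow> 'a) \<Rightarrow> 'x star_poly \<Rightarrow> 'a" where
  "poly_val f p = asum (\<lambda>w. p w \<odot> word_val f w) {w. p w \<noteq> 0}"

end

text \<open>An assignment of elements of a *-algebra to the generators.\<close>

locale assignment = star_algebra A for A :: "('a, 'm) star_alg_scheme" (structure) +
  fixes X :: "'x set" and f :: "'x \<Rightarrow> 'a"
  assumes assign [simp]: "x \<in> X \<Longrightarrow> f x \<in> carrier A"
begin

abbreviation F where "F \<equiv> free_star_alg X"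

sublocale F: star_algebra F by (rule star_algebra_free)

lemma letter_val_closed [simp]: "a \<in> Gen ` X \<union> Adj ` X \<Longrightarrow> letter_val f a \<in> carrier A"
  by auto

lemma word_val_closed [simp]: "w \<in> star_words X \<Longrightarrow> word_val f w \<in> carrier A"
  by (induction w) (auto simp: Cons_star_words_iff)

lemma word_val_append:
  "\<lbrakk>u \<in> star_words X; v \<in> star_words X\<rbrakk> \<Longrightarrow> word_val f (u @ v) = word_val f u \<otimes> word_val f v"
proof (induction u)
  case (Cons a u)
  then have "v \<noteq> []" by (auto simp: star_words_def)
  with Cons show ?case
    by (cases "u = []") (auto simp: Cons_star_words_iff mult_assoc)
qed (simp add: star_words_def)

lemma word_val_adj_word: "w \<in> star_words X \<Longrightarrow> word_val f (adj_word w) = star A (word_val f w)"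
proof (induction w)
  case (Cons a w)
  have a: "a \<in> Gen ` X \<union> Adj ` X"
    using Cons.prems by (simp add: Cons_star_words_iff)
  then have adj: "letter_val f (adj_letter a) = star A (letter_val f a)"
    by (auto simp: star_star)
  show ?case
  proof (cases "w = []")
    case True
    with adj show ?thesis by (simp add: adj_word_def)
  next
    case False
    then have w: "w \<in> star_words X"
      using Cons.prems by (simp add: Cons_star_words_iff)
    have "[adj_letter a] \<in> star_words X"
      using a by (auto simp: Cons_star_words_iff)
    moreover have "adj_word (a # w) = adj_word w @ [adj_letter a]"
      by (simp add: adj_word_def)
    ultimately show ?thesis
      using False w a adj Cons.IH by (simp add: word_val_append star_mult)
  qed
qed (simp add: star_words_def)

lemma poly_val_superset:
  assumes "finite S" "{w. p w \<noteq> 0} \<subseteq> S" "S \<subseteq> star_words X"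
  shows "poly_val f p = asum (\<lambda>w. p w \<odot> word_val f w) S"
  unfolding poly_val_def by (rule asum_mono_neutral) (use assms in auto)

lemma poly_val_closed [simp]: "p \<in> carrier F \<Longrightarrow> poly_val f p \<in> carrier A"
  unfolding poly_val_def by (rule asum_closed) (auto simp: free_carrier_iff)

lemma poly_val_zero [simp]: "poly_val f \<zero>\<^bsub>F\<^esub> = \<zero>"
  by (simp add: poly_val_def free_ops)

lemma poly_val_add:
  assumes "p \<in> carrier F" "q \<in> carrier F"
  shows "poly_val f (p \<oplus>\<^bsub>F\<^esub> q) = poly_val f p \<oplus> poly_val f q"
proof -
  let ?S = "{w. p w \<noteq> 0} \<union> {w. q w \<noteq> 0}"
  have S: "finite ?S" "?S \<subseteq> star_words X"
    using assms by (auto simp: free_carrier_iff)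
  have "poly_val f (p \<oplus>\<^bsub>F\<^esub> q) = asum (\<lambda>w. (p w + q w) \<odot> word_val f w) ?S"
    unfolding free_ops by (rule poly_val_superset[OF S(1) _ S(2)]) auto
  also have "\<dots> = asum (\<lambda>w. p w \<odot> word_val f w \<oplus> q w \<odot> word_val f w) ?S"
    by (rule asum_cong) (use S in \<open>auto simp: add_scale\<close>)
  also have "\<dots> = asum (\<lambda>w. p w \<odot> word_val f w) ?S \<oplus> asum (\<lambda>w. q w \<odot> word_val f w) ?S"
    by (rule asum_add) (use S in auto)
  also have "\<dots> = poly_val f p \<oplus> poly_val f q"
    using poly_val_superset[of ?S] S by simp
  finally show ?thesis .
qed

lemma poly_val_scale:
  assumes "p \<in> carrier F"
  shows "poly_val f (c \<odot>\<^bsub>F\<^esub> p) = c \<odot> poly_val f p"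
proof -
  let ?S = "{w. p w \<noteq> 0}"
  have S: "finite ?S" "?S \<subseteq> star_words X"
    using assms by (auto simp: free_carrier_iff)
  have "poly_val f (c \<odot>\<^bsub>F\<^esub> p) = asum (\<lambda>w. (c * p w) \<odot> word_val f w) ?S"
    unfolding free_ops by (rule poly_val_superset[OF S(1) _ S(2)]) auto
  also have "\<dots> = asum (\<lambda>w. c \<odot> p w \<odot> word_val f w) ?S"
    by (rule asum_cong) (use S in \<open>auto simp: scale_scale\<close>)
  also have "\<dots> = c \<odot> poly_val f p"
    unfolding poly_val_def by (rule asum_scale) (use S in auto)
  finally show ?thesis .
qed

lemma poly_val_monomial: 
  assumes "w \<in> star_words X"
  shows "poly_val f (monomial w) = word_val f w"
proof -
  have "poly_val f (monomial w) = asum (\<lambda>v. monomial w v \<odot> word_val f v) {w}"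
    by (rule poly_val_superset) (use assms in \<open>auto simp: monomial_def\<close>)
  also have "\<dots> = word_val f w"
    using assms asum_insert[of "{}" w "\<lambda>v. monomial w v \<odot> word_val f v"]
    by (simp add: monomial_def scale_one add_zero)
  finally show ?thesis .
qed

lemma poly_val_mult:
  assumes p: "p \<in> carrier F" and q: "q \<in> carrier F"
  shows "poly_val f (p \<otimes>\<^bsub>F\<^esub> q) = poly_val f p \<otimes> poly_val f q"
proof -
  have monomial: "poly_val f (monomial w \<otimes>\<^bsub>F\<^esub> q) = word_val f w \<otimes> poly_val f q"
    if w: "w \<in> star_words X" for w
    using q
  proof (induction rule: free_star_alg_induct)
    case (add c v q)
    then show ?case
      using w by (simp add: F.mult_add_right F.mult_scale_right mult_add_right mult_scale_right
          poly_val_add poly_val_scale poly_val_monomial monomial_append word_val_append)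
  qed (use w in simp)
  show ?thesis
    using p
  proof (induction rule: free_star_alg_induct)
    case (add c w p)
    then show ?case
      using q by (simp add: F.mult_add_left F.mult_scale_left mult_add_left mult_scale_left
          poly_val_add poly_val_scale poly_val_monomial monomial)
  qed (use q in simp)
qed

lemma poly_val_star:
  assumes "p \<in> carrier F"
  shows "poly_val f (star F p) = star A (poly_val f p)"
  using assms
proof (induction rule: free_star_alg_induct)
  case (add c w p)
  then show ?case
    by (simp add: F.star_add F.star_scale star_add star_scale poly_val_add poly_val_scale
        star_monomial poly_val_monomial word_val_adj_word)
qed simp

lemma poly_val_star_hom: "restrict (poly_val f) (carrier F) \<in> star_homs F A"
  by (rule star_homsI) (simp_all add: poly_val_add poly_val_scale poly_val_mult poly_val_star)

lemma poly_val_gen: "x \<in> X \<Longrightarrow> poly_val f (free_gen x) = f x"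
  by (simp add: free_gen_eq_monomial poly_val_monomial)

end

section \<open>The universal C*-seminorms\<close>

text \<open>The C*-seminorms whose supremum is the universal one.\<close>

definition bounded_seminorms :: "'x set \<Rightarrow> ('x \<Rightarrow> real) \<Rightarrow> ('x star_poly \<Rightarrow> real) set" where
  "bounded_seminorms X l =
    {p. cstar_seminorm (free_star_alg X) p \<and> (\<forall>x\<in>X. p (free_gen x) \<le> l x)}"

lemma univ_seminorm_eq: "univ_seminorm X l w = (SUP p\<in>bounded_seminorms X l. p w)"
  unfolding univ_seminorm_def bounded_seminorms_def by (rule arg_cong[where f = Sup]) auto

lemma bounded_seminormsD:
  assumes "p \<in> bounded_seminorms X l"
  shows "seminormed_star_algebra (free_star_alg X) p"
proof -
  interpret F: star_algebra "free_star_alg X" by (rule star_algebra_free)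
  show ?thesis
    by standard (use assms in \<open>simp add: bounded_seminorms_def\<close>)
qed

lemma bounded_seminorms_bdd:
  assumes "w \<in> carrier (free_star_alg X)"
  shows "bdd_above ((\<lambda>p. p w) ` bounded_seminorms X l)"
proof -
  have "\<exists>M. \<forall>p\<in>bounded_seminorms X l. p w \<le> M"
    using assms
  proof (induction rule: free_star_alg_generated)
    case zero
    then show ?case
      by (metis bounded_seminormsD seminormed_star_algebra.p_zero order_refl)
  next
    case (gen x)
    then show ?case by (auto simp: bounded_seminorms_def)
  next
    case (add u v)
    then obtain M N where MN: "\<forall>p\<in>bounded_seminorms X l. p u \<le> M" "\<forall>p\<in>bounded_seminorms X l. p v \<le> N"
      by blast
    have "p (u \<oplus>\<^bsub>free_star_alg X\<^esub> v) \<le> M + N" if p: "p \<in> bounded_seminorms X l" for p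
      using seminormed_star_algebra.p_add[OF bounded_seminormsD[OF p] add(1,2)] MN p by force
    then show ?case by blast
  next
    case (scale c u)
    then obtain M where M: "\<forall>p\<in>bounded_seminorms X l. p u \<le> M"
      by blast
    have "p (c \<odot>\<^bsub>free_star_alg X\<^esub> u) \<le> cmod c * M" if p: "p \<in> bounded_seminorms X l" for p
      using seminormed_star_algebra.p_scale[OF bounded_seminormsD[OF p] scale(1)] M p
      by (simp add: mult_left_mono)
    then show ?case by blast
  next
    case (mult u v)
    then obtain M N where MN: "\<forall>p\<in>bounded_seminorms X l. p u \<le> M" "\<forall>p\<in>bounded_seminorms X l. p v \<le> N"
      by blast
    have "p (u \<otimes>\<^bsub>free_star_alg X\<^esub> v) \<le> M * N" if p: "p \<in> bounded_seminorms X l" for p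
    proof -
      interpret seminormed_star_algebra "free_star_alg X" p
        using p by (rule bounded_seminormsD)
      have "p (u \<otimes>\<^bsub>free_star_alg X\<^esub> v) \<le> p u * p v"
        using mult(1,2) by (rule p_mult)
      also have "\<dots> \<le> M * N"
        using MN p mult(1,2) order_trans[OF p_nonneg[OF mult(1)]] by (intro mult_mono) auto
      finally show ?thesis .
    qed
    then show ?case by blast
  next
    case (star u)
    then show ?case
      by (metis bounded_seminormsD seminormed_star_algebra.p_star)
  qed
  then show ?thesis by (auto simp: bdd_above_def)
qed

lemma le_univ_seminorm:
  "\<lbrakk>p \<in> bounded_seminorms X l; w \<in> carrier (free_star_alg X)\<rbrakk> \<Longrightarrow> p w \<le> univ_seminorm X l w"
  unfolding univ_seminorm_eq by (rule cSUP_upper[OF _ bounded_seminorms_bdd])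

lemma bounded_seminorms_nonempty:
  assumes "\<And>x. x \<in> X \<Longrightarrow> 0 \<le> l x"
  shows "bounded_seminorms X l \<noteq> {}"
proof -
  have "(\<lambda>w. 0) \<in> bounded_seminorms X l"
    using assms by (simp add: bounded_seminorms_def cstar_seminorm_def)
  then show ?thesis by blast
qed

lemma univ_seminorm_le:
  assumes "\<And>x. x \<in> X \<Longrightarrow> 0 \<le> l x"
    and "\<And>p. p \<in> bounded_seminorms X l \<Longrightarrow> p w \<le> M"
  shows "univ_seminorm X l w \<le> M"
  unfolding univ_seminorm_eq by (rule cSUP_least) (use assms bounded_seminorms_nonempty in auto)

lemma cstar_seminorm_univ:
  assumes l: "\<And>x. x \<in> X \<Longrightarrow> 0 \<le> l x"
  shows "cstar_seminorm (free_star_alg X) (univ_seminorm X l)"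
  unfolding cstar_seminorm_def
proof (intro conjI ballI allI)
  let ?F = "free_star_alg X"
  let ?P = "bounded_seminorms X l"
  interpret F: star_algebra ?F by (rule star_algebra_free)
  note sn = bounded_seminormsD[of _ X l]
  note le = univ_seminorm_le[OF l] and ge = le_univ_seminorm
  obtain p0 where p0: "p0 \<in> ?P"
    using bounded_seminorms_nonempty[of X l] l by blast
  fix u
  assume u: "u \<in> carrier ?F"
  show nonneg: "0 \<le> univ_seminorm X l u"
    using seminormed_star_algebra.p_nonneg[OF sn[OF p0] u] ge[OF p0 u] by simp
  show "univ_seminorm X l (c \<odot>\<^bsub>?F\<^esub> u) = cmod c * univ_seminorm X l u" for c
  proof -
    have le': "univ_seminorm X l (c \<odot>\<^bsub>?F\<^esub> u) \<le> cmod c * univ_seminorm X l u" if "u \<in> carrier ?F" for c u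
    proof (rule le)
      fix p assume p: "p \<in> ?P"
      show "p (c \<odot>\<^bsub>?F\<^esub> u) \<le> cmod c * univ_seminorm X l u"
        using seminormed_star_algebra.p_scale[OF sn[OF p] that] ge[OF p that] by (simp add: mult_left_mono)
    qed
    show ?thesis
    proof (cases "c = 0")
      case True
      have "0 \<le> univ_seminorm X l \<zero>\<^bsub>?F\<^esub>"
        using seminormed_star_algebra.p_zero[OF sn[OF p0]] ge[OF p0, of "\<zero>\<^bsub>?F\<^esub>"] by simp
      then show ?thesis
        using le'[OF u, of 0] True u by simp
    next
      case False
      have "univ_seminorm X l u \<le> cmod (inverse c) * univ_seminorm X l (c \<odot>\<^bsub>?F\<^esub> u)"
        using le'[of "c \<odot>\<^bsub>?F\<^esub> u" "inverse c"] u False by (simp add: F.scale_scale F.scale_one)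
      then have "cmod c * univ_seminorm X l u \<le> univ_seminorm X l (c \<odot>\<^bsub>?F\<^esub> u)"
        using False by (simp add: norm_inverse norm_divide field_simps)
      with le'[OF u, of c] show ?thesis by simp
    qed
  qed
  show "univ_seminorm X l (star ?F u \<otimes>\<^bsub>?F\<^esub> u) = (univ_seminorm X l u)\<^sup>2"
  proof (rule antisym)
    show "univ_seminorm X l (star ?F u \<otimes>\<^bsub>?F\<^esub> u) \<le> (univ_seminorm X l u)\<^sup>2"
    proof (rule le)
      fix p assume p: "p \<in> ?P"
      show "p (star ?F u \<otimes>\<^bsub>?F\<^esub> u) \<le> (univ_seminorm X l u)\<^sup>2"
        using seminormed_star_algebra.p_star_mult[OF sn[OF p] u] ge[OF p u]
          seminormed_star_algebra.p_nonneg[OF sn[OF p] u] by (simp add: power_mono)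
    qed
    have "univ_seminorm X l u \<le> sqrt (univ_seminorm X l (star ?F u \<otimes>\<^bsub>?F\<^esub> u))"
    proof (rule le)
      fix p assume p: "p \<in> ?P"
      have "(p u)\<^sup>2 \<le> univ_seminorm X l (star ?F u \<otimes>\<^bsub>?F\<^esub> u)"
        using seminormed_star_algebra.p_star_mult[OF sn[OF p] u] ge[OF p, of "star ?F u \<otimes>\<^bsub>?F\<^esub> u"] u by simp
      then show "p u \<le> sqrt (univ_seminorm X l (star ?F u \<otimes>\<^bsub>?F\<^esub> u))"
        by (rule real_le_rsqrt)
    qed
    then show "(univ_seminorm X l u)\<^sup>2 \<le> univ_seminorm X l (star ?F u \<otimes>\<^bsub>?F\<^esub> u)"
      using nonneg by (metis abs_of_nonneg order_trans real_sqrt_le_iff real_sqrt_abs)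
  qed
  fix v
  assume v: "v \<in> carrier ?F"
  show "univ_seminorm X l (u \<oplus>\<^bsub>?F\<^esub> v) \<le> univ_seminorm X l u + univ_seminorm X l v"
  proof (rule le)
    fix p assume p: "p \<in> ?P"
    show "p (u \<oplus>\<^bsub>?F\<^esub> v) \<le> univ_seminorm X l u + univ_seminorm X l v"
      using seminormed_star_algebra.p_add[OF sn[OF p] u v] ge[OF p u] ge[OF p v] by simp
  qed
  show "univ_seminorm X l (u \<otimes>\<^bsub>?F\<^esub> v) \<le> univ_seminorm X l u * univ_seminorm X l v"
  proof (rule le)
    fix p assume p: "p \<in> ?P"
    have "p (u \<otimes>\<^bsub>?F\<^esub> v) \<le> p u * p v"
      by (rule seminormed_star_algebra.p_mult[OF sn[OF p] u v])
    also have "\<dots> \<le> univ_seminorm X l u * univ_seminorm X l v"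
      using seminormed_star_algebra.p_nonneg[OF sn[OF p]] u v nonneg ge[OF p] by (intro mult_mono) auto
    finally show "p (u \<otimes>\<^bsub>?F\<^esub> v) \<le> univ_seminorm X l u * univ_seminorm X l v" .
  qed
qed

lemma seminormed_univ:
  assumes "\<And>x. x \<in> X \<Longrightarrow> 0 \<le> l x"
  shows "seminormed_star_algebra (free_star_alg X) (univ_seminorm X l)"
  by (intro seminormed_star_algebra.intro star_algebra_free seminormed_star_algebra_axioms.intro
      cstar_seminorm_univ assms)

lemma univ_seminorm_gen:
  assumes "\<And>x. x \<in> X \<Longrightarrow> 0 \<le> l x" "x \<in> X"
  shows "univ_seminorm X l (free_gen x) \<le> l x"
  by (rule univ_seminorm_le) (use assms in \<open>auto simp: bounded_seminorms_def\<close>)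

text \<open>
  The norm pulled back along a *-homomorphism is one of the C*-seminorms of which the universal one
  is the supremum.
\<close>

lemma hom_le_univ_seminorm:
  assumes "seminormed_star_algebra B q" "\<phi> \<in> star_homs (free_star_alg X) B"
    and "\<And>x. x \<in> X \<Longrightarrow> q (\<phi> (free_gen x)) \<le> l x" "w \<in> carrier (free_star_alg X)"
  shows "q (\<phi> w) \<le> univ_seminorm X l w"
proof -
  interpret B: seminormed_star_algebra B q by fact
  interpret F: star_algebra "free_star_alg X" by (rule star_algebra_free)
  have "(\<lambda>w. q (\<phi> w)) \<in> bounded_seminorms X l"
    using assms(3) star_homsD[OF assms(2)]
    by (simp add: bounded_seminorms_def cstar_seminorm_def B.p_add B.p_scale B.p_mult B.p_star_mult)
  then show ?thesis
    using assms(4) by (rule le_univ_seminorm)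
qed

section \<open>The universal C*-algebras and their connecting maps\<close>

lemma bounds_nonneg: "\<lbrakk>l \<in> bounds X; x \<in> X\<rbrakk> \<Longrightarrow> 0 \<le> l x"
  by (auto simp: bounds_def)

lemma seminormed_univ_bounds:
  "l \<in> bounds X \<Longrightarrow> seminormed_star_algebra (free_star_alg X) (univ_seminorm X l)"
  by (rule seminormed_univ) (rule bounds_nonneg)

text \<open>The image of a *-polynomial in the universal C*-algebra.\<close>

definition univ_poly :: "'x set \<Rightarrow> ('x \<Rightarrow> real) \<Rightarrow> 'x star_poly \<Rightarrow> 'x univ_elem" where
  "univ_poly X l w = null_rel (free_star_alg X) (univ_seminorm X l) `` {\<lambda>n. w}"

lemma univ_gen_eq: "univ_gen X l x = univ_poly X l (free_gen x)"
  by (simp add: univ_gen_def univ_poly_def)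

lemma cstar_algebra_univ: "l \<in> bounds X \<Longrightarrow> cstar_algebra (univ_cstar X l)"
  unfolding univ_cstar_def
  by (rule seminormed_star_algebra.cstar_algebra_completion[OF seminormed_univ_bounds])

lemma univ_poly_hom:
  "l \<in> bounds X \<Longrightarrow>
    restrict (univ_poly X l) (carrier (free_star_alg X)) \<in> star_homs (free_star_alg X) (univ_cstar X l)"
  unfolding univ_cstar_def univ_poly_def restrict_def
  by (rule seminormed_star_algebra.const_star_hom[OF seminormed_univ_bounds, unfolded restrict_def])

lemma univ_poly_closed:
  "\<lbrakk>l \<in> bounds X; w \<in> carrier (free_star_alg X)\<rbrakk> \<Longrightarrow> univ_poly X l w \<in> carrier (univ_cstar X l)"
  using star_homsD(1)[OF univ_poly_hom] by fastforce

lemma nrm_univ_poly: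
  "\<lbrakk>l \<in> bounds X; w \<in> carrier (free_star_alg X)\<rbrakk>
    \<Longrightarrow> \<parallel>univ_poly X l w\<parallel>\<^bsub>univ_cstar X l\<^esub> = univ_seminorm X l w"
  unfolding univ_cstar_def univ_poly_def
  by (rule seminormed_star_algebra.nrm_const[OF seminormed_univ_bounds])

lemma univ_poly_dense:
  assumes "l \<in> bounds X" "u \<in> carrier (univ_cstar X l)" "0 < e"
  obtains w where "w \<in> carrier (free_star_alg X)"
    "\<parallel>u \<ominus>\<^bsub>univ_cstar X l\<^esub> univ_poly X l w\<parallel>\<^bsub>univ_cstar X l\<^esub> < e"
  using seminormed_star_algebra.const_dense[OF seminormed_univ_bounds[OF assms(1)], of u e] assms(2,3)
  unfolding univ_cstar_def univ_poly_def by blast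

lemma univ_hom_exists:
  assumes l: "l \<in> bounds X" and B: "cstar_algebra B"
    and f: "\<And>x. x \<in> X \<Longrightarrow> f x \<in> carrier B" "\<And>x. x \<in> X \<Longrightarrow> \<parallel>f x\<parallel>\<^bsub>B\<^esub> \<le> l x"
  shows "\<exists>\<psi>\<in>star_homs (univ_cstar X l) B. \<forall>x\<in>X. \<psi> (univ_gen X l x) = f x"
proof -
  interpret B: cstar_algebra B by fact
  interpret assignment B X f by standard (rule f(1))
  let ?v = "restrict (B.poly_val f) (carrier (free_star_alg X))"
  have gen: "?v (free_gen x) = f x" if "x \<in> X" for x
    using that by (simp add: poly_val_gen)
  have "\<parallel>?v w\<parallel>\<^bsub>B\<^esub> \<le> univ_seminorm X l w" if "w \<in> carrier (free_star_alg X)" for w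
    by (rule hom_le_univ_seminorm[OF B.seminormed_star_algebra_axioms poly_val_star_hom _ that])
      (use f gen in simp)
  then obtain \<psi> where \<psi>: "\<psi> \<in> star_homs (univ_cstar X l) B"
    "\<And>w. w \<in> carrier (free_star_alg X) \<Longrightarrow> \<psi> (univ_poly X l w) = ?v w"
    using seminormed_star_algebra.completion_extension[OF seminormed_univ_bounds[OF l] B poly_val_star_hom]
    unfolding univ_cstar_def univ_poly_def by blast
  have "\<psi> (univ_gen X l x) = f x" if "x \<in> X" for x
    using gen[OF that] \<psi>(2)[of "free_gen x"] that by (simp add: univ_gen_eq)
  with \<psi>(1) show ?thesis by blast
qed

lemma univ_hom_poly_eq:
  assumes l: "l \<in> bounds X" and B: "star_algebra B"
    and "\<phi> \<in> star_homs (univ_cstar X l) B" "\<psi> \<in> star_homs (free_star_alg X) B"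
    and eq: "\<And>x. x \<in> X \<Longrightarrow> \<phi> (univ_gen X l x) = \<psi> (free_gen x)"
    and w: "w \<in> carrier (free_star_alg X)"
  shows "\<phi> (univ_poly X l w) = \<psi> w"
proof -
  have "compose (carrier (free_star_alg X)) \<phi> (restrict (univ_poly X l) (carrier (free_star_alg X))) = \<psi>"
    by (rule free_hom_unique[OF star_homs_compose[OF star_algebra_free univ_poly_hom[OF l] assms(3)] assms(4) B])
      (use eq in \<open>simp add: compose_def univ_gen_eq\<close>)
  from fun_cong[OF this, of w] w show ?thesis
    by (simp add: compose_def)
qed

lemma univ_hom_unique:
  assumes l: "l \<in> bounds X" and B: "cstar_algebra B"
    and \<phi>: "\<phi> \<in> star_homs (univ_cstar X l) B" and \<psi>: "\<psi> \<in> star_homs (univ_cstar X l) B"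
    and eq: "\<And>x. x \<in> X \<Longrightarrow> \<phi> (univ_gen X l x) = \<psi> (univ_gen X l x)"
  shows "\<phi> = \<psi>"
proof -
  interpret B: cstar_algebra B by fact
  let ?\<psi> = "compose (carrier (free_star_alg X)) \<psi> (restrict (univ_poly X l) (carrier (free_star_alg X)))"
  have "?\<psi> \<in> star_homs (free_star_alg X) B"
    by (rule star_homs_compose[OF star_algebra_free univ_poly_hom[OF l] \<psi>])
  then have poly: "\<phi> (univ_poly X l w) = \<psi> (univ_poly X l w)" if w: "w \<in> carrier (free_star_alg X)" for w
    using univ_hom_poly_eq[OF l B.star_algebra_axioms \<phi> _ _ w, of ?\<psi>] eq w
    by (simp add: compose_def univ_gen_eq)
  show ?thesis
    by (rule seminormed_star_algebra.completion_hom_unique[OF seminormed_univ_bounds[OF l] B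
          \<phi>[unfolded univ_cstar_def] \<psi>[unfolded univ_cstar_def]])
      (use poly in \<open>simp add: univ_poly_def\<close>)
qed

text \<open>
  The connecting map, defined by a unique description, is the *-homomorphism that it is meant to be.
\<close>

lemma
  assumes l: "l \<in> bounds X" and l': "l' \<in> bounds X" and le: "\<And>x. x \<in> X \<Longrightarrow> l x \<le> l' x"
  shows univ_conn_hom: "univ_conn X l' l \<in> star_homs (univ_cstar X l') (univ_cstar X l)"
    and univ_conn_gen: "x \<in> X \<Longrightarrow> univ_conn X l' l (univ_gen X l' x) = univ_gen X l x"
proof -
  let ?C = "\<lambda>\<pi>. \<pi> \<in> star_homs (univ_cstar X l') (univ_cstar X l) \<and>
    (\<forall>x\<in>X. \<pi> (univ_gen X l' x) = univ_gen X l x)"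
  have closed: "univ_gen X l x \<in> carrier (univ_cstar X l)" if "x \<in> X" for x
    using univ_poly_closed[OF l] that by (simp add: univ_gen_eq)
  have le': "\<parallel>univ_gen X l x\<parallel>\<^bsub>univ_cstar X l\<^esub> \<le> l' x" if "x \<in> X" for x
    using univ_seminorm_gen[of X l x] bounds_nonneg[OF l] le[OF that] that
    by (simp add: univ_gen_eq nrm_univ_poly l)
  obtain \<pi> where \<pi>: "?C \<pi>"
    using univ_hom_exists[OF l' cstar_algebra_univ[OF l], where f = "univ_gen X l", OF closed le'] by blast
  moreover have "\<pi>' = \<pi>" if "?C \<pi>'" for \<pi>'
    by (rule univ_hom_unique[OF l' cstar_algebra_univ[OF l]]) (use that \<pi> in auto)
  ultimately have "?C (univ_conn X l' l)"
    unfolding univ_conn_def by (rule theI)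
  then show "univ_conn X l' l \<in> star_homs (univ_cstar X l') (univ_cstar X l)"
    and "x \<in> X \<Longrightarrow> univ_conn X l' l (univ_gen X l' x) = univ_gen X l x"
    by auto
qed

lemma univ_conn_poly:
  assumes l: "l \<in> bounds X" and l': "l' \<in> bounds X" and le: "\<And>x. x \<in> X \<Longrightarrow> l x \<le> l' x"
    and w: "w \<in> carrier (free_star_alg X)"
  shows "univ_conn X l' l (univ_poly X l' w) = univ_poly X l w"
proof -
  interpret U: cstar_algebra "univ_cstar X l"
    using l by (rule cstar_algebra_univ)
  have "univ_conn X l' l (univ_poly X l' w) = restrict (univ_poly X l) (carrier (free_star_alg X)) w"
    by (rule univ_hom_poly_eq[OF l' U.star_algebra_axioms univ_conn_hom[OF l l' le] univ_poly_hom[OF l] _ w])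
      (use univ_conn_gen[OF l l' le] in \<open>simp_all add: univ_gen_eq\<close>)
  then show ?thesis
    using w by simp
qed

section \<open>Norm topologies\<close>

lemma openin_norm_topology:
  assumes "cstar_algebra A"
  shows "openin (norm_topology A) V \<longleftrightarrow> V \<subseteq> carrier A \<and>
    (\<forall>x\<in>V. \<exists>r>0. \<forall>y\<in>carrier A. \<parallel>x \<ominus>\<^bsub>A\<^esub> y\<parallel>\<^bsub>A\<^esub> < r \<longrightarrow> y \<in> V)"
proof -
  interpret A: cstar_algebra A by fact
  interpret M: Metric_space "carrier A" "cstar_dist A"
    by (rule Metric_space_cstar_dist[OF A.normed_star_algebra_axioms])
  have ball: "M.mball x r \<subseteq> V \<longleftrightarrow> (\<forall>y\<in>carrier A. \<parallel>x \<ominus>\<^bsub>A\<^esub> y\<parallel>\<^bsub>A\<^esub> < r \<longrightarrow> y \<in> V)" if "x \<in> carrier A" for x r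
    using that by (auto simp: subset_iff cstar_dist_def)
  show ?thesis
    unfolding norm_topology_def M.openin_mtopology
  proof (intro conj_cong refl)
    assume "V \<subseteq> carrier A"
    from ball[OF subsetD[OF this]]
    show "(\<forall>x. x \<in> V \<longrightarrow> (\<exists>r>0. M.mball x r \<subseteq> V)) \<longleftrightarrow>
        (\<forall>x\<in>V. \<exists>r>0. \<forall>y\<in>carrier A. \<parallel>x \<ominus>\<^bsub>A\<^esub> y\<parallel>\<^bsub>A\<^esub> < r \<longrightarrow> y \<in> V)"
      by (simp add: Ball_def)
  qed
qed

lemma topspace_norm_topology:
  assumes "cstar_algebra A"
  shows "topspace (norm_topology A) = carrier A"
proof -
  interpret A: cstar_algebra A by fact
  interpret M: Metric_space "carrier A" "cstar_dist A"
    by (rule Metric_space_cstar_dist[OF A.normed_star_algebra_axioms])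
  show ?thesis
    by (simp add: norm_topology_def)
qed

lemma openin_norm_ball:
  assumes "cstar_algebra A" "x \<in> carrier A"
  shows "openin (norm_topology A) {y \<in> carrier A. \<parallel>x \<ominus>\<^bsub>A\<^esub> y\<parallel>\<^bsub>A\<^esub> < r}"
  unfolding openin_norm_topology[OF assms(1)]
proof (intro conjI ballI)
  interpret A: cstar_algebra A by fact
  fix y
  assume "y \<in> {y \<in> carrier A. \<parallel>x \<ominus>\<^bsub>A\<^esub> y\<parallel>\<^bsub>A\<^esub> < r}"
  then have y: "y \<in> carrier A" "\<parallel>x \<ominus>\<^bsub>A\<^esub> y\<parallel>\<^bsub>A\<^esub> < r" by auto
  have "\<parallel>x \<ominus>\<^bsub>A\<^esub> z\<parallel>\<^bsub>A\<^esub> < r" if "z \<in> carrier A" "\<parallel>y \<ominus>\<^bsub>A\<^esub> z\<parallel>\<^bsub>A\<^esub> < r - \<parallel>x \<ominus>\<^bsub>A\<^esub> y\<parallel>\<^bsub>A\<^esub>" for z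
    using A.p_triangle[OF assms(2) y(1) that(1)] that(2) by linarith
  with y show "\<exists>e>0. \<forall>z\<in>carrier A. \<parallel>y \<ominus>\<^bsub>A\<^esub> z\<parallel>\<^bsub>A\<^esub> < e \<longrightarrow> z \<in> {y \<in> carrier A. \<parallel>x \<ominus>\<^bsub>A\<^esub> y\<parallel>\<^bsub>A\<^esub> < r}"
    by (intro exI[of _ "r - \<parallel>x \<ominus>\<^bsub>A\<^esub> y\<parallel>\<^bsub>A\<^esub>"]) auto
qed auto

lemma star_hom_contractive_minus:
  assumes "cstar_algebra A" "cstar_algebra B" "\<phi> \<in> star_homs A B" "x \<in> carrier A" "y \<in> carrier A"
  shows "\<parallel>\<phi> x \<ominus>\<^bsub>B\<^esub> \<phi> y\<parallel>\<^bsub>B\<^esub> \<le> \<parallel>x \<ominus>\<^bsub>A\<^esub> y\<parallel>\<^bsub>A\<^esub>"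
proof -
  interpret A: cstar_algebra A by fact
  interpret B: cstar_algebra B by fact
  have "\<parallel>\<phi> (x \<ominus>\<^bsub>A\<^esub> y)\<parallel>\<^bsub>B\<^esub> \<le> \<parallel>x \<ominus>\<^bsub>A\<^esub> y\<parallel>\<^bsub>A\<^esub>"
    by (rule star_hom_contractive[OF assms(1) B.seminormed_star_algebra_axioms assms(3)])
      (use assms in simp)
  then show ?thesis
    using star_hom_minus[OF A.star_algebra_axioms assms(3-5)] by simp
qed

lemma star_hom_continuous:
  assumes "cstar_algebra A" "cstar_algebra B" "\<phi> \<in> star_homs A B"
  shows "continuous_map (norm_topology A) (norm_topology B) \<phi>"
  unfolding continuous_map_def topspace_norm_topology[OF assms(1)] topspace_norm_topology[OF assms(2)]
proof (intro conjI allI impI)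
  fix V
  assume V: "openin (norm_topology B) V"
  show "openin (norm_topology A) {x \<in> carrier A. \<phi> x \<in> V}"
    unfolding openin_norm_topology[OF assms(1)]
  proof (intro conjI ballI)
    fix x
    assume "x \<in> {x \<in> carrier A. \<phi> x \<in> V}"
    then have x: "x \<in> carrier A" "\<phi> x \<in> V" by auto
    then obtain r where r: "r > 0" "\<And>y. \<lbrakk>y \<in> carrier B; \<parallel>\<phi> x \<ominus>\<^bsub>B\<^esub> y\<parallel>\<^bsub>B\<^esub> < r\<rbrakk> \<Longrightarrow> y \<in> V"
      using V unfolding openin_norm_topology[OF assms(2)] by blast
    have "\<phi> y \<in> V" if "y \<in> carrier A" "\<parallel>x \<ominus>\<^bsub>A\<^esub> y\<parallel>\<^bsub>A\<^esub> < r" for y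
      using star_hom_contractive_minus[OF assms x(1) that(1)] that star_homsD(1)[OF assms(3)]
      by (intro r(2)) auto
    with r(1) show "\<exists>r>0. \<forall>y\<in>carrier A. \<parallel>x \<ominus>\<^bsub>A\<^esub> y\<parallel>\<^bsub>A\<^esub> < r \<longrightarrow> y \<in> {x \<in> carrier A. \<phi> x \<in> V}"
      by auto
  qed auto
qed (use star_homsD(1)[OF assms(3)] in auto)

section \<open>The free pro-C*-algebra\<close>

lemma free_pro_simps:
  "carrier (free_pro_cstar X) = free_pro_carrier X"
  "u \<oplus>\<^bsub>free_pro_cstar X\<^esub> v = (\<lambda>l\<in>bounds X. u l \<oplus>\<^bsub>univ_cstar X l\<^esub> v l)"
  "u \<otimes>\<^bsub>free_pro_cstar X\<^esub> v = (\<lambda>l\<in>bounds X. u l \<otimes>\<^bsub>univ_cstar X l\<^esub> v l)"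
  "c \<odot>\<^bsub>free_pro_cstar X\<^esub> u = (\<lambda>l\<in>bounds X. c \<odot>\<^bsub>univ_cstar X l\<^esub> u l)"
  "star (free_pro_cstar X) u = (\<lambda>l\<in>bounds X. star (univ_cstar X l) (u l))"
  by (simp_all add: free_pro_cstar_def)

lemma free_pro_carrierD:
  assumes "u \<in> free_pro_carrier X"
  shows "l \<in> bounds X \<Longrightarrow> u l \<in> carrier (univ_cstar X l)"
    and "\<lbrakk>l \<in> bounds X; l' \<in> bounds X; \<And>x. x \<in> X \<Longrightarrow> l x \<le> l' x\<rbrakk> \<Longrightarrow> univ_conn X l' l (u l') = u l"
  using assms by (auto simp: free_pro_carrier_def)

lemma free_pro_carrierI:
  assumes "\<And>l. l \<in> bounds X \<Longrightarrow> h l \<in> carrier (univ_cstar X l)"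
    and "\<And>l l'. \<lbrakk>l \<in> bounds X; l' \<in> bounds X; \<And>x. x \<in> X \<Longrightarrow> l x \<le> l' x\<rbrakk> \<Longrightarrow> univ_conn X l' l (h l') = h l"
  shows "(\<lambda>l\<in>bounds X. h l) \<in> free_pro_carrier X"
  using assms by (auto simp: free_pro_carrier_def)

lemma free_pro_closed:
  assumes u: "u \<in> free_pro_carrier X"
  shows "v \<in> free_pro_carrier X \<Longrightarrow> u \<oplus>\<^bsub>free_pro_cstar X\<^esub> v \<in> free_pro_carrier X"
    and "v \<in> free_pro_carrier X \<Longrightarrow> u \<otimes>\<^bsub>free_pro_cstar X\<^esub> v \<in> free_pro_carrier X"
    and "c \<odot>\<^bsub>free_pro_cstar X\<^esub> u \<in> free_pro_carrier X"
    and "star (free_pro_cstar X) u \<in> free_pro_carrier X"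
proof -
  have sa: "star_algebra (univ_cstar X l)" if "l \<in> bounds X" for l
    using cstar_algebra_univ[OF that] by (simp add: cstar_algebra_def)
  note closed = star_algebra.closed[OF sa]
  note hom = star_homsD[OF univ_conn_hom]
  show "c \<odot>\<^bsub>free_pro_cstar X\<^esub> u \<in> free_pro_carrier X"
    unfolding free_pro_simps
    by (rule free_pro_carrierI) (simp_all add: closed hom free_pro_carrierD[OF u])
  show "star (free_pro_cstar X) u \<in> free_pro_carrier X"
    unfolding free_pro_simps
    by (rule free_pro_carrierI) (simp_all add: closed hom free_pro_carrierD[OF u])
  assume v: "v \<in> free_pro_carrier X"
  show "u \<oplus>\<^bsub>free_pro_cstar X\<^esub> v \<in> free_pro_carrier X"
    unfolding free_pro_simps
    by (rule free_pro_carrierI) (simp_all add: closed hom free_pro_carrierD[OF u] free_pro_carrierD[OF v])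
  show "u \<otimes>\<^bsub>free_pro_cstar X\<^esub> v \<in> free_pro_carrier X"
    unfolding free_pro_simps
    by (rule free_pro_carrierI) (simp_all add: closed hom free_pro_carrierD[OF u] free_pro_carrierD[OF v])
qed

text \<open>The image of a *-polynomial in the free pro-C*-algebra.\<close>

definition pro_poly :: "'x set \<Rightarrow> 'x star_poly \<Rightarrow> 'x pro_elem" where
  "pro_poly X w = (\<lambda>l\<in>bounds X. univ_poly X l w)"

lemma free_pro_gen_eq: "free_pro_gen X x = pro_poly X (free_gen x)"
  by (simp add: free_pro_gen_def pro_poly_def univ_gen_eq)

lemma pro_poly_closed: "w \<in> carrier (free_star_alg X) \<Longrightarrow> pro_poly X w \<in> free_pro_carrier X"
  unfolding pro_poly_def by (rule free_pro_carrierI) (simp_all add: univ_poly_closed univ_conn_poly)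

lemma pro_poly_hom:
  "restrict (pro_poly X) (carrier (free_star_alg X)) \<in> star_homs (free_star_alg X) (free_pro_cstar X)"
proof -
  interpret F: star_algebra "free_star_alg X" by (rule star_algebra_free)
  note hom = star_homsD(2-5)[OF univ_poly_hom]
  have add: "univ_poly X l (p \<oplus>\<^bsub>free_star_alg X\<^esub> q) = univ_poly X l p \<oplus>\<^bsub>univ_cstar X l\<^esub> univ_poly X l q"
    if "l \<in> bounds X" "p \<in> carrier (free_star_alg X)" "q \<in> carrier (free_star_alg X)" for l p q
    using hom(1)[OF that] that by simp
  have scale: "univ_poly X l (c \<odot>\<^bsub>free_star_alg X\<^esub> p) = c \<odot>\<^bsub>univ_cstar X l\<^esub> univ_poly X l p"
    if "l \<in> bounds X" "p \<in> carrier (free_star_alg X)" for l p c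
    using hom(2)[OF that] that by simp
  have mult: "univ_poly X l (p \<otimes>\<^bsub>free_star_alg X\<^esub> q) = univ_poly X l p \<otimes>\<^bsub>univ_cstar X l\<^esub> univ_poly X l q"
    if "l \<in> bounds X" "p \<in> carrier (free_star_alg X)" "q \<in> carrier (free_star_alg X)" for l p q
    using hom(3)[OF that] that by simp
  have star: "univ_poly X l (star (free_star_alg X) p) = star (univ_cstar X l) (univ_poly X l p)"
    if "l \<in> bounds X" "p \<in> carrier (free_star_alg X)" for l p
    using hom(4)[OF that] that by simp
  show ?thesis
  proof (rule star_homsI)
    fix p
    assume "p \<in> carrier (free_star_alg X)"
    then show "restrict (pro_poly X) (carrier (free_star_alg X)) p \<in> carrier (free_pro_cstar X)"
      by (simp add: free_pro_simps pro_poly_closed)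
  qed (auto simp: free_pro_simps pro_poly_def add scale mult star intro!: restrict_ext)
qed

text \<open>The *-polynomials are dense in the free pro-C*-algebra.\<close>

lemma pro_poly_dense:
  assumes V: "openin (topol (free_pro_cstar X)) V" and u: "u \<in> V"
  obtains w where "w \<in> carrier (free_star_alg X)" "pro_poly X w \<in> V"
proof -
  obtain W where W: "openin (product_topology (\<lambda>l. norm_topology (univ_cstar X l)) (bounds X)) W"
    and VW: "V = W \<inter> free_pro_carrier X"
    using V by (auto simp: free_pro_cstar_def openin_subtopology)
  have uc: "u \<in> free_pro_carrier X" and uW: "u \<in> W"
    using u VW by simp_all
  note uD = free_pro_carrierD[OF uc]
  obtain T where T: "finite {l \<in> bounds X. T l \<noteq> topspace (norm_topology (univ_cstar X l))}"
    "\<forall>l\<in>bounds X. openin (norm_topology (univ_cstar X l)) (T l)"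
    "u \<in> Pi\<^sub>E (bounds X) T" "Pi\<^sub>E (bounds X) T \<subseteq> W"
    using bspec[OF W[unfolded openin_product_topology_alt] uW] by (elim exE conjE) (rule that)
  define L where "L = {l \<in> bounds X. T l \<noteq> carrier (univ_cstar X l)}"
  have L: "finite L" "L \<subseteq> bounds X"
  proof -
    have "L = {l \<in> bounds X. T l \<noteq> topspace (norm_topology (univ_cstar X l))}"
      unfolding L_def using topspace_norm_topology[OF cstar_algebra_univ] by auto
    with T(1) show "finite L" by simp
  qed (simp add: L_def)
  have "\<exists>r>0. \<forall>y\<in>carrier (univ_cstar X l). \<parallel>u l \<ominus>\<^bsub>univ_cstar X l\<^esub> y\<parallel>\<^bsub>univ_cstar X l\<^esub> < r \<longrightarrow> y \<in> T l"
    if "l \<in> L" for l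
  proof -
    have l: "l \<in> bounds X" using that L by blast
    then have "u l \<in> T l" using T(3) by auto
    then show ?thesis
      using bspec[OF T(2) l] openin_norm_topology[OF cstar_algebra_univ[OF l]] by blast
  qed
  then obtain r where r: "\<And>l. l \<in> L \<Longrightarrow> 0 < r l"
    "\<And>l y. \<lbrakk>l \<in> L; y \<in> carrier (univ_cstar X l); \<parallel>u l \<ominus>\<^bsub>univ_cstar X l\<^esub> y\<parallel>\<^bsub>univ_cstar X l\<^esub> < r l\<rbrakk> \<Longrightarrow> y \<in> T l"
    by metis
  define e where "e = Min (insert 1 (r ` L))"
  have e: "0 < e" "\<And>l. l \<in> L \<Longrightarrow> e \<le> r l"
    using L(1) r(1) by (auto simp: e_def)
  \<comment> \<open>The indices are directed: the sum of finitely many bounds is an upper bound for them.\<close>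
  define m where "m = (\<lambda>x\<in>X. \<Sum>l\<in>L. l x)"
  have m: "m \<in> bounds X" "\<And>l x. l \<in> L \<Longrightarrow> x \<in> X \<Longrightarrow> l x \<le> m x"
  proof -
    have nonneg: "0 \<le> l x" if "l \<in> L" "x \<in> X" for l x
      using bounds_nonneg[OF subsetD[OF L(2) that(1)] that(2)] .
    then show "m \<in> bounds X"
      by (auto simp: m_def bounds_def intro!: sum_nonneg)
    show "l x \<le> m x" if "l \<in> L" "x \<in> X" for l x
      using that L(1) nonneg by (auto simp: m_def intro!: member_le_sum)
  qed
  obtain w where w: "w \<in> carrier (free_star_alg X)"
    "\<parallel>u m \<ominus>\<^bsub>univ_cstar X m\<^esub> univ_poly X m w\<parallel>\<^bsub>univ_cstar X m\<^esub> < e"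
    using univ_poly_dense[OF m(1) uD(1)[OF m(1)] e(1)] .
  have "univ_poly X l w \<in> T l" if l: "l \<in> bounds X" for l
  proof (cases "l \<in> L")
    case True
    have "\<parallel>univ_conn X m l (u m) \<ominus>\<^bsub>univ_cstar X l\<^esub> univ_conn X m l (univ_poly X m w)\<parallel>\<^bsub>univ_cstar X l\<^esub>
        \<le> \<parallel>u m \<ominus>\<^bsub>univ_cstar X m\<^esub> univ_poly X m w\<parallel>\<^bsub>univ_cstar X m\<^esub>"
      by (rule star_hom_contractive_minus[OF cstar_algebra_univ[OF m(1)] cstar_algebra_univ[OF l]
            univ_conn_hom[OF l m(1)]])
        (use True m w uD univ_poly_closed in auto)
    moreover have "univ_conn X m l (u m) = u l"
      using uD(2)[OF l m(1)] m(2) True by simp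
    moreover have "univ_conn X m l (univ_poly X m w) = univ_poly X l w"
      using univ_conn_poly[OF l m(1) _ w(1)] m(2) True by simp
    ultimately show ?thesis
      using w e(2)[OF True] univ_poly_closed[OF l w(1)] by (intro r(2)[OF True]) auto
  next
    case False
    then have "T l = carrier (univ_cstar X l)"
      using l by (simp add: L_def)
    with univ_poly_closed[OF l w(1)] show ?thesis by simp
  qed
  then have "pro_poly X w \<in> W"
    using T(4) by (auto simp: pro_poly_def)
  with w(1) pro_poly_closed[OF w(1)] VW that show thesis by simp
qed

lemma topspace_free_pro: "topspace (topol (free_pro_cstar X)) = free_pro_carrier X"
proof -
  have "topspace (product_topology (\<lambda>l. norm_topology (univ_cstar X l)) (bounds X)) =
      (\<Pi>\<^sub>E l\<in>bounds X. carrier (univ_cstar X l))"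
    by (auto simp: PiE_iff topspace_norm_topology[OF cstar_algebra_univ])
  then show ?thesis
    by (auto simp: free_pro_cstar_def free_pro_carrier_def)
qed

lemma as_pro_cstar_simps:
  "star_homs P (as_pro_cstar A) = star_homs P A" "topol (as_pro_cstar A) = norm_topology A"
  by (simp_all add: star_homs_def as_pro_cstar_def)

text \<open>
  Evaluation at \<open>f\<close> factors through the component with the bounds \<open>l(x) = \<parallel>f(x)\<parallel>\<close>.
\<close>

lemma pro_hom_exists:
  assumes A: "cstar_algebra A" and f: "f \<in> X \<rightarrow> carrier A"
  shows "\<exists>\<phi>\<in>cont_star_homs (free_pro_cstar X) (as_pro_cstar A). \<forall>x\<in>X. \<phi> (free_pro_gen X x) = f x"
proof -
  interpret A: cstar_algebra A by fact
  define l where "l = (\<lambda>x\<in>X. \<parallel>f x\<parallel>\<^bsub>A\<^esub>)"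
  have l: "l \<in> bounds X"
    using f by (auto simp: l_def bounds_def Pi_iff)
  obtain \<psi> where \<psi>: "\<psi> \<in> star_homs (univ_cstar X l) A" "\<And>x. x \<in> X \<Longrightarrow> \<psi> (univ_gen X l x) = f x"
    using univ_hom_exists[OF l A, where f = f, OF funcset_mem[OF f]] by (auto simp: l_def)
  define \<phi> where "\<phi> = (\<lambda>u\<in>free_pro_carrier X. \<psi> (u l))"
  have "\<phi> \<in> star_homs (free_pro_cstar X) A"
  proof (rule star_homsI)
    fix u v and c :: complex
    assume "u \<in> carrier (free_pro_cstar X)"
    then have u: "u \<in> free_pro_carrier X" by (simp add: free_pro_simps)
    note hom = star_homsD[OF \<psi>(1)] and ul = free_pro_carrierD(1)[OF u l]
    show "\<phi> u \<in> carrier A"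
      using u ul hom by (simp add: \<phi>_def)
    show "\<phi> (c \<odot>\<^bsub>free_pro_cstar X\<^esub> u) = c \<odot>\<^bsub>A\<^esub> \<phi> u"
      using u ul hom free_pro_closed(3)[OF u, of c] l by (simp add: \<phi>_def) (simp add: free_pro_simps)
    show "\<phi> (star (free_pro_cstar X) u) = star A (\<phi> u)"
      using u ul hom free_pro_closed(4)[OF u] l by (simp add: \<phi>_def) (simp add: free_pro_simps)
    assume "v \<in> carrier (free_pro_cstar X)"
    then have v: "v \<in> free_pro_carrier X" by (simp add: free_pro_simps)
    note vl = free_pro_carrierD(1)[OF v l]
    show "\<phi> (u \<oplus>\<^bsub>free_pro_cstar X\<^esub> v) = \<phi> u \<oplus>\<^bsub>A\<^esub> \<phi> v"
      using u v ul vl hom free_pro_closed(1)[OF u v] l by (simp add: \<phi>_def) (simp add: free_pro_simps)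
    show "\<phi> (u \<otimes>\<^bsub>free_pro_cstar X\<^esub> v) = \<phi> u \<otimes>\<^bsub>A\<^esub> \<phi> v"
      using u v ul vl hom free_pro_closed(2)[OF u v] l by (simp add: \<phi>_def) (simp add: free_pro_simps)
  qed (simp add: \<phi>_def free_pro_simps)
  moreover have "continuous_map (topol (free_pro_cstar X)) (norm_topology A) \<phi>"
  proof (rule continuous_map_eq)
    have "continuous_map (topol (free_pro_cstar X)) (norm_topology (univ_cstar X l)) (\<lambda>u. u l)"
      unfolding free_pro_cstar_def top_star_alg.simps
      by (rule continuous_map_from_subtopology, rule continuous_map_product_projection[OF l])
    from continuous_map_compose[OF this star_hom_continuous[OF cstar_algebra_univ[OF l] A \<psi>(1)]]
    show "continuous_map (topol (free_pro_cstar X)) (norm_topology A) (\<psi> \<circ> (\<lambda>u. u l))" .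
  qed (simp add: topspace_free_pro \<phi>_def)
  moreover have "\<phi> (free_pro_gen X x) = f x" if "x \<in> X" for x
    using that l \<psi>(2) pro_poly_closed[of "free_gen x" X]
    by (simp add: \<phi>_def free_pro_gen_eq) (simp add: pro_poly_def univ_gen_eq)
  ultimately show ?thesis
    unfolding cont_star_homs_def as_pro_cstar_simps by blast
qed

lemma pro_hom_unique:
  assumes A: "cstar_algebra A"
    and \<phi>: "\<phi> \<in> cont_star_homs (free_pro_cstar X) (as_pro_cstar A)"
    and \<psi>: "\<psi> \<in> cont_star_homs (free_pro_cstar X) (as_pro_cstar A)"
    and eq: "\<And>x. x \<in> X \<Longrightarrow> \<phi> (free_pro_gen X x) = \<psi> (free_pro_gen X x)"
  shows "\<phi> = \<psi>"
proof -
  interpret A: cstar_algebra A by fact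
  let ?F = "free_star_alg X" and ?P = "free_pro_cstar X"
  have \<phi>': "\<phi> \<in> star_homs ?P A" "continuous_map (topol ?P) (norm_topology A) \<phi>"
    and \<psi>': "\<psi> \<in> star_homs ?P A" "continuous_map (topol ?P) (norm_topology A) \<psi>"
    using \<phi> \<psi> by (simp_all add: cont_star_homs_def as_pro_cstar_simps)
  let ?h = "restrict (pro_poly X) (carrier ?F)"
  have "compose (carrier ?F) \<phi> ?h = compose (carrier ?F) \<psi> ?h"
    by (rule free_hom_unique[OF star_homs_compose[OF star_algebra_free pro_poly_hom \<phi>'(1)]
          star_homs_compose[OF star_algebra_free pro_poly_hom \<psi>'(1)] A.star_algebra_axioms])
      (use eq in \<open>simp add: compose_def free_pro_gen_eq\<close>)
  then have poly: "\<phi> (pro_poly X w) = \<psi> (pro_poly X w)" if "w \<in> carrier ?F" for w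
    using that by (auto simp: compose_def fun_eq_iff restrict_def split: if_splits)
  show ?thesis
  proof (rule star_homs_eqI[OF \<phi>'(1) \<psi>'(1)])
    fix u
    assume u: "u \<in> carrier ?P"
    have c: "\<phi> v \<in> carrier A" "\<psi> v \<in> carrier A" if "v \<in> carrier ?P" for v
      using that star_homsD(1)[OF \<phi>'(1)] star_homsD(1)[OF \<psi>'(1)] by auto
    have "\<parallel>\<phi> u \<ominus>\<^bsub>A\<^esub> \<psi> u\<parallel>\<^bsub>A\<^esub> \<le> e" if "0 < e" for e
    proof -
      let ?B = "\<lambda>\<eta>. {v \<in> carrier ?P. \<parallel>\<eta> u \<ominus>\<^bsub>A\<^esub> \<eta> v\<parallel>\<^bsub>A\<^esub> < e / 2}"
      have B: "openin (topol ?P) (?B \<eta>)" "u \<in> ?B \<eta>"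
        if cont: "continuous_map (topol ?P) (norm_topology A) \<eta>"
          and \<eta>: "\<And>v. v \<in> carrier ?P \<Longrightarrow> \<eta> v \<in> carrier A" for \<eta>
      proof -
        have eq: "?B \<eta> = {v \<in> topspace (topol ?P). \<eta> v \<in> {y \<in> carrier A. \<parallel>\<eta> u \<ominus>\<^bsub>A\<^esub> y\<parallel>\<^bsub>A\<^esub> < e / 2}}"
          using \<eta> by (auto simp: topspace_free_pro free_pro_simps)
        show "openin (topol ?P) (?B \<eta>)"
          unfolding eq by (rule openin_continuous_map_preimage[OF cont openin_norm_ball[OF A \<eta>[OF u]]])
        show "u \<in> ?B \<eta>"
          using u \<eta>[OF u] \<open>0 < e\<close> by simp
      qed
      have "openin (topol ?P) (?B \<phi> \<inter> ?B \<psi>)" "u \<in> ?B \<phi> \<inter> ?B \<psi>"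
        using B[OF \<phi>'(2) c(1)] B[OF \<psi>'(2) c(2)] by (blast intro: openin_Int)+
      then obtain w where w: "w \<in> carrier ?F" "pro_poly X w \<in> ?B \<phi> \<inter> ?B \<psi>"
        by (rule pro_poly_dense)
      let ?v = "pro_poly X w"
      have v: "?v \<in> carrier ?P" using w by auto
      have "\<parallel>\<phi> u \<ominus>\<^bsub>A\<^esub> \<psi> u\<parallel>\<^bsub>A\<^esub> \<le> \<parallel>\<phi> u \<ominus>\<^bsub>A\<^esub> \<phi> ?v\<parallel>\<^bsub>A\<^esub> + \<parallel>\<phi> ?v \<ominus>\<^bsub>A\<^esub> \<psi> u\<parallel>\<^bsub>A\<^esub>"
        using c u v by (simp add: A.p_triangle)
      also have "\<parallel>\<phi> ?v \<ominus>\<^bsub>A\<^esub> \<psi> u\<parallel>\<^bsub>A\<^esub> = \<parallel>\<psi> u \<ominus>\<^bsub>A\<^esub> \<psi> ?v\<parallel>\<^bsub>A\<^esub>"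
        using c u v poly[OF w(1)] A.p_minus_commute[of "\<psi> ?v" "\<psi> u"] by simp
      finally show ?thesis using w(2) by simp
    qed
    then have "\<parallel>\<phi> u \<ominus>\<^bsub>A\<^esub> \<psi> u\<parallel>\<^bsub>A\<^esub> \<le> 0"
      by (metis dense_ge)
    then have "\<parallel>\<phi> u \<ominus>\<^bsub>A\<^esub> \<psi> u\<parallel>\<^bsub>A\<^esub> = 0"
      using c[OF u] by (simp add: order_antisym)
    then show "\<phi> u = \<psi> u"
      using c[OF u] by (simp add: A.p_minus_eq_zero_iff)
  qed
qed

lemma pro_eval_eq:
  assumes A: "cstar_algebra A"
    and \<phi>: "\<phi> \<in> cont_star_homs (free_pro_cstar (x ` {1..n})) (as_pro_cstar A)"
    and a: "\<And>j. j \<in> {1..n} \<Longrightarrow> \<phi> (free_pro_gen (x ` {1..n}) (x j)) = a j"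
  shows "pro_eval n x (as_pro_cstar A) a = \<phi>"
  unfolding pro_eval_def
proof (rule the_equality)
  fix \<psi>
  assume \<psi>: "\<psi> \<in> cont_star_homs (free_pro_cstar (x ` {1..n})) (as_pro_cstar A) \<and>
    (\<forall>j\<in>{1..n}. \<psi> (free_pro_gen (x ` {1..n}) (x j)) = a j)"
  show "\<psi> = \<phi>"
    by (rule pro_hom_unique[OF A]) (use \<psi> \<phi> a in auto)
qed (use \<phi> a in auto)

lemma
  assumes A: "cstar_algebra A" and f: "f \<in> x ` {1..n} \<rightarrow> carrier A"
  shows pro_eval_hom: "pro_eval n x (as_pro_cstar A) (\<lambda>j. f (x j)) \<in>
      cont_star_homs (free_pro_cstar (x ` {1..n})) (as_pro_cstar A)"
    and pro_eval_gen: "j \<in> {1..n} \<Longrightarrow>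
      pro_eval n x (as_pro_cstar A) (\<lambda>j. f (x j)) (free_pro_gen (x ` {1..n}) (x j)) = f (x j)"
proof -
  obtain \<phi> where \<phi>: "\<phi> \<in> cont_star_homs (free_pro_cstar (x ` {1..n})) (as_pro_cstar A)"
    "\<forall>y\<in>x ` {1..n}. \<phi> (free_pro_gen (x ` {1..n}) y) = f y"
    using pro_hom_exists[OF A f] by (elim bexE) (rule that)
  have "pro_eval n x (as_pro_cstar A) (\<lambda>j. f (x j)) = \<phi>"
    by (rule pro_eval_eq[OF A \<phi>(1)]) (use \<phi>(2) in auto)
  with \<phi> show "pro_eval n x (as_pro_cstar A) (\<lambda>j. f (x j)) \<in>
      cont_star_homs (free_pro_cstar (x ` {1..n})) (as_pro_cstar A)"
    and "j \<in> {1..n} \<Longrightarrow>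
      pro_eval n x (as_pro_cstar A) (\<lambda>j. f (x j)) (free_pro_gen (x ` {1..n}) (x j)) = f (x j)"
    by auto
qed

lemma free_pro_hom_compose:
  assumes "\<psi> \<in> star_homs (free_pro_cstar X) A" "\<phi> \<in> star_homs A B"
  shows "compose (carrier (free_pro_cstar X)) \<phi> \<psi> \<in> star_homs (free_pro_cstar X) B"
  using star_homsD[OF assms(1)] star_homsD[OF assms(2)]
  by (intro star_homsI) (simp_all add: compose_def free_pro_simps(1) free_pro_closed)

lemma pro_eval_natural:
  assumes A: "cstar_algebra A" and B: "cstar_algebra B" and \<phi>: "\<phi> \<in> star_homs A B"
    and f: "f \<in> x ` {1..n} \<rightarrow> carrier A"
    and g: "g \<in> carrier (free_pro_cstar (x ` {1..n}))"
    and b: "\<And>j. j \<in> {1..n} \<Longrightarrow> b j = \<phi> (f (x j))"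
  shows "pro_eval n x (as_pro_cstar B) b g = \<phi> (pro_eval n x (as_pro_cstar A) (\<lambda>j. f (x j)) g)"
proof -
  let ?P = "free_pro_cstar (x ` {1..n})"
  let ?e = "pro_eval n x (as_pro_cstar A) (\<lambda>j. f (x j))"
  let ?h = "compose (carrier ?P) \<phi> ?e"
  have e: "?e \<in> star_homs ?P A" "continuous_map (topol ?P) (norm_topology A) ?e"
    using pro_eval_hom[OF A f] unfolding cont_star_homs_def as_pro_cstar_simps by blast+
  have "?h \<in> star_homs ?P B"
    by (rule free_pro_hom_compose[OF e(1) \<phi>])
  moreover have "continuous_map (topol ?P) (norm_topology B) ?h"
    by (rule continuous_map_eq[OF continuous_map_compose[OF e(2) star_hom_continuous[OF A B \<phi>]]])
      (simp add: compose_def topspace_free_pro free_pro_simps)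
  moreover have "?h (free_pro_gen (x ` {1..n}) (x j)) = b j" if j: "j \<in> {1..n}" for j
    using pro_poly_closed[OF free_gen_carrier, of "x j" "x ` {1..n}"] pro_eval_gen[OF A f j] j b[OF j]
    by (simp add: compose_def free_pro_gen_eq free_pro_simps)
  ultimately have "pro_eval n x (as_pro_cstar B) b = ?h"
    by (intro pro_eval_eq[OF B]) (simp_all add: cont_star_homs_def as_pro_cstar_simps)
  then show ?thesis
    using g by (simp add: compose_def)
qed

section \<open>Products of C*-algebras\<close>

text \<open>
  A nonempty family of C*-algebras. Over the empty index set the supremum that defines the norm
  of the product would be unspecified.
\<close>

locale cstar_family =
  fixes \<Lambda> :: "'i set" and A :: "'i \<Rightarrow> 'a cstar_alg"
  assumes nonempty: "\<Lambda> \<noteq> {}"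
    and factor: "i \<in> \<Lambda> \<Longrightarrow> cstar_algebra (A i)"
begin

abbreviation B where "B \<equiv> cstar_prod \<Lambda> A"

lemma factor_star: "i \<in> \<Lambda> \<Longrightarrow> star_algebra (A i)"
  using factor by (simp add: cstar_algebra_def)

lemma factor_norm: "i \<in> \<Lambda> \<Longrightarrow> normed_star_algebra (A i) (nrm (A i))"
  using factor cstar_algebra.axioms by (metis cstar_algebra.seminorm cstar_algebra.norm_eq_zero factor_star
      normed_star_algebra.intro normed_star_algebra_axioms.intro seminormed_star_algebra.intro
      seminormed_star_algebra_axioms.intro)

lemma factor_seminorm: "i \<in> \<Lambda> \<Longrightarrow> seminormed_star_algebra (A i) (nrm (A i))"
  using factor_norm by (simp add: normed_star_algebra_def)

lemma prod_simps:
  "\<zero>\<^bsub>B\<^esub> = (\<lambda>i\<in>\<Lambda>. \<zero>\<^bsub>A i\<^esub>)"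
  "x \<oplus>\<^bsub>B\<^esub> y = (\<lambda>i\<in>\<Lambda>. x i \<oplus>\<^bsub>A i\<^esub> y i)"
  "x \<otimes>\<^bsub>B\<^esub> y = (\<lambda>i\<in>\<Lambda>. x i \<otimes>\<^bsub>A i\<^esub> y i)"
  "c \<odot>\<^bsub>B\<^esub> x = (\<lambda>i\<in>\<Lambda>. c \<odot>\<^bsub>A i\<^esub> x i)"
  "star B x = (\<lambda>i\<in>\<Lambda>. star (A i) (x i))"
  by (simp_all add: cstar_prod_def)

lemma prod_carrier_iff:
  "x \<in> carrier B \<longleftrightarrow> x \<in> extensional \<Lambda> \<and> (\<forall>i\<in>\<Lambda>. x i \<in> carrier (A i)) \<and>
    (\<exists>K. \<forall>i\<in>\<Lambda>. \<parallel>x i\<parallel>\<^bsub>A i\<^esub> \<le> K)"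
  by (auto simp: cstar_prod_def bdd_above_def PiE_iff)

lemma prod_component [simp]: "\<lbrakk>x \<in> carrier B; i \<in> \<Lambda>\<rbrakk> \<Longrightarrow> x i \<in> carrier (A i)"
  by (simp add: prod_carrier_iff)

lemma prod_bound:
  assumes "x \<in> carrier B"
  obtains K where "\<And>i. i \<in> \<Lambda> \<Longrightarrow> \<parallel>x i\<parallel>\<^bsub>A i\<^esub> \<le> K"
  using assms unfolding prod_carrier_iff by blast

lemma prod_carrierI:
  assumes "\<And>i. i \<in> \<Lambda> \<Longrightarrow> f i \<in> carrier (A i)" "\<And>i. i \<in> \<Lambda> \<Longrightarrow> \<parallel>f i\<parallel>\<^bsub>A i\<^esub> \<le> K"
  shows "(\<lambda>i\<in>\<Lambda>. f i) \<in> carrier B"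
  using assms by (auto simp: prod_carrier_iff)

lemma prod_extensional [simp]: "x \<in> carrier B \<Longrightarrow> x \<in> extensional \<Lambda>"
  by (simp add: prod_carrier_iff)

lemma component_le_nrm:
  assumes "x \<in> carrier B" "i \<in> \<Lambda>"
  shows "\<parallel>x i\<parallel>\<^bsub>A i\<^esub> \<le> \<parallel>x\<parallel>\<^bsub>B\<^esub>"
  using assms by (auto simp: cstar_prod_def intro: cSUP_upper)

lemma nrm_prod_le:
  assumes "\<And>i. i \<in> \<Lambda> \<Longrightarrow> \<parallel>x i\<parallel>\<^bsub>A i\<^esub> \<le> K"
  shows "\<parallel>x\<parallel>\<^bsub>B\<^esub> \<le> K"
  using nonempty assms by (auto simp: cstar_prod_def intro: cSUP_least)

lemma
  assumes x: "x \<in> carrier B"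
  shows prod_add_closed: "y \<in> carrier B \<Longrightarrow> x \<oplus>\<^bsub>B\<^esub> y \<in> carrier B"
    and prod_mult_closed: "y \<in> carrier B \<Longrightarrow> x \<otimes>\<^bsub>B\<^esub> y \<in> carrier B"
    and prod_scale_closed: "c \<odot>\<^bsub>B\<^esub> x \<in> carrier B"
    and prod_star_closed: "star B x \<in> carrier B"
proof -
  obtain K where K: "\<And>i. i \<in> \<Lambda> \<Longrightarrow> \<parallel>x i\<parallel>\<^bsub>A i\<^esub> \<le> K"
    using prod_bound[OF x] by blast
  show "c \<odot>\<^bsub>B\<^esub> x \<in> carrier B"
    unfolding prod_simps
  proof (rule prod_carrierI)
    fix i assume i: "i \<in> \<Lambda>"
    interpret Ai: seminormed_star_algebra "A i" "nrm (A i)" by (rule factor_seminorm[OF i])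
    show "c \<odot>\<^bsub>A i\<^esub> x i \<in> carrier (A i)" "\<parallel>c \<odot>\<^bsub>A i\<^esub> x i\<parallel>\<^bsub>A i\<^esub> \<le> cmod c * K"
      using x i K[OF i] by (simp_all add: Ai.p_scale mult_left_mono)
  qed
  show "star B x \<in> carrier B"
    unfolding prod_simps
  proof (rule prod_carrierI)
    fix i assume i: "i \<in> \<Lambda>"
    interpret Ai: seminormed_star_algebra "A i" "nrm (A i)" by (rule factor_seminorm[OF i])
    show "star (A i) (x i) \<in> carrier (A i)" "\<parallel>star (A i) (x i)\<parallel>\<^bsub>A i\<^esub> \<le> K"
      using x i K[OF i] by simp_all
  qed
  assume y: "y \<in> carrier B"
  obtain L where L: "\<And>i. i \<in> \<Lambda> \<Longrightarrow> \<parallel>y i\<parallel>\<^bsub>A i\<^esub> \<le> L"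
    using prod_bound[OF y] by blast
  show "x \<oplus>\<^bsub>B\<^esub> y \<in> carrier B"
    unfolding prod_simps
  proof (rule prod_carrierI)
    fix i assume i: "i \<in> \<Lambda>"
    interpret Ai: seminormed_star_algebra "A i" "nrm (A i)" by (rule factor_seminorm[OF i])
    show "x i \<oplus>\<^bsub>A i\<^esub> y i \<in> carrier (A i)"
      using x y i by simp
    show "\<parallel>x i \<oplus>\<^bsub>A i\<^esub> y i\<parallel>\<^bsub>A i\<^esub> \<le> K + L"
      using Ai.p_add[of "x i" "y i"] x y i K[OF i] L[OF i] by simp
  qed
  show "x \<otimes>\<^bsub>B\<^esub> y \<in> carrier B"
    unfolding prod_simps
  proof (rule prod_carrierI)
    fix i assume i: "i \<in> \<Lambda>"
    interpret Ai: seminormed_star_algebra "A i" "nrm (A i)" by (rule factor_seminorm[OF i])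
    show "x i \<otimes>\<^bsub>A i\<^esub> y i \<in> carrier (A i)"
      using x y i by simp
    have "\<parallel>x i \<otimes>\<^bsub>A i\<^esub> y i\<parallel>\<^bsub>A i\<^esub> \<le> \<parallel>x i\<parallel>\<^bsub>A i\<^esub> * \<parallel>y i\<parallel>\<^bsub>A i\<^esub>"
      using x y i by (simp add: Ai.p_mult)
    also have "\<dots> \<le> K * L"
      using x y i K[OF i] L[OF i] order_trans[OF Ai.p_nonneg K[OF i]] by (intro mult_mono) simp_all
    finally show "\<parallel>x i \<otimes>\<^bsub>A i\<^esub> y i\<parallel>\<^bsub>A i\<^esub> \<le> K * L" .
  qed
qed

lemma star_algebra_prod: "star_algebra B"
proof
  note sa = factor_star
  fix x assume x: "x \<in> carrier B"
  show "\<exists>y\<in>carrier B. x \<oplus>\<^bsub>B\<^esub> y = \<zero>\<^bsub>B\<^esub>"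
  proof (rule bexI[OF _ prod_scale_closed[OF x, of "-1"]])
    have "x i \<oplus>\<^bsub>A i\<^esub> (-1) \<odot>\<^bsub>A i\<^esub> x i = \<zero>\<^bsub>A i\<^esub>" if "i \<in> \<Lambda>" for i
      using star_algebra.minus_self[OF sa[OF that], of "x i"] x that by (simp add: star_minus_def)
    then show "x \<oplus>\<^bsub>B\<^esub> (-1) \<odot>\<^bsub>B\<^esub> x = \<zero>\<^bsub>B\<^esub>"
      by (auto simp: prod_simps intro!: restrict_ext)
  qed
  show "x \<oplus>\<^bsub>B\<^esub> y = y \<oplus>\<^bsub>B\<^esub> x" if y: "y \<in> carrier B" for y
    unfolding prod_simps by (rule restrict_ext) (use x y in \<open>simp add: star_algebra.add_commute[OF factor_star]\<close>)
next
  show "\<zero>\<^bsub>B\<^esub> \<in> carrier B"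
    unfolding prod_simps using star_algebra.zero_closed[OF factor_star]
      seminormed_star_algebra.p_zero[OF factor_seminorm] by (intro prod_carrierI[where K = 0]) simp_all
qed (auto simp: prod_add_closed prod_mult_closed prod_scale_closed prod_star_closed,
  auto intro!: extensionalityI[where A = \<Lambda>] simp: prod_simps
    star_algebra.closed[OF factor_star] star_algebra.add_assoc[OF factor_star]
    star_algebra.add_zero[OF factor_star] star_algebra.scale_add[OF factor_star]
    star_algebra.add_scale[OF factor_star] star_algebra.scale_scale[OF factor_star]
    star_algebra.scale_one[OF factor_star] star_algebra.mult_assoc[OF factor_star]
    star_algebra.mult_add_left[OF factor_star] star_algebra.mult_add_right[OF factor_star]
    star_algebra.mult_scale_left[OF factor_star] star_algebra.mult_scale_right[OF factor_star]
    star_algebra.star_star[OF factor_star] star_algebra.star_add[OF factor_star]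
    star_algebra.star_mult[OF factor_star] star_algebra.star_scale[OF factor_star])

lemma prod_minus: "i \<in> \<Lambda> \<Longrightarrow> (x \<ominus>\<^bsub>B\<^esub> y) i = x i \<ominus>\<^bsub>A i\<^esub> y i"
  by (simp add: star_minus_def prod_simps)

lemma normed_star_algebra_prod: "normed_star_algebra B (nrm B)"
proof -
  interpret B: star_algebra B by (rule star_algebra_prod)
  obtain k where k: "k \<in> \<Lambda>" using nonempty by blast
  note sn = factor_seminorm
  have nonneg: "0 \<le> \<parallel>x\<parallel>\<^bsub>B\<^esub>" if "x \<in> carrier B" for x
    using seminormed_star_algebra.p_nonneg[OF sn[OF k], of "x k"] component_le_nrm[OF that k] that k by simp
  have scale: "\<parallel>c \<odot>\<^bsub>B\<^esub> x\<parallel>\<^bsub>B\<^esub> \<le> cmod c * \<parallel>x\<parallel>\<^bsub>B\<^esub>" if "x \<in> carrier B" for c x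
    by (rule nrm_prod_le)
      (use that component_le_nrm in \<open>simp add: prod_simps seminormed_star_algebra.p_scale[OF sn] mult_left_mono\<close>)
  show ?thesis
  proof
    show "cstar_seminorm B (nrm B)"
      unfolding cstar_seminorm_def
    proof (intro conjI ballI allI)
      fix x assume x: "x \<in> carrier B"
      show "0 \<le> \<parallel>x\<parallel>\<^bsub>B\<^esub>" using nonneg[OF x] .
      show "\<parallel>c \<odot>\<^bsub>B\<^esub> x\<parallel>\<^bsub>B\<^esub> = cmod c * \<parallel>x\<parallel>\<^bsub>B\<^esub>" for c
      proof (cases "c = 0")
        case True
        then show ?thesis
          using scale[OF x, of 0] nonneg[of "0 \<odot>\<^bsub>B\<^esub> x"] x by simp
      next
        case False
        have "\<parallel>x\<parallel>\<^bsub>B\<^esub> \<le> cmod (inverse c) * \<parallel>c \<odot>\<^bsub>B\<^esub> x\<parallel>\<^bsub>B\<^esub>"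
          using scale[of "c \<odot>\<^bsub>B\<^esub> x" "inverse c"] x False by (simp add: B.scale_scale B.scale_one)
        then have "cmod c * \<parallel>x\<parallel>\<^bsub>B\<^esub> \<le> \<parallel>c \<odot>\<^bsub>B\<^esub> x\<parallel>\<^bsub>B\<^esub>"
          using False by (simp add: norm_inverse norm_divide field_simps)
        with scale[OF x, of c] show ?thesis by simp
      qed
      show "\<parallel>star B x \<otimes>\<^bsub>B\<^esub> x\<parallel>\<^bsub>B\<^esub> = \<parallel>x\<parallel>\<^bsub>B\<^esub>\<^sup>2"
      proof (rule antisym)
        have comp: "\<parallel>(star B x \<otimes>\<^bsub>B\<^esub> x) i\<parallel>\<^bsub>A i\<^esub> = \<parallel>x i\<parallel>\<^bsub>A i\<^esub>\<^sup>2" if "i \<in> \<Lambda>" for i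
          using that x by (simp add: prod_simps seminormed_star_algebra.p_star_mult[OF sn])
        show "\<parallel>star B x \<otimes>\<^bsub>B\<^esub> x\<parallel>\<^bsub>B\<^esub> \<le> \<parallel>x\<parallel>\<^bsub>B\<^esub>\<^sup>2"
        proof (rule nrm_prod_le)
          fix i assume i: "i \<in> \<Lambda>"
          show "\<parallel>(star B x \<otimes>\<^bsub>B\<^esub> x) i\<parallel>\<^bsub>A i\<^esub> \<le> \<parallel>x\<parallel>\<^bsub>B\<^esub>\<^sup>2"
            unfolding comp[OF i] using seminormed_star_algebra.p_nonneg[OF sn[OF i], of "x i"]
              component_le_nrm[OF x i] x i by (intro power_mono) simp_all
        qed
        have "\<parallel>x\<parallel>\<^bsub>B\<^esub> \<le> sqrt \<parallel>star B x \<otimes>\<^bsub>B\<^esub> x\<parallel>\<^bsub>B\<^esub>"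
        proof (rule nrm_prod_le)
          fix i assume i: "i \<in> \<Lambda>"
          show "\<parallel>x i\<parallel>\<^bsub>A i\<^esub> \<le> sqrt \<parallel>star B x \<otimes>\<^bsub>B\<^esub> x\<parallel>\<^bsub>B\<^esub>"
            using component_le_nrm[of "star B x \<otimes>\<^bsub>B\<^esub> x" i] x i comp[OF i] by (intro real_le_rsqrt) simp
        qed
        then show "\<parallel>x\<parallel>\<^bsub>B\<^esub>\<^sup>2 \<le> \<parallel>star B x \<otimes>\<^bsub>B\<^esub> x\<parallel>\<^bsub>B\<^esub>"
          using nonneg[OF x] by (metis abs_of_nonneg order_trans real_sqrt_le_iff real_sqrt_abs)
      qed
      fix y assume y: "y \<in> carrier B"
      show "\<parallel>x \<oplus>\<^bsub>B\<^esub> y\<parallel>\<^bsub>B\<^esub> \<le> \<parallel>x\<parallel>\<^bsub>B\<^esub> + \<parallel>y\<parallel>\<^bsub>B\<^esub>"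
      proof (rule nrm_prod_le)
        fix i assume i: "i \<in> \<Lambda>"
        show "\<parallel>(x \<oplus>\<^bsub>B\<^esub> y) i\<parallel>\<^bsub>A i\<^esub> \<le> \<parallel>x\<parallel>\<^bsub>B\<^esub> + \<parallel>y\<parallel>\<^bsub>B\<^esub>"
          using seminormed_star_algebra.p_add[OF sn[OF i], of "x i" "y i"] x y i
            component_le_nrm[OF x i] component_le_nrm[OF y i] by (simp add: prod_simps)
      qed
      show "\<parallel>x \<otimes>\<^bsub>B\<^esub> y\<parallel>\<^bsub>B\<^esub> \<le> \<parallel>x\<parallel>\<^bsub>B\<^esub> * \<parallel>y\<parallel>\<^bsub>B\<^esub>"
      proof (rule nrm_prod_le)
        fix i assume i: "i \<in> \<Lambda>"
        interpret Ai: seminormed_star_algebra "A i" "nrm (A i)" by (rule sn[OF i])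
        have "\<parallel>(x \<otimes>\<^bsub>B\<^esub> y) i\<parallel>\<^bsub>A i\<^esub> \<le> \<parallel>x i\<parallel>\<^bsub>A i\<^esub> * \<parallel>y i\<parallel>\<^bsub>A i\<^esub>"
          using x y i by (simp add: prod_simps Ai.p_mult)
        also have "\<dots> \<le> \<parallel>x\<parallel>\<^bsub>B\<^esub> * \<parallel>y\<parallel>\<^bsub>B\<^esub>"
          using x y i nonneg[OF x] by (intro mult_mono component_le_nrm) simp_all
        finally show "\<parallel>(x \<otimes>\<^bsub>B\<^esub> y) i\<parallel>\<^bsub>A i\<^esub> \<le> \<parallel>x\<parallel>\<^bsub>B\<^esub> * \<parallel>y\<parallel>\<^bsub>B\<^esub>" .
      qed
    qed
    fix x assume x: "x \<in> carrier B" "\<parallel>x\<parallel>\<^bsub>B\<^esub> = 0"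
    show "x = \<zero>\<^bsub>B\<^esub>"
    proof (rule extensionalityI[where A = \<Lambda>])
      fix i assume i: "i \<in> \<Lambda>"
      interpret Ai: normed_star_algebra "A i" "nrm (A i)" by (rule factor_norm[OF i])
      have "\<parallel>x i\<parallel>\<^bsub>A i\<^esub> = 0"
        using component_le_nrm[OF x(1) i] Ai.p_nonneg[OF prod_component[OF x(1) i]] x(2) by linarith
      then show "x i = \<zero>\<^bsub>B\<^esub> i"
        using Ai.p_eq_zero[of "x i"] x(1) i by (simp add: prod_simps)
    qed (use x in \<open>simp_all add: prod_simps\<close>)
  qed
qed

theorem cstar_algebra_prod: "cstar_algebra B"
proof (rule cstar_algebraI)
  show "normed_star_algebra B (nrm B)" by (rule normed_star_algebra_prod)
  then interpret B: normed_star_algebra B "nrm B" .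
  fix s
  assume s: "s \<in> cauchy_seqs B (nrm B)"
  then have sc: "s n \<in> carrier B" for n by simp
  have comp: "\<parallel>s m i \<ominus>\<^bsub>A i\<^esub> s n i\<parallel>\<^bsub>A i\<^esub> \<le> \<parallel>s m \<ominus>\<^bsub>B\<^esub> s n\<parallel>\<^bsub>B\<^esub>" if "i \<in> \<Lambda>" for i m n
    using component_le_nrm[of "s m \<ominus>\<^bsub>B\<^esub> s n" i] that sc by (simp add: prod_minus)
  have "\<exists>a\<in>carrier (A i). (\<lambda>n. \<parallel>s n i \<ominus>\<^bsub>A i\<^esub> a\<parallel>\<^bsub>A i\<^esub>) \<longlonglongrightarrow> 0" if i: "i \<in> \<Lambda>" for i
  proof -
    interpret Ai: cstar_algebra "A i" by (rule factor[OF i])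
    have "(\<lambda>n. s n i) \<in> cauchy_seqs (A i) (nrm (A i))"
    proof (rule Ai.cauchy_seqsI)
      show "((\<lambda>j. \<parallel>s (fst j) i \<ominus>\<^bsub>A i\<^esub> s (snd j) i\<parallel>\<^bsub>A i\<^esub>) \<longlongrightarrow> 0) (sequentially \<times>\<^sub>F sequentially)"
        by (rule null_if_le[OF B.cauchy_seqs_null[OF s]]) (use sc i comp[OF i] in simp_all)
    qed (use sc i in simp)
    then show ?thesis by (rule Ai.convergent)
  qed
  then obtain a where a: "\<And>i. i \<in> \<Lambda> \<Longrightarrow> a i \<in> carrier (A i)"
    "\<And>i. i \<in> \<Lambda> \<Longrightarrow> (\<lambda>n. \<parallel>s n i \<ominus>\<^bsub>A i\<^esub> a i\<parallel>\<^bsub>A i\<^esub>) \<longlonglongrightarrow> 0"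
    by metis
  \<comment> \<open>The coordinates converge at a common rate, so their limits form a bounded family.\<close>
  have uniform: "\<exists>N. \<forall>m\<ge>N. \<forall>i\<in>\<Lambda>. \<parallel>s m i \<ominus>\<^bsub>A i\<^esub> a i\<parallel>\<^bsub>A i\<^esub> \<le> e" if "0 < e" for e
  proof -
    obtain N where N: "\<And>m n. m \<ge> N \<Longrightarrow> n \<ge> N \<Longrightarrow> \<parallel>s m \<ominus>\<^bsub>B\<^esub> s n\<parallel>\<^bsub>B\<^esub> < e"
      using B.cauchy_seqsD[OF s \<open>0 < e\<close>] by metis
    have "\<parallel>s m i \<ominus>\<^bsub>A i\<^esub> a i\<parallel>\<^bsub>A i\<^esub> \<le> e" if m: "m \<ge> N" and i: "i \<in> \<Lambda>" for m i
    proof (rule LIMSEQ_le_const)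
      interpret Ai: normed_star_algebra "A i" "nrm (A i)" by (rule factor_norm[OF i])
      show "(\<lambda>n. e + \<parallel>s n i \<ominus>\<^bsub>A i\<^esub> a i\<parallel>\<^bsub>A i\<^esub>) \<longlonglongrightarrow> e"
        using tendsto_add[OF tendsto_const a(2)[OF i], of e] by simp
      have "\<parallel>s m i \<ominus>\<^bsub>A i\<^esub> a i\<parallel>\<^bsub>A i\<^esub> \<le> e + \<parallel>s n i \<ominus>\<^bsub>A i\<^esub> a i\<parallel>\<^bsub>A i\<^esub>" if n: "n \<ge> N" for n
        using Ai.p_triangle[of "s m i" "s n i" "a i"] comp[OF i, of m n] N[OF m n] sc i a(1)[OF i]
        by simp
      then show "\<exists>N. \<forall>n\<ge>N. \<parallel>s m i \<ominus>\<^bsub>A i\<^esub> a i\<parallel>\<^bsub>A i\<^esub> \<le> e + \<parallel>s n i \<ominus>\<^bsub>A i\<^esub> a i\<parallel>\<^bsub>A i\<^esub>"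
        by blast
    qed
    then show ?thesis by blast
  qed
  define b where "b = (\<lambda>i\<in>\<Lambda>. a i)"
  have b: "b \<in> carrier B"
  proof -
    obtain N where N: "\<And>i. i \<in> \<Lambda> \<Longrightarrow> \<parallel>s N i \<ominus>\<^bsub>A i\<^esub> a i\<parallel>\<^bsub>A i\<^esub> \<le> 1"
      using uniform[of 1] by auto
    show ?thesis
      unfolding b_def
    proof (rule prod_carrierI)
      fix i assume i: "i \<in> \<Lambda>"
      interpret Ai: normed_star_algebra "A i" "nrm (A i)" by (rule factor_norm[OF i])
      show "a i \<in> carrier (A i)" by (rule a(1)[OF i])
      show "\<parallel>a i\<parallel>\<^bsub>A i\<^esub> \<le> \<parallel>s N\<parallel>\<^bsub>B\<^esub> + 1"
        using Ai.p_abs_diff[of "s N i" "a i"] N[OF i] component_le_nrm[OF sc i, of N] sc i a(1)[OF i] by simp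
    qed
  qed
  have "(\<lambda>n. \<parallel>s n \<ominus>\<^bsub>B\<^esub> b\<parallel>\<^bsub>B\<^esub>) \<longlonglongrightarrow> 0"
  proof (rule LIMSEQ_I)
    fix e :: real
    assume "0 < e"
    then obtain N where N: "\<And>m i. m \<ge> N \<Longrightarrow> i \<in> \<Lambda> \<Longrightarrow> \<parallel>s m i \<ominus>\<^bsub>A i\<^esub> a i\<parallel>\<^bsub>A i\<^esub> \<le> e / 2"
      using uniform[of "e / 2"] by auto
    have "\<parallel>s m \<ominus>\<^bsub>B\<^esub> b\<parallel>\<^bsub>B\<^esub> \<le> e / 2" if "m \<ge> N" for m
      by (rule nrm_prod_le) (use N[OF that] in \<open>simp add: prod_minus b_def\<close>)
    then have "norm (\<parallel>s m \<ominus>\<^bsub>B\<^esub> b\<parallel>\<^bsub>B\<^esub> - 0) < e" if "m \<ge> N" for m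
      using that \<open>0 < e\<close> sc b by (simp add: le_less_trans[of _ "e / 2" e])
    then show "\<exists>N. \<forall>m\<ge>N. norm (\<parallel>s m \<ominus>\<^bsub>B\<^esub> b\<parallel>\<^bsub>B\<^esub> - 0) < e" by blast
  qed
  with b show "\<exists>b\<in>carrier B. (\<lambda>n. \<parallel>s n \<ominus>\<^bsub>B\<^esub> b\<parallel>\<^bsub>B\<^esub>) \<longlonglongrightarrow> 0" by blast
qed

lemma proj_hom: "i \<in> \<Lambda> \<Longrightarrow> (\<lambda>x\<in>carrier B. x i) \<in> star_homs B (A i)"
  by (rule star_homsI)
    (simp_all add: prod_add_closed prod_mult_closed prod_scale_closed prod_star_closed,
      simp_all add: prod_simps)

end

section \<open>The relation \<open>g = 0\<close>\<close>

lemma zero_relation_iff: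
  "(f, A) \<in> zero_relation n x g \<longleftrightarrow> cstar_algebra A \<and> f \<in> x ` {1..n} \<rightarrow>\<^sub>E carrier A \<and>
    pro_eval n x (as_pro_cstar A) (\<lambda>j. f (x j)) g = \<zero>\<^bsub>A\<^esub>"
  by (auto simp: zero_relation_def fx_objects_def)

lemma pro_eval_closed:
  assumes "cstar_algebra A" "f \<in> x ` {1..n} \<rightarrow> carrier A" "g \<in> carrier (free_pro_cstar (x ` {1..n}))"
  shows "pro_eval n x (as_pro_cstar A) (\<lambda>j. f (x j)) g \<in> carrier A"
proof -
  have "pro_eval n x (as_pro_cstar A) (\<lambda>j. f (x j)) \<in> star_homs (free_pro_cstar (x ` {1..n})) A"
    using pro_eval_hom[OF assms(1,2)] unfolding cont_star_homs_def as_pro_cstar_simps by blast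
  from star_homsD(1)[OF this assms(3)] show ?thesis .
qed

lemma zero_relation_C1:
  assumes "g \<in> carrier (free_pro_cstar (x ` {1..n}))"
  shows "axiom_C1 (x ` {1..n}) (zero_relation n x g)"
  unfolding axiom_C1_def
proof (intro allI impI, elim conjE)
  fix A :: "'b cstar_alg"
  assume A: "cstar_algebra A" and zero: "carrier A = {\<zero>\<^bsub>A\<^esub>}"
  let ?f = "\<lambda>y\<in>x ` {1..n}. \<zero>\<^bsub>A\<^esub>"
  have f: "?f \<in> x ` {1..n} \<rightarrow>\<^sub>E carrier A"
    using zero by auto
  have "pro_eval n x (as_pro_cstar A) (\<lambda>j. ?f (x j)) g \<in> carrier A"
    by (rule pro_eval_closed[OF A _ assms]) (use f in auto)
  with A f zero show "(?f, A) \<in> zero_relation n x g"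
    unfolding zero_relation_iff by blast
qed

lemma zero_relation_C2:
  assumes g: "g \<in> carrier (free_pro_cstar (x ` {1..n}))"
  shows "axiom_C2 (x ` {1..n}) (zero_relation n x g) (zero_relation n x g)"
  unfolding axiom_C2_def
proof (intro allI impI, elim conjE)
  fix A :: "'b cstar_alg" and B :: "'c cstar_alg" and \<phi> f
  assume A: "cstar_algebra A" and B: "cstar_algebra B" and \<phi>: "\<phi> \<in> star_homs A B"
    and inj: "inj_on \<phi> (carrier A)" and f: "f \<in> x ` {1..n} \<rightarrow>\<^sub>E carrier A"
    and zero: "(compose (x ` {1..n}) \<phi> f, B) \<in> zero_relation n x g"
  interpret A: cstar_algebra A by fact
  interpret B: cstar_algebra B by fact
  have f': "f \<in> x ` {1..n} \<rightarrow> carrier A" using f by (simp add: PiE_iff Pi_iff)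
  let ?a = "pro_eval n x (as_pro_cstar A) (\<lambda>j. f (x j)) g"
  have "\<phi> ?a = pro_eval n x (as_pro_cstar B) (\<lambda>j. compose (x ` {1..n}) \<phi> f (x j)) g"
    by (rule pro_eval_natural[OF A B \<phi> f' g, symmetric]) (simp add: compose_def)
  also have "\<dots> = \<phi> \<zero>\<^bsub>A\<^esub>"
    using zero star_hom_zero[OF A.star_algebra_axioms B.star_algebra_axioms \<phi>] by (simp add: zero_relation_iff)
  finally have "?a = \<zero>\<^bsub>A\<^esub>"
    using inj pro_eval_closed[OF A f' g] A.zero_closed by (meson inj_onD)
  with A f show "(f, A) \<in> zero_relation n x g"
    by (simp add: zero_relation_iff)
qed

lemma zero_relation_C3:
  assumes g: "g \<in> carrier (free_pro_cstar (x ` {1..n}))"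
  shows "axiom_C3 (x ` {1..n}) (zero_relation n x g) (zero_relation n x g)"
  unfolding axiom_C3_def
proof (intro allI impI, elim conjE)
  fix A :: "'b cstar_alg" and B :: "'c cstar_alg" and \<phi> f
  assume A: "cstar_algebra A" and B: "cstar_algebra B" and \<phi>: "\<phi> \<in> star_homs A B"
    and zero: "(f, A) \<in> zero_relation n x g"
  interpret A: cstar_algebra A by fact
  interpret B: cstar_algebra B by fact
  have f: "f \<in> x ` {1..n} \<rightarrow> carrier A" using zero by (simp add: zero_relation_iff PiE_iff Pi_iff)
  have "pro_eval n x (as_pro_cstar B) (\<lambda>j. compose (x ` {1..n}) \<phi> f (x j)) g =
      \<phi> (pro_eval n x (as_pro_cstar A) (\<lambda>j. f (x j)) g)"
    by (rule pro_eval_natural[OF A B \<phi> f g]) (simp add: compose_def)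
  also have "\<dots> = \<zero>\<^bsub>B\<^esub>"
    using zero star_hom_zero[OF A.star_algebra_axioms B.star_algebra_axioms \<phi>] by (simp add: zero_relation_iff)
  finally show "(compose (x ` {1..n}) \<phi> f, B) \<in> zero_relation n x g"
    using B f star_homsD(1)[OF \<phi>] by (auto simp: zero_relation_iff compose_def)
qed

text \<open>Zeros in a product are detected by the coordinate projections, which are *-homomorphisms.\<close>

lemma zero_relation_prod:
  assumes g: "g \<in> carrier (free_pro_cstar (x ` {1..n}))" and ne: "\<Lambda> \<noteq> {}"
    and zero: "\<And>i. i \<in> \<Lambda> \<Longrightarrow> (f i, A i) \<in> zero_relation n x g"
    and bdd: "\<And>y. y \<in> x ` {1..n} \<Longrightarrow> bdd_above ((\<lambda>i. \<parallel>f i y\<parallel>\<^bsub>A i\<^esub>) ` \<Lambda>)"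
  shows "(prod_map (x ` {1..n}) \<Lambda> f, cstar_prod \<Lambda> A) \<in> zero_relation n x g"
proof -
  interpret cstar_family \<Lambda> A
    by (rule cstar_family.intro) (use ne zero in \<open>auto simp: zero_relation_iff\<close>)
  let ?h = "prod_map (x ` {1..n}) \<Lambda> f"
  have fc: "f i y \<in> carrier (A i)" if "i \<in> \<Lambda>" "y \<in> x ` {1..n}" for i y
    using zero[OF that(1)] that(2) by (auto simp: zero_relation_iff)
  have h: "?h y \<in> carrier B" if y: "y \<in> x ` {1..n}" for y
  proof -
    obtain K where "\<And>i. i \<in> \<Lambda> \<Longrightarrow> \<parallel>f i y\<parallel>\<^bsub>A i\<^esub> \<le> K"
      using bdd[OF y] by (auto simp: bdd_above_def)
    then have "(\<lambda>i\<in>\<Lambda>. f i y) \<in> carrier B"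
      using fc y by (intro prod_carrierI)
    with y show ?thesis by (simp add: prod_map_def)
  qed
  then have h': "?h \<in> x ` {1..n} \<rightarrow> carrier B" by blast
  let ?e = "pro_eval n x (as_pro_cstar B) (\<lambda>j. ?h (x j)) g"
  have e: "?e \<in> carrier B"
    by (rule pro_eval_closed[OF cstar_algebra_prod h' g])
  have "?e = \<zero>\<^bsub>B\<^esub>"
  proof (rule extensionalityI[where A = \<Lambda>])
    fix i assume i: "i \<in> \<Lambda>"
    have "pro_eval n x (as_pro_cstar (A i)) (\<lambda>j. f i (x j)) g = (\<lambda>u\<in>carrier B. u i) ?e"
      by (rule pro_eval_natural[OF cstar_algebra_prod factor[OF i] proj_hom[OF i] h' g])
        (use i h in \<open>simp add: prod_map_def\<close>)
    then show "?e i = \<zero>\<^bsub>B\<^esub> i"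
      using zero[OF i] e i by (simp add: zero_relation_iff prod_simps)
  qed (use e in \<open>simp_all add: prod_simps\<close>)
  moreover have "?h \<in> extensional (x ` {1..n})"
    by (simp add: prod_map_def)
  ultimately show ?thesis
    using cstar_algebra_prod h by (auto simp: zero_relation_iff PiE_iff)
qed

theorem theorem6p4:
  fixes n :: nat and x :: "nat \<Rightarrow> 'x" and g :: "'x pro_elem"
  assumes "inj_on x {1..n}"
    and "g \<in> carrier (free_pro_cstar (x ` {1..n}))"
  shows "closed_cstar_relation (x ` {1..n})
    (zero_relation n x g :: ('x, 'a) fx_object set)
    (zero_relation n x g :: ('x, 'b) fx_object set)
    (zero_relation n x g :: ('x, nat \<Rightarrow> 'a) fx_object set)
    (zero_relation n x g :: ('x, 'i \<Rightarrow> 'a) fx_object set)"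
  unfolding closed_cstar_relation_def cstar_relation_def
proof (intro conjI)
  note g = assms(2)
  show "(zero_relation n x g :: ('x, 'a) fx_object set) \<subseteq> fx_objects (x ` {1..n})"
    by (auto simp: zero_relation_def)
  show "axiom_C1 (x ` {1..n}) (zero_relation n x g :: ('x, 'a) fx_object set)"
    by (rule zero_relation_C1[OF g])
  show "axiom_C2 (x ` {1..n}) (zero_relation n x g :: ('x, 'a) fx_object set)
      (zero_relation n x g :: ('x, 'b) fx_object set)"
    by (rule zero_relation_C2[OF g])
  show "axiom_C3 (x ` {1..n}) (zero_relation n x g :: ('x, 'a) fx_object set)
      (zero_relation n x g :: ('x, 'b) fx_object set)"
    by (rule zero_relation_C3[OF g])
  show "axiom_C4f (x ` {1..n}) (zero_relation n x g :: ('x, 'a) fx_object set)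
      (zero_relation n x g :: ('x, nat \<Rightarrow> 'a) fx_object set)"
    unfolding axiom_C4f_def
  proof (intro allI impI, elim conjE)
    fix m :: nat and f and A :: "nat \<Rightarrow> 'a cstar_alg"
    assume "m \<ge> 1" and zero: "\<forall>j\<in>{1..m}. (f j, A j) \<in> zero_relation n x g"
    show "(prod_map (x ` {1..n}) {1..m} f, cstar_prod {1..m} A) \<in> zero_relation n x g"
      by (rule zero_relation_prod[OF g _ bspec[OF zero]]) (use \<open>m \<ge> 1\<close> in auto)
  qed
  show "axiom_C4b (x ` {1..n}) (zero_relation n x g :: ('x, 'a) fx_object set)
      (zero_relation n x g :: ('x, 'i \<Rightarrow> 'a) fx_object set)"
    unfolding axiom_C4b_def
  proof (intro allI impI, elim conjE)
    fix \<Lambda> :: "'i set" and f and A :: "'i \<Rightarrow> 'a cstar_alg"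
    assume "\<Lambda> \<noteq> {}" and zero: "\<forall>i\<in>\<Lambda>. (f i, A i) \<in> zero_relation n x g"
      and bdd: "\<forall>y\<in>x ` {1..n}. bdd_above ((\<lambda>i. \<parallel>f i y\<parallel>\<^bsub>A i\<^esub>) ` \<Lambda>)"
    show "(prod_map (x ` {1..n}) \<Lambda> f, cstar_prod \<Lambda> A) \<in> zero_relation n x g"
      by (rule zero_relation_prod[OF g \<open>\<Lambda> \<noteq> {}\<close> bspec[OF zero] bspec[OF bdd]])
  qed
qed

end
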